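(* Let $V$ be a vector space over a field $\mathbb{F}$, let $a,b\in{\rm L}(V)$ and suppose that $$(a^* )^{\prime\prime}=\{c^*:\, c\in (a)^{\prime\prime}\}.$$ If $b\in (a)^{\prime\prime}$, then $d_b({\rm L}(V))\subseteq d_a({\rm L}(V))$.
   Context: ${\rm L}(V)$ is the algebra of all linear operators on $V$, and $V^*$ the vector space of all linear functionals on $V$. For $a\in{\rm L}(V)$, $a^*\in{\rm L}(V^* )$ is the adjoint, $a^*(\rho)=\rho\circ a$, and $d_a:{\rm L}(V)\to{\rm L}(V)$ is the derivation $d_a(x)=ax-xa$. For an operator $a$, $(a)^{\prime}$ is its commutant (the set of all linear operators on the same space commuting with $a$) and $(a)^{\prime\prime}$ its bicommutant (the set of all linear operators on the same space commuting with every element of $(a)^{\prime}$); for $a$ these are taken in ${\rm L}(V)$ and for $a^*$ in ${\rm L}(V^* )$. *)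

theory Defs
  imports Complex_Main "HOL-Library.FuncSet"
begin

text \<open>
  The vector space \<open>V\<close> is a whole type \<open>'v\<close> with an explicit scalar multiplication; no
  finite-dimensionality is involved.  Its dual \<open>V\<^sup>*\<close> is a proper subset of \<open>'v \<Rightarrow> 'f\<close>, so operators
  on \<open>V\<^sup>*\<close> are represented by extensional functions (\<open>undefined\<close> outside the dual), which makes
  equality of HOL functions coincide with equality of operators.
\<close>

definition linops :: "('f::field \<Rightarrow> 'v::ab_group_add \<Rightarrow> 'v) \<Rightarrow> ('v \<Rightarrow> 'v) set" where
  "linops scale = {x. Vector_Spaces.linear scale scale x}"

definition dual :: "('f::field \<Rightarrow> 'v::ab_group_add \<Rightarrow> 'v) \<Rightarrow> ('v \<Rightarrow> 'f) set" where
  "dual scale = {\<rho>. Vector_Spaces.linear scale (*) \<rho>}"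

definition dual_linops ::
    "('f::field \<Rightarrow> 'v::ab_group_add \<Rightarrow> 'v) \<Rightarrow> (('v \<Rightarrow> 'f) \<Rightarrow> ('v \<Rightarrow> 'f)) set" where
  "dual_linops scale =
     {T \<in> dual scale \<rightarrow>\<^sub>E dual scale.
        (\<forall>\<rho>\<in>dual scale. \<forall>\<sigma>\<in>dual scale. T (\<lambda>v. \<rho> v + \<sigma> v) = (\<lambda>v. T \<rho> v + T \<sigma> v)) \<and>
        (\<forall>k. \<forall>\<rho>\<in>dual scale. T (\<lambda>v. k * \<rho> v) = (\<lambda>v. k * T \<rho> v))}"

definition adjoint ::
    "('f::field \<Rightarrow> 'v::ab_group_add \<Rightarrow> 'v) \<Rightarrow> ('v \<Rightarrow> 'v) \<Rightarrow> ('v \<Rightarrow> 'f) \<Rightarrow> ('v \<Rightarrow> 'f)" where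
  "adjoint scale a = (\<lambda>\<rho>\<in>dual scale. \<rho> \<circ> a)"

text \<open>
  Commutant of \<open>A\<close> within the set \<open>L\<close> of all linear operators on the space with carrier \<open>W\<close>.
  Commutation is tested on \<open>W\<close> only, because extensional functions are irrelevant outside it.
\<close>

definition commutant :: "'w set \<Rightarrow> ('w \<Rightarrow> 'w) set \<Rightarrow> ('w \<Rightarrow> 'w) set \<Rightarrow> ('w \<Rightarrow> 'w) set" where
  "commutant W L A = {T \<in> L. \<forall>S\<in>A. \<forall>w\<in>W. T (S w) = S (T w)}"

definition bicommutant :: "'w set \<Rightarrow> ('w \<Rightarrow> 'w) set \<Rightarrow> ('w \<Rightarrow> 'w) \<Rightarrow> ('w \<Rightarrow> 'w) set" where
  "bicommutant W L a = commutant W L (commutant W L {a})"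

definition derivation :: "('v \<Rightarrow> 'v) \<Rightarrow> ('v \<Rightarrow> 'v) \<Rightarrow> ('v \<Rightarrow> 'v::ab_group_add)" where
  "derivation a x = (\<lambda>v. (a \<circ> x) v - (x \<circ> a) v)"

end

theory Submission
  imports Defs "HOL-Computational_Algebra.Polynomial_Factorial" "HOL-Library.Function_Algebras"
begin

text \<open>
  View \<open>V\<close> as a module over the polynomial ring, the variable \<open>t\<close> acting as \<open>a\<close>.  If \<open>b = f(a)\<close>, then
  \<open>[b, x] = [a, z]\<close> where \<open>z\<close> is the divided difference of \<open>f\<close> with \<open>a\<close> acting on both sides of \<open>x\<close>.
  The proof shows that the hypothesis forces every \<open>b\<close> in the bicommutant to be close enough to a
  polynomial in \<open>a\<close> for this to survive.

  For \<open>c\<close> in the bicommutant of \<open>a\<close> the adjoint of \<open>c\<close> lies in the bicommutant of the adjoint of \<open>a\<close>.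
  Operators on the dual are the functionals on \<open>V \<otimes> V*\<close>, and those commuting with the adjoint of \<open>a\<close> are
  the ones vanishing on all \<open>a y \<otimes> s - y \<otimes> s a\<close>.  So the hypothesis says that \<open>c v \<otimes> r - v \<otimes> r c\<close> is a finite
  sum of such tensors (\<open>locally_central_of_adjoint\<close>).  As only finitely many \<open>y\<close> occur, \<open>c\<close> can be
  tested against operators that commute with \<open>a\<close> on a finite set only (\<open>locally_centralE\<close>), and such
  operators are easy to construct, whereas module endomorphisms may be scarce.

  Suppose that \<open>V\<close> is a torsion module.  Testing with local homomorphisms between primary vectors shows
  that a finite rank operator \<open>T\<close> with \<open>tr (a^k T) = 0\<close> for all \<open>k\<close> satisfies \<open>tr (b T) = 0\<close>
  (\<open>trace_determined_torsion\<close>).  Hence \<open>tr (b T)\<close> is a linear functional \<open>L\<close> of the sequence of the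
  \<open>tr (a^k T)\<close>, and \<open>z\<close> is obtained by applying \<open>L\<close> to the divided differences of the powers \<open>t^m\<close>
  (\<open>range_contained_torsion\<close>).

  Suppose that some vector \<open>v0\<close> is not torsion.  Mapping \<open>v0\<close> to an arbitrary vector by a local
  homomorphism and using that a module whose dual is torsion has a bounded annihilator
  (\<open>dual_torsion_bounded\<close>) one finds that \<open>b\<close> is a fraction: \<open>f(a) b = h(a)\<close> with \<open>f \<noteq> 0\<close>
  (\<open>bicomm_is_fraction\<close>).  The irreducible factors \<open>p\<close> of \<open>f\<close> are then removed one by one
  (\<open>range_contained_fraction\<close>).  Either \<open>p\<close> cancels, or \<open>p(a)\<close> has finite ascent and descent
  (\<open>drazin_of_ker_prime\<close>).  In that case \<open>V\<close> is the direct sum of the kernel and the range of some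
  \<open>p(a)^n\<close>; on the kernel \<open>b\<close> is a polynomial in \<open>a\<close>, and on the range \<open>p(a)\<close> is invertible.  The
  operators \<open>c\<close> with \<open>[c, L(V)] \<subseteq> [a, L(V)]\<close> form an algebra, and this algebra contains the Drazin
  inverse of \<open>p(a)^n\<close> (\<open>range_contained_drazin\<close>), so that \<open>b\<close> lies in it as soon as \<open>p(a) b\<close> does.
\<close>

section \<open>Polynomials over a field\<close>

lemma poly_ideal_generator:
  fixes J :: "'f::field poly set"
  assumes add: "\<And>h k. h \<in> J \<Longrightarrow> k \<in> J \<Longrightarrow> h + k \<in> J"
    and mult: "\<And>q h. h \<in> J \<Longrightarrow> q * h \<in> J"
    and ne: "h0 \<in> J" "h0 \<noteq> 0"
  obtains g where "g \<in> J" "g \<noteq> 0" "\<And>h. h \<in> J \<Longrightarrow> g dvd h"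
proof -
  define g where "g = arg_min degree (\<lambda>h. h \<in> J \<and> h \<noteq> 0)"
  have g: "g \<in> J" "g \<noteq> 0" and min: "\<And>h. h \<in> J \<Longrightarrow> h \<noteq> 0 \<Longrightarrow> degree g \<le> degree h"
    using arg_min_nat_lemma[of "\<lambda>h. h \<in> J \<and> h \<noteq> 0" h0 degree] ne unfolding g_def by auto
  have "g dvd h" if h: "h \<in> J" for h
  proof -
    have "h mod g = h + (- (h div g)) * g"
      by (simp add: minus_div_mult_eq_mod[symmetric])
    then have "h mod g \<in> J" using add[OF h mult[OF g(1)]] by metis
    then have "h mod g = 0" using min[of "h mod g"] degree_mod_less[OF g(2), of h] by fastforce
    then show ?thesis by auto
  qed
  with g that show thesis by blast
qed

lemma irreducible_coprime_bezout:
  fixes p h :: "'f::field poly"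
  assumes p: "irreducible p" and nd: "\<not> p dvd h"
  obtains u v where "u * p + v * h = 1"
proof -
  define J where "J = {u * p + v * h | u v. True}"
  have add: "x + y \<in> J" if xy: "x \<in> J" "y \<in> J" for x y
  proof -
    obtain u v u' v' where "x = u * p + v * h" "y = u' * p + v' * h" using xy J_def by auto
    then have "x + y = (u + u') * p + (v + v') * h" by (simp add: algebra_simps)
    then show ?thesis unfolding J_def by blast
  qed
  have mult: "q * x \<in> J" if x: "x \<in> J" for q x
  proof -
    obtain u v where "x = u * p + v * h" using x J_def by auto
    then have "q * x = (q * u) * p + (q * v) * h" by (simp add: algebra_simps)
    then show ?thesis unfolding J_def by blast
  qed
  have "p = 1 * p + 0 * h" "h = 0 * p + 1 * h" by simp_all
  then have pJ: "p \<in> J" and hJ: "h \<in> J" unfolding J_def by blast+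
  have "p \<noteq> 0" using p by auto
  obtain g where g: "g \<in> J" "\<And>x. x \<in> J \<Longrightarrow> g dvd x"
    using poly_ideal_generator[of J p, OF add mult pJ \<open>p \<noteq> 0\<close>] by metis
  have "g dvd p" "g dvd h" using g pJ hJ by auto
  moreover have "\<not> p dvd g" using nd \<open>g dvd h\<close> dvd_trans by blast
  ultimately have "g dvd 1" using irreducibleD'[OF p] by blast
  then obtain k where "1 = k * g" by (metis dvdE mult.commute)
  then have "1 \<in> J" using mult[OF g(1)] by metis
  then show thesis using that unfolding J_def by auto
qed

lemma irreducible_power_bezout:
  fixes p h :: "'f::field poly"
  assumes p: "irreducible p" and nd: "\<not> p dvd h"
  obtains u v where "u * p ^ n + v * h = 1"
proof -
  obtain u v where uv: "u * p + v * h = 1" using irreducible_coprime_bezout[OF assms] .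
  have "\<exists>x y. x * p ^ n + y * h = 1"
  proof (induction n)
    case 0
    have "1 * p ^ 0 + 0 * h = 1" by simp
    then show ?case by blast
  next
    case (Suc n)
    then obtain x y where xy: "x * p ^ n + y * h = 1" by blast
    have "(x * p ^ n + y * h) * (u * p + v * h) =
      (x * u) * p ^ Suc n + (x * p ^ n * v + y * u * p + y * v * h) * h"
      by (simp add: algebra_simps)
    then show ?case using xy uv by (metis mult_1)
  qed
  then show thesis using that by blast
qed

lemma ex_irreducible_dvd:
  fixes g :: "'f::field poly"
  assumes "degree g > 0"
  obtains p where "irreducible p" "p dvd g"
proof -
  have "\<exists>p. irreducible p \<and> p dvd g" using assms
  proof (induction "degree g" arbitrary: g rule: less_induct)
    case less
    show ?case
    proof (cases "irreducible g")
      case False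
      have "g \<noteq> 0" using less.prems by auto
      then have "\<not> g dvd 1" using less.prems by (simp add: is_unit_iff_degree)
      with False \<open>g \<noteq> 0\<close> obtain h k where hk: "g = h * k" "\<not> h dvd 1" "\<not> k dvd 1"
        unfolding irreducible_def by blast
      then have "h \<noteq> 0" "k \<noteq> 0" using \<open>g \<noteq> 0\<close> by auto
      then have "degree h > 0" "degree k > 0" "degree g = degree h + degree k"
        using hk by (auto simp: is_unit_iff_degree degree_mult_eq)
      then have "\<exists>p. irreducible p \<and> p dvd h" using less.hyps[of h] by auto
      then show ?thesis using hk(1) by (meson dvd_mult2)
    qed auto
  qed
  then show thesis using that by blast
qed

lemma irreducible_degree_pos:
  fixes p :: "'f::field poly"
  assumes "irreducible p"
  shows "degree p > 0"
  using assms is_unit_iff_degree[of p] by (metis gr0I irreducible_def)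

lemma split_off_power:
  fixes p g :: "'f::field poly"
  assumes p: "irreducible p" and g: "g \<noteq> 0"
  obtains n h where "g = p ^ n * h" "\<not> p dvd h"
proof -
  have "\<exists>n h. g = p ^ n * h \<and> \<not> p dvd h" using g
  proof (induction "degree g" arbitrary: g rule: less_induct)
    case less
    show ?case
    proof (cases "p dvd g")
      case True
      then obtain k where k: "g = p * k" by auto
      with less.prems have "k \<noteq> 0" "p \<noteq> 0" by auto
      then have "degree k < degree g" using irreducible_degree_pos[OF p] k by (simp add: degree_mult_eq)
      then obtain n h where "k = p ^ n * h" "\<not> p dvd h" using less.hyps \<open>k \<noteq> 0\<close> by blast
      then have "g = p ^ Suc n * h" using k by (simp add: mult.assoc)
      then show ?thesis using \<open>\<not> p dvd h\<close> by blast
    next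
      case False
      have "g = p ^ 0 * g" by simp
      with False show ?thesis by blast
    qed
  qed
  then show thesis using that by blast
qed

text \<open>Write \<open>h = p^n k\<close> with \<open>p\<close> not dividing \<open>k\<close>; then \<open>n < N\<close>, and a Bezout identity for
  \<open>p^(N - n)\<close> and \<open>k\<close> puts \<open>p^n\<close> into \<open>J\<close>.  It serves to show that a vector, or a vector seen
  through a functional, has order exactly \<open>p^N\<close>.\<close>

lemma ideal_contains_smaller_power:
  fixes J :: "'f::field poly set"
  assumes add: "\<And>h k. h \<in> J \<Longrightarrow> k \<in> J \<Longrightarrow> h + k \<in> J"
    and mult: "\<And>q h. h \<in> J \<Longrightarrow> q * h \<in> J"
    and p: "irreducible p" and pN: "p ^ N \<in> J" and h: "h \<in> J" and nd: "\<not> p ^ N dvd h"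
  shows "p ^ (N - 1) \<in> J"
proof -
  have "h \<noteq> 0" using nd by auto
  obtain n k where nk: "h = p ^ n * k" "\<not> p dvd k" using split_off_power[OF p \<open>h \<noteq> 0\<close>] .
  have "n < N" using nd nk(1) by (metis dvd_mult2 le_imp_power_dvd not_le)
  obtain u v where uv: "u * p ^ (N - n) + v * k = 1" using irreducible_power_bezout[OF p nk(2)] .
  have e: "p ^ N = p ^ n * p ^ (N - n)" using \<open>n < N\<close> by (simp add: power_add[symmetric])
  have "p ^ n = p ^ n * (u * p ^ (N - n) + v * k)" using uv by simp
  also have "\<dots> = u * p ^ N + v * h" unfolding e nk(1) by (simp add: algebra_simps)
  finally have "p ^ n \<in> J" using add[OF mult[OF pN] mult[OF h]] by metis
  then have "p ^ (N - 1 - n) * p ^ n \<in> J" by (rule mult)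
  moreover have "p ^ (N - 1 - n) * p ^ n = p ^ (N - 1)" using \<open>n < N\<close> by (simp add: power_add[symmetric])
  ultimately show ?thesis by simp
qed

section \<open>Extending linear maps and functionals\<close>

text \<open>A linear relation that relates \<open>0\<close> to nothing but \<open>0\<close> is the graph of a linear map on its
  domain, and this map extends.  Functionals and operators with prescribed values are obtained from
  it by writing down the relation.\<close>

lemma linear_relation_extend:
  fixes s1 :: "'f::field \<Rightarrow> 'v::ab_group_add \<Rightarrow> 'v" and s2 :: "'f \<Rightarrow> 'w::ab_group_add \<Rightarrow> 'w"
  assumes "vector_space s1" "vector_space s2"
    and ne: "(0, 0) \<in> G"
    and add: "\<And>x y x' y'. (x, y) \<in> G \<Longrightarrow> (x', y') \<in> G \<Longrightarrow> (x + x', y + y') \<in> G"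
    and scale: "\<And>c x y. (x, y) \<in> G \<Longrightarrow> (s1 c x, s2 c y) \<in> G"
    and single: "\<And>y. (0, y) \<in> G \<Longrightarrow> y = 0"
  obtains g where "Vector_Spaces.linear s1 s2 g" "\<And>x y. (x, y) \<in> G \<Longrightarrow> g x = y"
proof -
  interpret vector_space_pair s1 s2 using assms(1,2) by (simp add: vector_space_pair_def)
  define S where "S = fst ` G"
  obtain B where B: "B \<subseteq> S" "vs1.independent B" "S \<subseteq> vs1.span B"
    using vs1.basis_exists[of S] by metis
  have "\<exists>h. \<forall>x\<in>B. (x, h x) \<in> G" using B(1) unfolding S_def by (intro bchoice) force
  then obtain h where h: "\<And>x. x \<in> B \<Longrightarrow> (x, h x) \<in> G" by blast
  obtain g where g: "Vector_Spaces.linear s1 s2 g" "\<forall>x\<in>B. g x = h x"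
    using linear_independent_extend[OF B(2)] by blast
  interpret g: Vector_Spaces.linear s1 s2 g by fact
  have "vs1.subspace {x. (x, g x) \<in> G}"
    unfolding vs1.subspace_def using ne add scale by (auto simp: g.add g.scale)
  moreover have "B \<subseteq> {x. (x, g x) \<in> G}" using h g(2) by auto
  ultimately have span: "vs1.span B \<subseteq> {x. (x, g x) \<in> G}" by (simp add: vs1.span_minimal)
  show thesis
  proof
    show "g x = y" if xy: "(x, y) \<in> G" for x y
    proof -
      have "x \<in> S" using xy unfolding S_def by force
      then have "(x, g x) \<in> G" using span B(3) by auto
      have "(x + s1 (- 1) x, g x + s2 (- 1) y) \<in> G" by (rule add[OF \<open>(x, g x) \<in> G\<close> scale[OF xy]])
      then have "(0, g x - y) \<in> G" by simp
      then have "g x - y = 0" by (rule single)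
      then show ?thesis by simp
    qed
  qed fact
qed

lemma vector_space_field: "vector_space ((*) :: 'f::field \<Rightarrow> 'f \<Rightarrow> 'f)"
  by unfold_locales (simp_all add: algebra_simps)

section \<open>A fixed operator and its polynomials\<close>

locale endo = vector_space scale
  for scale :: "'f::field \<Rightarrow> 'v::ab_group_add \<Rightarrow> 'v" (infixr "*s" 75) +
  fixes a :: "'v \<Rightarrow> 'v"
  assumes linear_a: "Vector_Spaces.linear scale scale a"

context endo begin

abbreviation lin :: "('v \<Rightarrow> 'v) \<Rightarrow> bool" where "lin \<equiv> Vector_Spaces.linear scale scale"
abbreviation fnl :: "('v \<Rightarrow> 'f) \<Rightarrow> bool" where "fnl \<equiv> Vector_Spaces.linear scale (*)"

lemma lin_iff: "lin x \<longleftrightarrow> (\<forall>u v. x (u + v) = x u + x v) \<and> (\<forall>c v. x (c *s v) = c *s x v)"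
  using vector_space_axioms by (simp add: Vector_Spaces.linear_iff)

lemma fnl_iff: "fnl l \<longleftrightarrow> (\<forall>u v. l (u + v) = l u + l v) \<and> (\<forall>c v. l (c *s v) = c * l v)"
  using vector_space_axioms vector_space_field[where 'f = 'f] by (simp add: Vector_Spaces.linear_iff)

lemma linI: "(\<And>u v. x (u + v) = x u + x v) \<Longrightarrow> (\<And>c v. x (c *s v) = c *s x v) \<Longrightarrow> lin x"
  by (simp add: lin_iff)

lemma fnlI: "(\<And>u v. l (u + v) = l u + l v) \<Longrightarrow> (\<And>c v. l (c *s v) = c * l v) \<Longrightarrow> fnl l"
  by (simp add: fnl_iff)

lemma lin_add: "lin x \<Longrightarrow> x (u + v) = x u + x v" by (simp add: lin_iff)
lemma lin_scale: "lin x \<Longrightarrow> x (c *s v) = c *s x v" by (simp add: lin_iff)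
lemma lin_0: "lin x \<Longrightarrow> x 0 = 0" using lin_scale[of x 0 0] by simp
lemma lin_minus: "lin x \<Longrightarrow> x (- v) = - x v"
  using lin_add[of x v "- v"] lin_0[of x] by (simp add: eq_neg_iff_add_eq_0 add.commute)
lemma lin_diff: "lin x \<Longrightarrow> x (u - v) = x u - x v"
  using lin_add[of x u "- v"] lin_minus[of x v] by simp
lemma lin_sum: "lin x \<Longrightarrow> x (\<Sum>i\<in>I. f i) = (\<Sum>i\<in>I. x (f i))"
  by (induction I rule: infinite_finite_induct) (auto simp: lin_0 lin_add)

lemma fnl_add: "fnl l \<Longrightarrow> l (u + v) = l u + l v" by (simp add: fnl_iff)
lemma fnl_scale: "fnl l \<Longrightarrow> l (c *s v) = c * l v" by (simp add: fnl_iff)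
lemma fnl_0: "fnl l \<Longrightarrow> l 0 = 0" using fnl_scale[of l 0 0] by simp
lemma fnl_minus: "fnl l \<Longrightarrow> l (- v) = - l v"
  using fnl_add[of l v "- v"] fnl_0[of l] by (simp add: eq_neg_iff_add_eq_0 add.commute)
lemma fnl_diff: "fnl l \<Longrightarrow> l (u - v) = l u - l v"
  using fnl_add[of l u "- v"] fnl_minus[of l v] by simp
lemma fnl_sum: "fnl l \<Longrightarrow> l (\<Sum>i\<in>I. f i) = (\<Sum>i\<in>I. l (f i))"
  by (induction I rule: infinite_finite_induct) (auto simp: fnl_0 fnl_add)

lemma lin_comp: "lin x \<Longrightarrow> lin y \<Longrightarrow> lin (\<lambda>v. x (y v))" by (simp add: lin_iff)
lemma lin_plus: "lin x \<Longrightarrow> lin y \<Longrightarrow> lin (\<lambda>v. x v + y v)"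
  by (simp add: lin_iff algebra_simps scale_right_distrib)
lemma lin_minus_fun: "lin x \<Longrightarrow> lin y \<Longrightarrow> lin (\<lambda>v. x v - y v)"
  by (simp add: lin_iff algebra_simps scale_right_diff_distrib)
lemma lin_scaled: "lin x \<Longrightarrow> lin (\<lambda>v. c *s x v)"
  by (simp add: lin_iff scale_right_distrib mult.commute)
lemma lin_id: "lin (\<lambda>v. v)" by (simp add: lin_iff)
lemma lin_zero: "lin (\<lambda>v. 0)" by (simp add: lin_iff)
lemma lin_sum_fun: "(\<And>i. i \<in> I \<Longrightarrow> lin (f i)) \<Longrightarrow> lin (\<lambda>v. \<Sum>i\<in>I. f i v)"
  by (induction I rule: infinite_finite_induct) (auto intro: lin_plus lin_zero)
lemma fnl_comp: "fnl l \<Longrightarrow> lin y \<Longrightarrow> fnl (\<lambda>v. l (y v))" by (simp add: lin_iff fnl_iff)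
lemma lin_rank_one: "fnl l \<Longrightarrow> lin (\<lambda>v. l v *s u)"
  by (simp add: fnl_iff lin_iff scale_left_distrib)

lemmas lin_a = linear_a
lemmas a_add = lin_add[OF linear_a] and a_scale = lin_scale[OF linear_a]
  and a_diff = lin_diff[OF linear_a] and a_sum = lin_sum[OF linear_a] and a_0 = lin_0[OF linear_a]

lemma lin_funpow: "lin (a ^^ n)"
  by (induction n) (auto simp: lin_iff a_add a_scale)

text \<open>The action of the polynomial ring on \<open>V\<close>: \<open>pact h v\<close> is \<open>h(a) v\<close>.\<close>

definition pact :: "'f poly \<Rightarrow> 'v \<Rightarrow> 'v" where
  "pact h v = (\<Sum>i\<le>degree h. coeff h i *s (a ^^ i) v)"

lemma pact_bound: "degree h \<le> n \<Longrightarrow> pact h v = (\<Sum>i\<le>n. coeff h i *s (a ^^ i) v)"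
  unfolding pact_def by (rule sum.mono_neutral_left) (auto simp: coeff_eq_0)

lemma lin_pact: "lin (pact h)"
  unfolding pact_def[abs_def] by (intro lin_sum_fun lin_scaled lin_funpow)

lemmas pact_vadd = lin_add[OF lin_pact] and pact_vscale = lin_scale[OF lin_pact]
  and pact_vdiff = lin_diff[OF lin_pact] and pact_v0 = lin_0[OF lin_pact]

lemma pact_0: "pact 0 v = 0" by (simp add: pact_def)

lemma pact_pCons: "pact (pCons c h) v = c *s v + a (pact h v)"
proof -
  have "pact (pCons c h) v = (\<Sum>i\<le>Suc (degree h). coeff (pCons c h) i *s (a ^^ i) v)"
    by (rule pact_bound) (simp add: degree_pCons_le)
  also have "\<dots> = c *s v + (\<Sum>i\<le>degree h. coeff h i *s (a ^^ Suc i) v)"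
    by (subst sum.atMost_Suc_shift) simp
  also have "(\<Sum>i\<le>degree h. coeff h i *s (a ^^ Suc i) v) = a (pact h v)"
    by (simp add: pact_def a_sum a_scale)
  finally show ?thesis .
qed

lemma commute_pact:
  assumes "lin x" "\<And>v. x (a v) = a (x v)"
  shows "x (pact h v) = pact h (x v)"
  by (induction h arbitrary: v)
    (simp_all add: pact_0 pact_pCons lin_0[OF assms(1)] lin_add[OF assms(1)] lin_scale[OF assms(1)] assms(2))

lemma pact_a: "pact h (a v) = a (pact h v)"
  using commute_pact[OF lin_a] by simp

lemma pact_add: "pact (h + k) v = pact h v + pact k v"
proof -
  let ?n = "max (degree h) (degree k)"
  have "degree (h + k) \<le> ?n" by (rule degree_add_le_max)
  then show ?thesis
    using pact_bound[of "h + k" ?n] pact_bound[of h ?n] pact_bound[of k ?n]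
    by (simp add: scale_left_distrib sum.distrib)
qed

lemma pact_smult: "pact (smult c h) v = c *s pact h v"
  using pact_bound[of "smult c h" "degree h"] by (simp add: pact_def scale_sum_right)

lemma pact_minus: "pact (- h) v = - pact h v"
  using pact_smult[of "- 1" h v] by simp

lemma pact_diff: "pact (h - k) v = pact h v - pact k v"
  using pact_add[of h "- k" v] by (simp add: pact_minus)

lemma pact_mult: "pact (h * k) v = pact h (pact k v)"
  by (induction h) (simp_all add: pact_0 pact_pCons pact_add pact_smult a_add)

lemma pact_1: "pact 1 v = v"
  using pact_pCons[of 1 0 v] by (simp add: pact_0 a_0 one_pCons)

lemma pact_commute: "pact h (pact k v) = pact k (pact h v)"
  by (metis mult.commute pact_mult)

lemma pact_power_add: "pact (p ^ (m + n)) v = pact (p ^ m) (pact (p ^ n) v)"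
  by (simp add: pact_mult power_add)

lemma pact_monom: "pact (monom c m) v = c *s (a ^^ m) v"
  by (induction m) (simp_all add: monom_0 monom_Suc pact_pCons pact_0 a_0 a_scale)

lemma pact_dvd_0: "h dvd k \<Longrightarrow> pact h v = 0 \<Longrightarrow> pact k v = 0"
  by (metis dvdE mult.commute pact_mult pact_v0)

lemma pact_funpow: "pact h ((a ^^ n) v) = (a ^^ n) (pact h v)"
  by (metis pact_monom pact_commute scale_one)

lemma pact_mod: "pact g v = 0 \<Longrightarrow> pact (h mod g) v = pact h v"
  using pact_add[of "h div g * g" "h mod g" v] by (simp add: pact_mult pact_v0)

text \<open>The divided difference \<open>(g(s) - g(t)) / (s - t)\<close>, with \<open>s\<close> acting as \<open>a\<close> from the left of \<open>x\<close> and \<open>t\<close> as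
  \<open>a\<close> from the right; for \<open>g = t^m\<close> it is the sum of all \<open>a^j x a^k\<close> with \<open>j + k = m - 1\<close>.\<close>

definition divdiff :: "'f poly \<Rightarrow> ('v \<Rightarrow> 'v) \<Rightarrow> 'v \<Rightarrow> 'v" where
  "divdiff g x v = (\<Sum>k<degree g. pact (poly_shift (Suc k) g) (x ((a ^^ k) v)))"

lemma divdiff_0: "divdiff 0 x v = 0" by (simp add: divdiff_def)

lemma divdiff_pCons: "divdiff (pCons c g) x v = pact g (x v) + divdiff g x (a v)"
proof (cases "g = 0")
  case True then show ?thesis by (simp add: divdiff_def pact_0)
next
  case False
  have s: "poly_shift (Suc k) (pCons c g) = poly_shift k g" for k
    by (simp add: poly_eq_iff coeff_poly_shift)
  show ?thesis using False
    by (simp add: divdiff_def s sum.lessThan_Suc_shift funpow_Suc_right del: funpow.simps sum.lessThan_Suc)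
qed

lemma lin_divdiff: "lin x \<Longrightarrow> lin (divdiff g x)"
  unfolding divdiff_def[abs_def] by (intro lin_sum_fun lin_comp[OF lin_pact] lin_comp[OF _ lin_funpow])

lemma divdiff_commutator:
  assumes x: "lin x"
  shows "a (divdiff g x v) - divdiff g x (a v) = pact g (x v) - x (pact g v)"
proof (induction g arbitrary: v)
  case 0 then show ?case by (simp add: divdiff_0 pact_0 a_0 lin_0[OF x])
next
  case (pCons c g)
  have "a (divdiff (pCons c g) x v) - divdiff (pCons c g) x (a v) =
    a (pact g (x v)) - pact g (x (a v)) + (a (divdiff g x (a v)) - divdiff g x (a (a v)))"
    by (simp add: divdiff_pCons a_add)
  also have "\<dots> = a (pact g (x v)) - x (a (pact g v))"
    by (simp add: pCons.IH pact_a)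
  finally show ?case by (simp add: pact_pCons lin_add[OF x] lin_scale[OF x])
qed

text \<open>On the rank one operator with functional \<open>l\<close> and vector \<open>u\<close> the divided difference of \<open>g\<close> at \<open>v\<close> is a
  polynomial in \<open>a\<close> applied to \<open>u\<close>; it depends on \<open>v\<close> through the sequence \<open>s\<close> of moments \<open>l (a^k v)\<close>.\<close>

definition divdiff_poly :: "'f poly \<Rightarrow> (nat \<Rightarrow> 'f) \<Rightarrow> 'f poly" where
  "divdiff_poly g s = (\<Sum>k<degree g. smult (s k) (poly_shift (Suc k) g))"

lemma divdiff_rank_one: "divdiff g (\<lambda>v. l v *s u) v = pact (divdiff_poly g (\<lambda>k. l ((a ^^ k) v))) u"
proof -
  have "pact (\<Sum>k\<in>K. f k) u = (\<Sum>k\<in>K. pact (f k) u)" for K and f :: "nat \<Rightarrow> 'f poly"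
    by (induction K rule: infinite_finite_induct) (auto simp: pact_0 pact_add)
  then show ?thesis by (simp add: divdiff_def divdiff_poly_def pact_vscale pact_smult)
qed

lemma coeff_divdiff_poly: "coeff (divdiff_poly g s) i = (\<Sum>k<degree g. s k * coeff g (i + Suc k))"
  by (simp add: divdiff_poly_def coeff_sum coeff_poly_shift)

lemma degree_divdiff_poly: "degree g > 0 \<Longrightarrow> degree (divdiff_poly g s) < degree g"
  by (rule degree_lessI) (auto simp: coeff_divdiff_poly coeff_eq_0)

lemma coeff_divdiff_poly_top:
  assumes "degree g > 0"
  shows "coeff (divdiff_poly g s) (degree g - 1) = s 0 * lead_coeff g"
proof -
  have "coeff (divdiff_poly g s) (degree g - 1) = (\<Sum>k<degree g. if k = 0 then s 0 * lead_coeff g else 0)"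
    unfolding coeff_divdiff_poly using assms by (intro sum.cong) (auto simp: coeff_eq_0)
  then show ?thesis using assms by simp
qed

lemma divdiff_poly_eq_0_D:
  assumes "degree g > 0" "g dvd divdiff_poly g s"
  shows "s 0 = 0"
proof -
  have "divdiff_poly g s = 0" using degree_divdiff_poly[OF assms(1), of s] assms(2) dvd_imp_degree_le leD by blast
  then show ?thesis using coeff_divdiff_poly_top[OF assms(1), of s] assms(1) by auto
qed

lemma divdiff_poly_sum_list:
  "(\<Sum>y\<leftarrow>ys. pact (divdiff_poly g (s y)) u) = pact (divdiff_poly g (\<lambda>k. \<Sum>y\<leftarrow>ys. s y k)) u"
proof (induction ys)
  case Nil then show ?case by (simp add: divdiff_poly_def pact_0)
next
  case (Cons y ys)
  have "divdiff_poly g (s y) + divdiff_poly g t = divdiff_poly g (\<lambda>k. s y k + t k)" for t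
    by (simp add: divdiff_poly_def smult_add_left sum.distrib)
  with Cons show ?case by (simp add: pact_add[symmetric])
qed

section \<open>Functionals with prescribed values\<close>

lemma fnl_relation_extend:
  assumes "(0, 0) \<in> G"
    and "\<And>x y x' y'. (x, y) \<in> G \<Longrightarrow> (x', y') \<in> G \<Longrightarrow> (x + x', y + y') \<in> G"
    and "\<And>c x y. (x, y) \<in> G \<Longrightarrow> (c *s x, c * y) \<in> G"
    and "\<And>y. (0, y) \<in> G \<Longrightarrow> y = 0"
  obtains l where "fnl l" "\<And>x y. (x, y) \<in> G \<Longrightarrow> l x = y"
  using linear_relation_extend[OF vector_space_axioms vector_space_field assms] by blast

lemma lin_relation_extend:
  assumes "(0, 0) \<in> G"
    and "\<And>x y x' y'. (x, y) \<in> G \<Longrightarrow> (x', y') \<in> G \<Longrightarrow> (x + x', y + y') \<in> G"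
    and "\<And>c x y. (x, y) \<in> G \<Longrightarrow> (c *s x, c *s y) \<in> G"
    and "\<And>y. (0, y) \<in> G \<Longrightarrow> y = 0"
  obtains l where "lin l" "\<And>x y. (x, y) \<in> G \<Longrightarrow> l x = y"
  using linear_relation_extend[OF vector_space_axioms vector_space_axioms assms] by blast

lemma fnl_separates:
  assumes "subspace S" "v \<notin> S"
  obtains l where "fnl l" "l v = 1" "\<And>s. s \<in> S \<Longrightarrow> l s = 0"
proof -
  define G where "G = {(s + c *s v, c) | s c. s \<in> S}"
  have "(0 + 0 *s v, 0) \<in> G" unfolding G_def using assms(1) subspace_0 by blast
  then have z: "(0, 0) \<in> G" by simp
  have p: "(x + x', y + y') \<in> G" if xy: "(x, y) \<in> G" "(x', y') \<in> G" for x y x' y'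
  proof -
    obtain s s' where s: "x = s + y *s v" "s \<in> S" "x' = s' + y' *s v" "s' \<in> S" using xy G_def by auto
    then have "x + x' = (s + s') + (y + y') *s v" by (simp add: scale_left_distrib)
    then show ?thesis unfolding G_def using subspace_add[OF assms(1) s(2,4)] by blast
  qed
  have m: "(c *s x, c * y) \<in> G" if xy: "(x, y) \<in> G" for c x y
  proof -
    obtain s where s: "x = s + y *s v" "s \<in> S" using xy G_def by auto
    then have "c *s x = c *s s + (c * y) *s v" by (simp add: scale_right_distrib)
    then show ?thesis unfolding G_def using subspace_scale[OF assms(1) s(2)] by blast
  qed
  have u: "y = 0" if y: "(0, y) \<in> G" for y
  proof (rule ccontr)
    assume "y \<noteq> 0"
    obtain s where s: "0 = s + y *s v" "s \<in> S" using y G_def by auto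
    then have "y *s v = - s" by (simp add: eq_neg_iff_add_eq_0 add.commute)
    then have "inverse y *s (y *s v) = inverse y *s (- s)" by simp
    then have "v = inverse y *s (- s)" using \<open>y \<noteq> 0\<close> by simp
    also have "\<dots> \<in> S" using s(2) assms(1) subspace_neg subspace_scale by blast
    finally show False using assms(2) by simp
  qed
  obtain l where l: "fnl l" "\<And>x y. (x, y) \<in> G \<Longrightarrow> l x = y" using fnl_relation_extend[OF z p m u] by blast
  have "(0 + 1 *s v, 1) \<in> G" unfolding G_def using subspace_0[OF assms(1)] by blast
  then have "l v = 1" using l(2)[of v 1] by simp
  moreover have "l s = 0" if "s \<in> S" for s
  proof -
    have "(s + 0 *s v, 0) \<in> G" unfolding G_def using that by blast
    then show ?thesis using l(2)[of s 0] by simp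
  qed
  ultimately show thesis using that l(1) by blast
qed

lemma fnl_eqI:
  assumes "\<And>l. fnl l \<Longrightarrow> l u = l v"
  shows "u = v"
proof (rule ccontr)
  assume "u \<noteq> v"
  then have "u - v \<notin> {0}" by simp
  then obtain l where "fnl l" "l (u - v) = 1"
    using fnl_separates[of "{0}" "u - v"] subspace_single_0 by blast
  then show False using assms[of l] by (simp add: fnl_diff)
qed


lemma span_insertD:
  assumes "z \<in> span (insert x E)"
  obtains c y where "y \<in> span E" "z = y + c *s x"
proof -
  obtain c where "z - c *s x \<in> span E" using assms span_breakdown_eq by blast
  then show thesis using that[of "z - c *s x" c] by simp
qed

text \<open>The functional is extended along growing finite sets of vectors.  The requirement \<open>R n\<close> met at
  stage \<open>n\<close> depends only on values on the span of a finite set, so later stages cannot destroy it.\<close>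

lemma functional_by_stages:
  fixes R :: "nat \<Rightarrow> 'v set \<Rightarrow> ('v \<Rightarrow> 'f) \<Rightarrow> bool"
  assumes step: "\<And>n E r. finite E \<Longrightarrow> E \<subseteq> W \<Longrightarrow> fnl r \<Longrightarrow>
      \<exists>E' r'. finite E' \<and> E \<subseteq> E' \<and> E' \<subseteq> W \<and> fnl r' \<and> (\<forall>s\<in>span E. r' s = r s) \<and> R n E' r'"
    and local: "\<And>n E r r'. R n E r \<Longrightarrow> (\<And>s. s \<in> span E \<Longrightarrow> r' s = r s) \<Longrightarrow> R n E r'"
  shows "\<exists>l. fnl l \<and> (\<forall>n. \<exists>E. R n E l)"
proof -
  define P where "P n X = (finite (fst X) \<and> fst X \<subseteq> W \<and> fnl (snd X) \<and>
    (case n of 0 \<Rightarrow> True | Suc m \<Rightarrow> R m (fst X) (snd X)))" for n and X :: "'v set \<times> ('v \<Rightarrow> 'f)"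
  define Q where "Q X Y = (fst X \<subseteq> fst Y \<and> (\<forall>s\<in>span (fst X). snd Y s = snd X s))"
    for X Y :: "'v set \<times> ('v \<Rightarrow> 'f)"
  have "\<exists>X. \<forall>n. P n (X n) \<and> Q (X n) (X (Suc n))"
  proof (rule dependent_nat_choice)
    have "P 0 ({}, \<lambda>v. 0)" by (simp add: P_def fnl_iff)
    then show "\<exists>x. P 0 x" by blast
  next
    fix X n assume "P n X"
    then have "finite (fst X)" "fst X \<subseteq> W" "fnl (snd X)" by (auto simp: P_def)
    from step[OF this, of n] obtain E' r' where "finite E'" "fst X \<subseteq> E'" "E' \<subseteq> W" "fnl r'" "\<forall>s\<in>span (fst X). r' s = snd X s"
      "R n E' r'" by blast
    then have "P (Suc n) (E', r') \<and> Q X (E', r')" by (simp add: P_def Q_def)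
    then show "\<exists>y. P (Suc n) y \<and> Q X y" by blast
  qed
  then obtain X where X: "\<And>n. P n (X n)" "\<And>n. Q (X n) (X (Suc n))" by blast
  define E where "E n = fst (X n)" for n
  define r where "r n = snd (X n)" for n
  have E: "E n \<subseteq> E m" if "n \<le> m" for n m
    using that by (induction rule: dec_induct) (use X(2) in \<open>auto simp: E_def Q_def\<close>)
  have sE: "span (E n) \<subseteq> span (E m)" if "n \<le> m" for n m
    using E[OF that] by (rule span_mono)
  have r: "r m s = r n s" if "n \<le> m" "s \<in> span (E n)" for n m s
    using that(1)
  proof (induction rule: dec_induct)
    case (step m)
    have "s \<in> span (E m)" using sE[OF step(1)] that(2) by auto
    then show ?case using X(2)[of m] step.IH by (simp add: Q_def E_def r_def)
  qed simp
  have fr: "fnl (r n)" for n using X(1)[of n] by (simp add: P_def r_def)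
  define G where "G = {(s, r n s) | s n. s \<in> span (E n)}"
  have z: "(0, 0) \<in> G" unfolding G_def using fnl_0[OF fr[of 0]] span_zero by force
  have p: "(x + x', y + y') \<in> G" if xy: "(x, y) \<in> G" "(x', y') \<in> G" for x y x' y'
  proof -
    obtain n n' where n: "x \<in> span (E n)" "y = r n x" "x' \<in> span (E n')" "y' = r n' x'"
      using xy G_def by auto
    let ?m = "max n n'"
    have "x \<in> span (E ?m)" "x' \<in> span (E ?m)"
      using sE[of n ?m] sE[of n' ?m] n by auto
    moreover have "y + y' = r ?m (x + x')"
      using r[of n ?m x] r[of n' ?m x'] n by (simp add: fnl_add[OF fr])
    ultimately show ?thesis unfolding G_def using span_add by blast
  qed
  have m: "(c *s x, c * y) \<in> G" if "(x, y) \<in> G" for c x y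
    using that unfolding G_def by (auto simp: fnl_scale[OF fr, symmetric] intro: span_scale)
  have u: "y = 0" if "(0, y) \<in> G" for y
    using that unfolding G_def by (auto simp: fnl_0[OF fr])
  obtain l where l: "fnl l" "\<And>x y. (x, y) \<in> G \<Longrightarrow> l x = y"
    using fnl_relation_extend[OF z p m u] by blast
  have "\<exists>E. R n E l" for n
  proof -
    have "R n (E (Suc n)) (r (Suc n))" using X(1)[of "Suc n"] by (simp add: P_def E_def r_def)
    moreover have "l s = r (Suc n) s" if "s \<in> span (E (Suc n))" for s
      using l(2)[of s "r (Suc n) s"] that unfolding G_def by blast
    ultimately show ?thesis using local by blast
  qed
  with l(1) show ?thesis by blast
qed

text \<open>Only finitely many proper steps fit into a finite-dimensional space.  The induction adds one
  generator \<open>x\<close> at a time; what matters is whether the coset of \<open>x\<close> modulo the old span misses some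
  \<open>S N\<close>, in which case nothing new arises, or meets all of them.\<close>

lemma decreasing_meets_finite_span:
  fixes S :: "nat \<Rightarrow> 'v set"
  assumes sub: "\<And>n. subspace (S n)" and dec: "\<And>m n. m \<le> n \<Longrightarrow> S n \<subseteq> S m" and "finite E"
  shows "\<exists>M. \<forall>m\<ge>M. \<forall>y\<in>span E. y \<in> S M \<longrightarrow> y \<in> S m"
  using \<open>finite E\<close>
proof (induction E)
  case empty
  then show ?case using sub by (auto simp: subspace_def)
next
  case (insert x E)
  then obtain M where M: "\<And>m y. m \<ge> M \<Longrightarrow> y \<in> span E \<Longrightarrow> y \<in> S M \<Longrightarrow> y \<in> S m" by blast
  show ?case
  proof (cases "\<exists>N. \<forall>y\<in>span E. y + x \<notin> S N")
    case True
    then obtain N where N: "\<And>y. y \<in> span E \<Longrightarrow> y + x \<notin> S N" by blast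
    let ?M = "max M N"
    have "z \<in> S m" if m: "m \<ge> ?M" and z: "z \<in> span (insert x E)" "z \<in> S ?M" for m z
    proof -
      obtain c y where cy: "y \<in> span E" "z = y + c *s x" using span_insertD[OF z(1)] .
      have "z \<in> S M" "z \<in> S N" using z(2) dec[of M ?M] dec[of N ?M] by auto
      have "c = 0"
      proof (rule ccontr)
        assume "c \<noteq> 0"
        then have "inverse c *s z = inverse c *s y + x" using cy(2) by (simp add: scale_right_distrib)
        moreover have "inverse c *s z \<in> S N" using \<open>z \<in> S N\<close> sub subspace_scale by blast
        ultimately show False using N[of "inverse c *s y"] cy(1) span_scale by auto
      qed
      then show ?thesis using M[of m y] cy m \<open>z \<in> S M\<close> by auto
    qed
    then show ?thesis by blast
  next
    case False
    then obtain y where y: "y \<in> span E" "y + x \<in> S M" by blast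
    have yx: "y + x \<in> S m" if m: "m \<ge> M" for m
    proof -
      obtain y' where y': "y' \<in> span E" "y' + x \<in> S m" using False by blast
      then have "(y + x) - (y' + x) \<in> S M" using y dec[OF m] sub subspace_diff by blast
      then have "y - y' \<in> S m" using M[OF m, of "y - y'"] y(1) y'(1) span_diff by auto
      then have "(y - y') + (y' + x) \<in> S m" using y'(2) sub subspace_add by blast
      then show ?thesis by simp
    qed
    have "z \<in> S m" if m: "m \<ge> M" and z: "z \<in> span (insert x E)" "z \<in> S M" for m z
    proof -
      obtain c y' where cy: "y' \<in> span E" "z = y' + c *s x" using span_insertD[OF z(1)] .
      have e: "z - c *s (y + x) = y' - c *s y" using cy by (simp add: scale_right_distrib)
      have "z - c *s (y + x) \<in> S M" using z(2) y(2) sub subspace_diff subspace_scale by blast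
      then have "y' - c *s y \<in> S m" using M[OF m, of "y' - c *s y"] e cy(1) y(1) span_diff span_scale by auto
      then have "(z - c *s (y + x)) + c *s (y + x) \<in> S m" using e yx[OF m] sub subspace_add subspace_scale by metis
      then show ?thesis by simp
    qed
    then show ?thesis by blast
  qed
qed

text \<open>If no nonzero vector lies in all \<open>S n\<close>, then a finite-dimensional space meets \<open>S m\<close> only in \<open>0\<close>
  for large \<open>m\<close>.  So at every stage \<open>S n\<close> contains a vector on which the functional is still free.\<close>

lemma functional_nonzero_on_decreasing:
  fixes S :: "nat \<Rightarrow> 'v set"
  assumes sub: "\<And>n. subspace (S n)" and dec: "\<And>m n. m \<le> n \<Longrightarrow> S n \<subseteq> S m"
    and nz: "\<And>n. \<exists>u\<in>S n. u \<noteq> 0"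
  shows "\<exists>l. fnl l \<and> (\<forall>n. \<exists>u\<in>S n. l u \<noteq> 0)"
proof (cases "\<exists>u. u \<noteq> 0 \<and> (\<forall>n. u \<in> S n)")
  case True
  then obtain u where u: "u \<noteq> 0" "\<And>n. u \<in> S n" by blast
  obtain l where "fnl l" "l u = 1" using fnl_separates[of "{0}" u] u(1) subspace_single_0 by auto
  then show ?thesis using u(2) by (metis zero_neq_one)
next
  case False
  define R where "R n E r = (\<exists>u\<in>S n \<inter> span E. r u \<noteq> 0)" for n E and r :: "'v \<Rightarrow> 'f"
  have step: "\<exists>E' r'. finite E' \<and> E \<subseteq> E' \<and> E' \<subseteq> UNIV \<and> fnl r' \<and> (\<forall>s\<in>span E. r' s = r s) \<and> R n E' r'"
    if E: "finite E" "fnl r" for n E r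
  proof -
    obtain M where M: "\<And>m y. m \<ge> M \<Longrightarrow> y \<in> span E \<Longrightarrow> y \<in> S M \<Longrightarrow> y \<in> S m"
      using decreasing_meets_finite_span[of S E, OF sub dec E(1)] by blast
    have z: "y = 0" if y: "y \<in> span E" "y \<in> S M" for y
    proof -
      have "y \<in> S m" for m
        using M[of "max m M" y] y dec[of m "max m M"] by auto
      then show ?thesis using False by blast
    qed
    obtain u where u: "u \<in> S (max n M)" "u \<noteq> 0" using nz by blast
    then have uS: "u \<in> S n" "u \<in> S M" using dec[of n "max n M"] dec[of M "max n M"] by auto
    then have "u \<notin> span E" using z u(2) by blast
    then obtain l where l: "fnl l" "l u = 1" "\<And>s. s \<in> span E \<Longrightarrow> l s = 0"
      using fnl_separates[of "span E" u] subspace_span by blast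
    define r' where "r' v = r v + (1 - r u) * l v" for v
    have "fnl r'" using E(2) l(1) by (simp add: r'_def fnl_iff algebra_simps)
    moreover have "r' u = 1" by (simp add: r'_def l)
    moreover have "\<forall>s\<in>span E. r' s = r s" by (simp add: r'_def l)
    moreover have "u \<in> span (insert u E)" by (simp add: span_base)
    moreover have "R n (insert u E) r'"
      unfolding R_def using uS(1) \<open>r' u = 1\<close> \<open>u \<in> span (insert u E)\<close>
      by (intro bexI[of _ u]) simp_all
    ultimately show ?thesis using E(1) by (intro exI[of _ "insert u E"] exI[of _ r']) auto
  qed
  have loc: "R n E r'" if "R n E r" "\<And>s. s \<in> span E \<Longrightarrow> r' s = r s" for n E r r'
    using that unfolding R_def by auto
  have "\<exists>l. fnl l \<and> (\<forall>n. \<exists>E. R n E l)"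
    by (rule functional_by_stages[of UNIV R], rule step, assumption, assumption, fact loc)
  then obtain l where "fnl l" "\<And>n. \<exists>E. R n E l" by blast
  then show ?thesis unfolding R_def by blast
qed

section \<open>Torsion of the dual\<close>

lemma annihilator_generator:
  assumes "h \<noteq> 0" "pact h w = 0"
  obtains g where "g \<noteq> 0" "pact g w = 0" "\<And>k. pact k w = 0 \<Longrightarrow> g dvd k"
proof -
  have "\<exists>g. g \<in> {k. pact k w = 0} \<and> g \<noteq> 0 \<and> (\<forall>k\<in>{k. pact k w = 0}. g dvd k)"
  proof (rule poly_ideal_generator[of "{k. pact k w = 0}" h])
    fix g assume "g \<in> {k. pact k w = 0}" "g \<noteq> 0" "\<And>k. k \<in> {k. pact k w = 0} \<Longrightarrow> g dvd k"
    then show ?thesis by blast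
  qed (use assms in \<open>simp_all add: pact_add pact_mult pact_v0\<close>)
  then show thesis using that by blast
qed

text \<open>Choose \<open>w0\<close> whose annihilator has a generator \<open>g0\<close> of maximal degree.  If \<open>g0 w \<noteq> 0\<close>, let \<open>p\<close> be an
  irreducible factor of the order of \<open>g0 w\<close> and \<open>p^i\<close> the exact power of \<open>p\<close> in \<open>g0 = p^i s\<close>.  Some
  multiple \<open>x\<close> of \<open>w\<close> has order \<open>p^(i+1)\<close>, while \<open>p^i w0\<close> has the coprime order \<open>s\<close>, so the sum of
  the two has order \<open>p^(i+1) s = p g0\<close>, against maximality.\<close>

lemma bounded_torsion_annihilator:
  assumes W: "subspace W" "\<And>w. w \<in> W \<Longrightarrow> a w \<in> W"
    and bd: "\<And>w. w \<in> W \<Longrightarrow> \<exists>h. h \<noteq> 0 \<and> degree h \<le> d \<and> pact h w = 0"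
  obtains k where "k \<noteq> 0" "\<And>w. w \<in> W \<Longrightarrow> pact k w = 0"
proof -
  have Wp: "pact h w \<in> W" if "w \<in> W" for h w
    using that by (induction h)
      (auto simp: pact_0 pact_pCons W subspace_0[OF W(1)] intro!: subspace_add[OF W(1)] subspace_scale[OF W(1)])
  define P where "P X = (fst X \<in> W \<and> snd X \<noteq> 0 \<and> pact (snd X) (fst X) = 0 \<and>
    (\<forall>h. pact h (fst X) = 0 \<longrightarrow> snd X dvd h))" for X :: "'v \<times> 'f poly"
  have ex: "\<exists>g. P (w, g)" if w: "w \<in> W" for w
  proof -
    obtain h where h: "h \<noteq> 0" "pact h w = 0" using bd[OF w] by blast
    obtain g where "g \<noteq> 0" "pact g w = 0" "\<And>k. pact k w = 0 \<Longrightarrow> g dvd k"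
      using annihilator_generator[OF h] by blast
    then show ?thesis using w by (auto simp: P_def)
  qed
  have bP: "\<forall>X. P X \<longrightarrow> degree (snd X) < Suc d"
  proof (intro allI impI)
    fix X assume X: "P X"
    then obtain h where h: "h \<noteq> 0" "degree h \<le> d" "pact h (fst X) = 0" using bd[of "fst X"] P_def by auto
    then have "snd X dvd h" using X by (auto simp: P_def)
    then have "degree (snd X) \<le> degree h" using h(1) by (rule dvd_imp_degree_le)
    then show "degree (snd X) < Suc d" using h(2) by simp
  qed
  obtain g where "P (0, g)" using ex subspace_0[OF W(1)] by blast
  from ex_has_greatest_nat[of P _ "\<lambda>X. degree (snd X)", OF this bP]
  obtain X where X: "P X" "\<And>Y. P Y \<Longrightarrow> degree (snd Y) \<le> degree (snd X)" by blast
  obtain w0 g0 where X0: "X = (w0, g0)" by (cases X)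
  have w0: "w0 \<in> W" "g0 \<noteq> 0" "pact g0 w0 = 0" "\<And>h. pact h w0 = 0 \<Longrightarrow> g0 dvd h"
    using X(1) unfolding X0 P_def by auto
  show thesis
  proof (rule that[OF w0(2)])
    fix w assume w: "w \<in> W"
    show "pact g0 w = 0"
    proof (rule ccontr)
      assume nz: "pact g0 w \<noteq> 0"
      obtain h where h: "h \<noteq> 0" "pact h (pact g0 w) = 0" using bd[OF Wp[OF w]] by blast
      obtain g where g: "g \<noteq> 0" "pact g (pact g0 w) = 0" "\<And>k. pact k (pact g0 w) = 0 \<Longrightarrow> g dvd k"
        using annihilator_generator[OF h] by blast
      have "degree g > 0"
      proof (rule ccontr)
        assume "\<not> degree g > 0"
        then have "g dvd 1" using g(1) by (simp add: is_unit_iff_degree)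
        then have "pact 1 (pact g0 w) = 0" using pact_dvd_0 g(2) by blast
        then show False using nz by (simp add: pact_1)
      qed
      then obtain p where p: "irreducible p" "p dvd g" using ex_irreducible_dvd by blast
      then obtain q where q: "g = p * q" by auto
      have p0: "p \<noteq> 0" and q0: "q \<noteq> 0" using g(1) q by auto
      define y where "y = pact q (pact g0 w)"
      have "y \<noteq> 0"
      proof
        assume "y = 0"
        then have "g dvd q" using g(3) y_def by auto
        then have "degree g \<le> degree q" using q0 dvd_imp_degree_le by blast
        then show False using q p0 q0 irreducible_degree_pos[OF p(1)] by (simp add: degree_mult_eq)
      qed
      have py: "pact p y = 0" using g(2) unfolding y_def q pact_mult by simp
      obtain i s where gs: "g0 = p ^ i * s" "\<not> p dvd s" using split_off_power[OF p(1) w0(2)] .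
      have s0: "s \<noteq> 0" using w0(2) gs(1) by auto
      define x where "x = pact q (pact s w)"
      define z where "z = pact (p ^ i) w0"
      have xi: "pact (p ^ i) x = y" unfolding x_def y_def gs(1) pact_mult by (metis pact_commute)
      have xi1: "pact (p ^ Suc i) x = 0" using py xi by (simp add: pact_mult)
      have sz: "pact s z = 0" using w0(3) unfolding z_def gs(1) by (metis pact_mult pact_commute)
      have ordx: "p ^ Suc i dvd k" if k: "pact k x = 0" for k
      proof (rule ccontr)
        assume nd: "\<not> p ^ Suc i dvd k"
        have "p ^ (Suc i - 1) \<in> {k. pact k x = 0}"
          by (rule ideal_contains_smaller_power[OF _ _ p(1) _ _ nd])
            (auto simp: pact_add pact_mult pact_v0 k xi1[unfolded power_Suc pact_mult])
        then show False using xi \<open>y \<noteq> 0\<close> by simp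
      qed
      have ordz: "s dvd k" if k: "pact k z = 0" for k
      proof -
        have "pact (p ^ i * k) w0 = 0" using k unfolding z_def pact_mult by (metis pact_commute)
        then have "p ^ i * s dvd p ^ i * k" using w0(4) gs(1) by blast
        then show ?thesis using p0 by simp
      qed
      have xW: "x + z \<in> W" unfolding x_def z_def using w w0(1) by (intro subspace_add[OF W(1)] Wp)
      then obtain f where f: "P (x + z, f)" using ex by blast
      then have f0: "f \<noteq> 0" "pact f x + pact f z = 0" by (auto simp: P_def pact_vadd)
      have "pact (s * f) x + pact (s * f) z = 0"
        using f0(2) by (simp add: pact_mult pact_vadd[symmetric] pact_v0)
      moreover have "pact (s * f) z = 0" using sz by (simp add: pact_mult pact_commute[of s] pact_v0)
      ultimately have "p ^ Suc i dvd s * f" using ordx by simp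
      have "pact (p ^ Suc i * f) x + pact (p ^ Suc i * f) z = 0"
        using f0(2) by (metis pact_mult pact_vadd pact_v0)
      moreover have "pact (p ^ Suc i * f) x = 0" using xi1 by (metis pact_mult pact_commute pact_v0)
      ultimately have sd: "s dvd p ^ Suc i * f" using ordz by simp
      obtain u v where uv: "u * p ^ Suc i + v * s = 1" using irreducible_power_bezout[OF p(1) gs(2)] by blast
      have "f = u * (p ^ Suc i * f) + s * (v * f)"
        using arg_cong[OF uv, of "\<lambda>t. t * f"] by (simp add: algebra_simps)
      then have "s dvd f" using sd by (metis dvd_add dvd_mult dvd_triv_left)
      have "f = u * f * p ^ Suc i + v * (s * f)"
        using arg_cong[OF uv, of "\<lambda>t. t * f"] by (simp add: algebra_simps)
      then have "p ^ Suc i dvd f" using \<open>p ^ Suc i dvd s * f\<close> by (metis dvd_add dvd_mult dvd_triv_right)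
      then obtain f' where f': "f = p ^ Suc i * f'" by auto
      have "s dvd f'"
      proof -
        have "f' = u * f + s * (v * f')"
          using arg_cong[OF uv, of "\<lambda>t. t * f'"] f' by (simp add: algebra_simps)
        then show ?thesis using \<open>s dvd f\<close> by (metis dvd_add dvd_mult dvd_triv_left)
      qed
      then have "p ^ Suc i * s dvd f" using f' by simp
      then have "degree (p ^ Suc i * s) \<le> degree f" using f0(1) dvd_imp_degree_le by blast
      moreover have "degree f \<le> degree g0" using X(2)[OF f] X0 by simp
      moreover have "degree (p ^ Suc i * s) = degree p + degree g0"
        using p0 s0 unfolding gs(1) by (simp add: degree_mult_eq mult.assoc)
      ultimately show False using irreducible_degree_pos[OF p(1)] by simp
    qed
  qed
qed

text \<open>A nontorsion vector spans a copy of the polynomial ring, and a finite-dimensional space of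
  polynomials has bounded degrees.\<close>

lemma nontorsion_finite_degrees:
  assumes w: "\<And>h. h \<noteq> 0 \<Longrightarrow> pact h w \<noteq> 0" and "finite E"
  shows "\<exists>D. \<forall>h. pact h w \<in> span E \<longrightarrow> degree h \<le> D"
  using \<open>finite E\<close>
proof (induction E)
  case empty
  have "\<forall>h. pact h w \<in> span {} \<longrightarrow> degree h \<le> 0"
  proof (intro allI impI)
    fix h assume "pact h w \<in> span {}"
    then have "h = 0" using w[of h] by auto
    then show "degree h \<le> 0" by simp
  qed
  then show ?case by blast
next
  case (insert x E)
  then obtain D where D: "\<And>h. pact h w \<in> span E \<Longrightarrow> degree h \<le> D" by blast
  show ?case
  proof (cases "\<exists>y h0. y \<in> span E \<and> pact h0 w = y + x")
    case True
    then obtain y h0 where yh: "y \<in> span E" "pact h0 w = y + x" by blast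
    have "degree h \<le> max D (degree h0)" if h: "pact h w \<in> span (insert x E)" for h
    proof -
      obtain c z where cz: "z \<in> span E" "pact h w = z + c *s x" using span_insertD[OF h] .
      have "pact (h - smult c h0) w = z - c *s y"
        by (simp add: pact_diff pact_smult cz yh scale_right_distrib)
      then have "degree (h - smult c h0) \<le> D" using D cz(1) yh(1) span_diff span_scale by simp
      moreover have "h = (h - smult c h0) + smult c h0" by simp
      ultimately show ?thesis using degree_add_le_max[of "h - smult c h0" "smult c h0"]
          degree_smult_le[of c h0] by (metis (no_types, lifting) max.mono order_trans)
    qed
    then show ?thesis by blast
  next
    case False
    have "degree h \<le> D" if h: "pact h w \<in> span (insert x E)" for h
    proof -
      obtain c z where cz: "z \<in> span E" "pact h w = z + c *s x" using span_insertD[OF h] .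
      have "c = 0"
      proof (rule ccontr)
        assume "c \<noteq> 0"
        then have "pact (smult (inverse c) h) w = inverse c *s z + x"
          by (simp add: pact_smult cz(2) scale_right_distrib)
        then show False using False span_scale[OF cz(1)] by blast
      qed
      then show ?thesis using D cz by simp
    qed
    then show ?thesis by blast
  qed
qed

lemma finite_torsion_annihilator:
  assumes "finite E" "\<And>e. e \<in> E \<Longrightarrow> \<exists>h. h \<noteq> 0 \<and> pact h e = 0"
  obtains g where "g \<noteq> 0" "\<And>e. e \<in> span E \<Longrightarrow> pact g e = 0"
proof -
  have "\<exists>g. g \<noteq> 0 \<and> (\<forall>e\<in>E. pact g e = 0)" using assms
  proof (induction E)
    case empty show ?case by (rule exI[of _ 1]) simp
  next
    case (insert x E)
    obtain g where g: "g \<noteq> 0" "\<forall>e\<in>E. pact g e = 0" using insert.IH insert.prems by blast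
    obtain h where h: "h \<noteq> 0" "pact h x = 0" using insert.prems by blast
    have "g * h \<noteq> 0" "\<forall>e\<in>insert x E. pact (g * h) e = 0"
      using g h by (auto simp: pact_mult pact_v0) (metis pact_commute pact_v0)
    then show ?case by blast
  qed
  then obtain g where g: "g \<noteq> 0" "\<forall>e\<in>E. pact g e = 0" by blast
  have "subspace {e. pact g e = 0}" by (auto simp: subspace_def pact_v0 pact_vadd pact_vscale)
  then have "span E \<subseteq> {e. pact g e = 0}" using g(2) by (intro span_minimal) auto
  then show thesis using that g(1) by blast
qed

text \<open>A gliding hump argument.  Suppose that for all finite \<open>E\<close> and all \<open>n\<close> some \<open>w\<close> has
  \<open>w, a w, \<dots>, a^n w\<close> independent modulo the span of \<open>E\<close>.  Then one functional can be made to take the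
  values \<open>0, \<dots>, 0, 1\<close> on such a sequence for each \<open>n\<close>, hence to read off the leading coefficient of
  every \<open>h\<close> of degree \<open>n\<close> from \<open>h(a) w\<close>, so that no \<open>h \<noteq> 0\<close> kills it.  Therefore some \<open>E\<close> and \<open>n\<close>
  violate this; it follows that \<open>W\<close> is torsion with orders of bounded degree.\<close>

lemma dual_torsion_bounded:
  assumes W: "subspace W" "\<And>w. w \<in> W \<Longrightarrow> a w \<in> W"
    and dual: "\<And>l. fnl l \<Longrightarrow> \<exists>h. h \<noteq> 0 \<and> (\<forall>w\<in>W. l (pact h w) = 0)"
  obtains k where "k \<noteq> 0" "\<And>w. w \<in> W \<Longrightarrow> pact k w = 0"
proof -
  have Wn: "(a ^^ j) w \<in> W" if "w \<in> W" for j w using that by (induction j) (auto intro: W)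
  \<comment> \<open>independence modulo every finite set has to fail, or else \<open>R\<close> could be met at every stage\<close>
  have "\<exists>E n. finite E \<and> E \<subseteq> W \<and> (\<forall>w\<in>W. \<exists>h. h \<noteq> 0 \<and> degree h \<le> n \<and> pact h w \<in> span E)"
  proof (rule ccontr)
    assume neg: "\<not> ?thesis"
    define R where "R n E r = (\<exists>w\<in>W. \<forall>j\<le>n. (a ^^ j) w \<in> span E \<and> r ((a ^^ j) w) = (if j = n then 1 else 0))"
      for n E and r :: "'v \<Rightarrow> 'f"
    have step: "\<exists>E' r'. finite E' \<and> E \<subseteq> E' \<and> E' \<subseteq> W \<and> fnl r' \<and> (\<forall>s\<in>span E. r' s = r s) \<and> R n E' r'"
      if E: "finite E" "E \<subseteq> W" "fnl r" for n E r
    proof -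
      have "\<not> (\<forall>w\<in>W. \<exists>h. h \<noteq> 0 \<and> degree h \<le> n \<and> pact h w \<in> span E)"
        using neg E(1,2) by meson
      then obtain w where w: "w \<in> W" "\<And>h. h \<noteq> 0 \<Longrightarrow> degree h \<le> n \<Longrightarrow> pact h w \<notin> span E"
        by meson
      define G where "G = {(e + pact h w, r e + coeff h n) | e h. e \<in> span E \<and> degree h \<le> n}"
      have GI: "(e + pact h w, r e + coeff h n) \<in> G" if "e \<in> span E" "degree h \<le> n" for e h
        unfolding G_def using that by blast
      have z: "(0, 0) \<in> G" using GI[of 0 0] by (simp add: span_zero pact_0 fnl_0[OF E(3)])
      have p: "(x + x', y + y') \<in> G" if xy: "(x, y) \<in> G" "(x', y') \<in> G" for x y x' y'
      proof -
        obtain e h e' h' where *: "x = e + pact h w" "y = r e + coeff h n" "x' = e' + pact h' w"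
          "y' = r e' + coeff h' n" "e \<in> span E" "e' \<in> span E" "degree h \<le> n" "degree h' \<le> n"
          using xy G_def by auto
        then have "x + x' = (e + e') + pact (h + h') w" "y + y' = r (e + e') + coeff (h + h') n"
          by (simp_all add: pact_add fnl_add[OF E(3)])
        moreover have "e + e' \<in> span E" "degree (h + h') \<le> n" using * by (simp_all add: span_add degree_add_le)
        ultimately show ?thesis using GI by metis
      qed
      have m: "(c *s x, c * y) \<in> G" if xy: "(x, y) \<in> G" for c x y
      proof -
        obtain e h where *: "x = e + pact h w" "y = r e + coeff h n" "e \<in> span E" "degree h \<le> n"
          using xy G_def by auto
        then have "c *s x = c *s e + pact (smult c h) w" "c * y = r (c *s e) + coeff (smult c h) n"
          by (simp_all add: pact_smult fnl_scale[OF E(3)] scale_right_distrib distrib_left)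
        moreover have "degree (smult c h) \<le> n" using *(4) degree_smult_le order_trans by blast
        moreover have "c *s e \<in> span E" using *(3) by (rule span_scale)
        ultimately show ?thesis using GI by metis
      qed
      have u: "y = 0" if y: "(0, y) \<in> G" for y
      proof -
        obtain e h where *: "0 = e + pact h w" "y = r e + coeff h n" "e \<in> span E" "degree h \<le> n"
          using y G_def by auto
        then have "pact h w = - e" by (simp add: eq_neg_iff_add_eq_0 add.commute)
        then have "pact h w \<in> span E" using *(3) span_neg by simp
        then have "h = 0" using w(2) *(4) by blast
        then show ?thesis using * by (simp add: pact_0 fnl_0[OF E(3)])
      qed
      obtain r' where r': "fnl r'" "\<And>x y. (x, y) \<in> G \<Longrightarrow> r' x = y"
        using fnl_relation_extend[OF z p m u] by blast
      define E' where "E' = E \<union> (\<lambda>j. (a ^^ j) w) ` {..n}"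
      have "R n E' r'" unfolding R_def
      proof (intro bexI[of _ w] allI impI conjI)
        fix j assume j: "j \<le> n"
        then show "(a ^^ j) w \<in> span E'" unfolding E'_def by (intro span_base) auto
        show "r' ((a ^^ j) w) = (if j = n then 1 else 0)"
          using r'(2)[OF GI[of 0 "monom 1 j"]] j
          by (simp add: span_zero degree_monom_eq pact_monom fnl_0[OF E(3)])
      qed fact
      moreover have "r' s = r s" if "s \<in> span E" for s
        using r'(2)[OF GI[of s 0]] that by (simp add: pact_0)
      moreover have "finite E'" "E \<subseteq> E'" "E' \<subseteq> W"
        unfolding E'_def using E(1,2) Wn[OF w(1)] by auto
      ultimately show ?thesis using r'(1) by blast
    qed
    have loc: "R n E r'" if loc_prems: "R n E r" "\<And>s. s \<in> span E \<Longrightarrow> r' s = r s" for n E r r'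
    proof -
      obtain w where "w \<in> W"
        "\<And>j. j \<le> n \<Longrightarrow> (a ^^ j) w \<in> span E \<and> r ((a ^^ j) w) = (if j = n then 1 else 0)"
        using loc_prems(1) unfolding R_def by blast
      then show ?thesis unfolding R_def using loc_prems(2) by (intro bexI[of _ w]) simp_all
    qed
    have "\<exists>l. fnl l \<and> (\<forall>n. \<exists>E. R n E l)"
      by (rule functional_by_stages[of W R], fact step, fact loc)
    then obtain l where l: "fnl l" "\<And>n. \<exists>E. R n E l" by blast
    obtain h where h: "h \<noteq> 0" "\<forall>w\<in>W. l (pact h w) = 0" using dual[OF l(1)] by blast
    obtain w where w: "w \<in> W" "\<And>j. j \<le> degree h \<Longrightarrow> l ((a ^^ j) w) = (if j = degree h then 1 else 0)"
      using l(2)[of "degree h"] unfolding R_def by blast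
    have "l (pact h w) = (\<Sum>j\<le>degree h. if j = degree h then lead_coeff h else 0)"
      unfolding pact_def fnl_sum[OF l(1)] fnl_scale[OF l(1)] by (intro sum.cong) (auto simp: w(2))
    also have "\<dots> = lead_coeff h" by simp
    finally show False using h w(1) by auto
  qed
  then obtain E n where E: "finite E" "E \<subseteq> W"
    "\<And>w. w \<in> W \<Longrightarrow> \<exists>h. h \<noteq> 0 \<and> degree h \<le> n \<and> pact h w \<in> span E" by blast
  have tors: "\<exists>h. h \<noteq> 0 \<and> pact h w = 0" if w: "w \<in> W" for w
  proof (rule ccontr)
    assume "\<not> ?thesis"
    then have "\<And>h. h \<noteq> 0 \<Longrightarrow> pact h w \<noteq> 0" by blast
    from nontorsion_finite_degrees[OF this E(1)]
    obtain D where D: "\<And>h. pact h w \<in> span E \<Longrightarrow> degree h \<le> D" by blast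
    obtain h where h: "h \<noteq> 0" "pact h ((a ^^ Suc D) w) \<in> span E"
      using E(3)[OF Wn[OF w, of "Suc D"]] by metis
    have "pact h ((a ^^ Suc D) w) = pact (h * monom 1 (Suc D)) w" by (simp only: pact_mult pact_monom scale_one)
    then have "degree (h * monom 1 (Suc D)) \<le> D" using D h(2) by simp
    then show False using h(1) by (simp add: degree_mult_eq degree_monom_eq)
  qed
  obtain g where g: "g \<noteq> 0" "\<And>e. e \<in> span E \<Longrightarrow> pact g e = 0"
  proof (rule finite_torsion_annihilator[OF E(1)])
    show "\<exists>h. h \<noteq> 0 \<and> pact h e = 0" if "e \<in> E" for e using that E(2) tors by auto
  qed (use that in blast)
  have "\<exists>h. h \<noteq> 0 \<and> degree h \<le> degree g + n \<and> pact h w = 0" if w: "w \<in> W" for w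
  proof -
    obtain h where h: "h \<noteq> 0" "degree h \<le> n" "pact h w \<in> span E" using E(3)[OF w] by blast
    then have "g * h \<noteq> 0" "degree (g * h) \<le> degree g + n" "pact (g * h) w = 0"
      using g by (simp_all add: degree_mult_eq pact_mult)
    then show ?thesis by blast
  qed
  from bounded_torsion_annihilator[OF W this] show thesis using that by metis
qed


section \<open>The hypothesis on the dual as an identity between functionals\<close>

definition bicomm :: "('v \<Rightarrow> 'v) \<Rightarrow> bool" where
  "bicomm c \<longleftrightarrow> lin c \<and> (\<forall>x. lin x \<longrightarrow> (\<forall>v. x (a v) = a (x v)) \<longrightarrow> (\<forall>v. c (x v) = x (c v)))"

text \<open>In \<open>V \<otimes> V*\<close> this says that \<open>c v \<otimes> r - v \<otimes> r c\<close> is a sum of terms \<open>a y \<otimes> s - y \<otimes> s a\<close>.  The tensor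
  \<open>v \<otimes> r\<close> is represented by the functional \<open>x \<mapsto> r (x v)\<close> on the operators \<open>x\<close> of \<open>V\<close>.\<close>

definition locally_central :: "('v \<Rightarrow> 'v) \<Rightarrow> bool" where
  "locally_central c \<longleftrightarrow> (\<forall>v r. fnl r \<longrightarrow> (\<exists>ys. (\<forall>y\<in>set ys. fnl (fst y)) \<and>
     (\<forall>x. lin x \<longrightarrow> r (x (c v)) - r (c (x v)) =
       (\<Sum>y\<leftarrow>ys. fst y (x (a (snd y)) - a (x (snd y)))))))"

lemma bicommutant_eq: "bicommutant UNIV (linops scale) a = {c. bicomm c}"
  by (auto simp: bicommutant_def commutant_def linops_def bicomm_def)

lemma bicomm_lin: "bicomm c \<Longrightarrow> lin c"
  by (simp add: bicomm_def)

lemma bicomm_commute: "bicomm c \<Longrightarrow> c (a v) = a (c v)"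
  using lin_a by (simp add: bicomm_def)

text \<open>Were \<open>c v \<otimes> r - v \<otimes> r c\<close> outside the span \<open>S\<close> of all \<open>a y \<otimes> s - y \<otimes> s a\<close>, a functional \<open>Phi\<close> would
  vanish on \<open>S\<close> but not on it.  Then \<open>T s = (\<lambda>u. Phi (u \<otimes> s))\<close> is an operator on the dual that commutes
  with the adjoint of \<open>a\<close> but not with that of \<open>c\<close>.\<close>

lemma locally_central_of_adjoint:
  assumes c: "lin c"
    and adj: "adjoint scale c \<in> bicommutant (dual scale) (dual_linops scale) (adjoint scale a)"
  shows "locally_central c"
  unfolding locally_central_def
proof (intro allI impI)
  fix v r assume r: "fnl r"
  define sc :: "'f \<Rightarrow> (('v \<Rightarrow> 'v) \<Rightarrow> 'f) \<Rightarrow> ('v \<Rightarrow> 'v) \<Rightarrow> 'f" where "sc = (\<lambda>k F x. k * F x)"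
  \<comment> \<open>only the functionals of this space are of interest; its operator is the identity\<close>
  interpret F: endo sc "\<lambda>F. F"
  proof -
    have "vector_space sc"
      unfolding sc_def by unfold_locales (auto simp: fun_eq_iff algebra_simps)
    then show "endo sc (\<lambda>F. F)"
      by (simp add: endo_def endo_axioms_def Vector_Spaces.linear_iff)
  qed
  define tau :: "'v \<Rightarrow> ('v \<Rightarrow> 'f) \<Rightarrow> ('v \<Rightarrow> 'v) \<Rightarrow> 'f" where
    "tau u s = (\<lambda>x. if lin x then s (x u) else 0)" for u s
  define com where "com ys = (\<lambda>x. if lin x then \<Sum>y\<leftarrow>ys. fst y (x (a (snd y)) - a (x (snd y))) else 0)"
    for ys :: "(('v \<Rightarrow> 'f) \<times> 'v) list"
  define S where "S = {com ys | ys. \<forall>y\<in>set ys. fnl (fst y)}"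
  have S: "F.subspace S"
    unfolding F.subspace_def
  proof (intro conjI ballI allI)
    have "com [] \<in> S" unfolding S_def by (intro CollectI exI[of _ "[]"]) simp
    moreover have "com [] = 0" by (simp add: com_def fun_eq_iff)
    ultimately show "0 \<in> S" by simp
  next
    fix F G assume "F \<in> S" "G \<in> S"
    then obtain ys zs where ys: "F = com ys" "\<forall>y\<in>set ys. fnl (fst y)" "G = com zs" "\<forall>y\<in>set zs. fnl (fst y)"
      unfolding S_def by blast
    have "F + G = com (ys @ zs)" unfolding ys(1,3) by (simp add: com_def fun_eq_iff)
    then show "F + G \<in> S" unfolding S_def using ys(2,4) by (intro CollectI exI[of _ "ys @ zs"]) auto
  next
    fix k F assume "F \<in> S"
    then obtain ys where ys: "F = com ys" "\<forall>y\<in>set ys. fnl (fst y)" unfolding S_def by blast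
    have "sc k F = com (map (\<lambda>y. (\<lambda>u. k * fst y u, snd y)) ys)"
      unfolding ys(1) by (simp add: com_def fun_eq_iff sc_def o_def sum_list_const_mult)
    moreover have "fnl (\<lambda>u. k * l u)" if "fnl l" for l
      using that by (simp add: fnl_iff algebra_simps)
    ultimately show "sc k F \<in> S" unfolding S_def using ys(2)
      by (intro CollectI exI[of _ "map (\<lambda>y. (\<lambda>u. k * fst y u, snd y)) ys"]) auto
  qed
  define F0 where "F0 = tau (c v) r - tau v (r \<circ> c)"
  have "F0 \<in> S"
  proof (rule ccontr)
    assume "F0 \<notin> S"
    obtain Phi where Phi: "F.fnl Phi" "Phi F0 = 1" "\<And>s. s \<in> S \<Longrightarrow> Phi s = 0"
      using F.fnl_separates[OF S \<open>F0 \<notin> S\<close>] by blast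
    define T where "T = (\<lambda>s\<in>dual scale. \<lambda>u. Phi (tau u s))"
    have Phi_add: "Phi (F + G) = Phi F + Phi G" for F G using Phi(1) F.fnl_add by blast
    have Phi_scale: "Phi (\<lambda>x. k * F x) = k * Phi F" for k F
      using F.fnl_scale[OF Phi(1), of k F] by (simp add: sc_def)
    have T: "T s = (\<lambda>u. Phi (tau u s))" if "s \<in> dual scale" for s using that by (simp add: T_def)
    have tau_add: "tau (u + w) s = tau u s + tau w s" if "s \<in> dual scale" for u w s
      using that by (auto simp: tau_def fun_eq_iff dual_def lin_add fnl_add)
    have tau_scale: "tau (k *s u) s = (\<lambda>x. k * tau u s x)" if "s \<in> dual scale" for k u s
      using that by (auto simp: tau_def fun_eq_iff dual_def lin_scale fnl_scale)
    have dual_plus: "(\<lambda>u. s u + t u) \<in> dual scale" if "s \<in> dual scale" "t \<in> dual scale" for s t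
      using that by (simp add: dual_def fnl_iff algebra_simps)
    have dual_scale: "(\<lambda>u. k * s u) \<in> dual scale" if "s \<in> dual scale" for k s
      using that by (simp add: dual_def fnl_iff algebra_simps)
    have "T \<in> dual_linops scale"
      unfolding dual_linops_def
    proof (intro CollectI conjI ballI allI)
      show "T \<in> dual scale \<rightarrow>\<^sub>E dual scale"
      proof (intro PiE_I)
        fix s assume s: "s \<in> dual scale"
        show "T s \<in> dual scale" unfolding T[OF s] dual_def
          by (intro CollectI fnlI) (simp_all add: tau_add[OF s] tau_scale[OF s] Phi_add Phi_scale)
      qed (simp add: T_def)
    next
      fix s t assume st: "s \<in> dual scale" "t \<in> dual scale"
      have "tau u (\<lambda>w. s w + t w) = tau u s + tau u t" for u by (simp add: tau_def fun_eq_iff)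
      then show "T (\<lambda>v. s v + t v) = (\<lambda>v. T s v + T t v)"
        by (simp add: T[OF st(1)] T[OF st(2)] T[OF dual_plus[OF st]] Phi_add)
    next
      fix k s assume s: "s \<in> dual scale"
      have "tau u (\<lambda>w. k * s w) = (\<lambda>x. k * tau u s x)" for u by (simp add: tau_def fun_eq_iff)
      then show "T (\<lambda>v. k * s v) = (\<lambda>v. k * T s v)"
        by (simp add: T[OF s] T[OF dual_scale[OF s]] Phi_scale)
    qed
    moreover have comp: "s \<circ> y \<in> dual scale" if "s \<in> dual scale" "lin y" for s y
      using that by (simp add: dual_def fnl_iff lin_iff)
    have T_dual: "T s \<in> dual scale" if "s \<in> dual scale" for s
      using calculation that by (auto simp: dual_linops_def)
    have "T (adjoint scale a s) = adjoint scale a (T s)" if s: "s \<in> dual scale" for s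
    proof -
      have "Phi (tau u (s \<circ> a)) = Phi (tau (a u) s)" for u
      proof -
        have fs: "fnl s" using s by (simp add: dual_def)
        have "tau (a u) s = tau u (s \<circ> a) + com [(s, u)]"
          by (auto simp: tau_def com_def fun_eq_iff fnl_diff[OF fs])
        moreover have "com [(s, u)] \<in> S" unfolding S_def using fs
          by (intro CollectI exI[of _ "[(s, u)]"]) simp
        ultimately show ?thesis by (simp add: Phi_add Phi(3))
      qed
      then show ?thesis
        using T_dual[OF s] by (simp add: adjoint_def s T comp[OF s lin_a] fun_eq_iff)
    qed
    ultimately have "T \<in> commutant (dual scale) (dual_linops scale) {adjoint scale a}"
      by (simp add: commutant_def)
    moreover have rd: "r \<in> dual scale" using r by (simp add: dual_def)
    ultimately have "adjoint scale c (T r) = T (adjoint scale c r)"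
      using adj unfolding bicommutant_def commutant_def[of _ _ "commutant _ _ _"] by blast
    then have "T r \<circ> c = T (r \<circ> c)" using T_dual[OF rd] by (simp add: adjoint_def rd)
    then have "Phi (tau (c v) r) = Phi (tau v (r \<circ> c))"
      by (simp add: T[OF rd] T[OF comp[OF rd c]] fun_eq_iff)
    moreover have "tau (c v) r = F0 + tau v (r \<circ> c)" by (simp add: F0_def)
    ultimately show False using Phi(2) by (simp add: Phi_add)
  qed
  then obtain ys where ys: "F0 = com ys" "\<forall>y\<in>set ys. fnl (fst y)" unfolding S_def by blast
  have "r (x (c v)) - r (c (x v)) = (\<Sum>y\<leftarrow>ys. fst y (x (a (snd y)) - a (x (snd y))))" if "lin x" for x
    using fun_cong[OF ys(1), of x] that by (simp add: F0_def tau_def com_def)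
  with ys(2) show "\<exists>ys. (\<forall>y\<in>set ys. fnl (fst y)) \<and> (\<forall>x. lin x \<longrightarrow> r (x (c v)) - r (c (x v)) =
       (\<Sum>y\<leftarrow>ys. fst y (x (a (snd y)) - a (x (snd y)))))" by blast
qed

text \<open>The form in which the hypothesis is used most: an operator that commutes with \<open>a\<close> only on
  finitely many vectors already commutes with \<open>c\<close>, as far as one vector and one functional see.\<close>

lemma locally_centralE:
  assumes "locally_central c" "fnl r"
  obtains A where "finite A" "\<And>x. lin x \<Longrightarrow> (\<And>y. y \<in> A \<Longrightarrow> x (a y) = a (x y)) \<Longrightarrow> r (x (c v)) = r (c (x v))"
proof -
  obtain ys where ys: "\<And>y. y \<in> set ys \<Longrightarrow> fnl (fst y)" "\<And>x. lin x \<Longrightarrow> r (x (c v)) - r (c (x v)) =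
       (\<Sum>y\<leftarrow>ys. fst y (x (a (snd y)) - a (x (snd y))))"
    using assms unfolding locally_central_def by blast
  have "r (x (c v)) = r (c (x v))"
    if x: "lin x" "\<And>y. y \<in> snd ` set ys \<Longrightarrow> x (a y) = a (x y)" for x
  proof -
    have "(\<Sum>y\<leftarrow>ys. fst y (x (a (snd y)) - a (x (snd y)))) = (\<Sum>y\<leftarrow>ys. 0)"
      by (rule arg_cong[of _ _ sum_list], rule map_cong) (auto simp: x(2) fnl_0 ys(1))
    then show ?thesis using ys(2)[OF x(1)] by simp
  qed
  then show thesis using that[of "snd ` set ys"] by simp
qed


section \<open>Primary vectors\<close>

lemma increasing_meets_finite_span:
  fixes S :: "nat \<Rightarrow> 'v set"
  assumes sub: "\<And>n. subspace (S n)" and inc: "\<And>m n. m \<le> n \<Longrightarrow> S m \<subseteq> S n" and "finite E"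
  shows "\<exists>M. \<forall>m. \<forall>y\<in>span E. y \<in> S m \<longrightarrow> y \<in> S M"
  using \<open>finite E\<close>
proof (induction E)
  case empty
  then show ?case using sub by (auto simp: subspace_def)
next
  case (insert x E)
  then obtain M where M: "\<And>m y. y \<in> span E \<Longrightarrow> y \<in> S m \<Longrightarrow> y \<in> S M" by blast
  show ?case
  proof (cases "\<exists>N y. y \<in> span E \<and> y + x \<in> S N")
    case True
    then obtain N y where y: "y \<in> span E" "y + x \<in> S N" by blast
    let ?M = "max M N"
    have "z \<in> S ?M" if z: "z \<in> span (insert x E)" "z \<in> S m" for m z
    proof -
      obtain c y' where cy: "y' \<in> span E" "z = y' + c *s x" using span_insertD[OF z(1)] .
      let ?m = "max m N"
      have e: "z - c *s (y + x) = y' - c *s y" using cy by (simp add: scale_right_distrib)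
      have "z \<in> S ?m" "y + x \<in> S ?m" "y + x \<in> S ?M"
        using z(2) y(2) inc[of m ?m] inc[of N ?m] inc[of N ?M] by auto
      then have "z - c *s (y + x) \<in> S ?m" using sub subspace_diff subspace_scale by blast
      then have "y' - c *s y \<in> S M" using M[of "y' - c *s y" ?m] e cy(1) y(1) span_diff span_scale by auto
      then have "z - c *s (y + x) \<in> S ?M" using e inc[of M ?M] by auto
      then have "(z - c *s (y + x)) + c *s (y + x) \<in> S ?M"
        using \<open>y + x \<in> S ?M\<close> sub subspace_add subspace_scale by metis
      then show ?thesis by simp
    qed
    then show ?thesis by blast
  next
    case False
    have "z \<in> S M" if z: "z \<in> span (insert x E)" "z \<in> S m" for m z
    proof -
      obtain c y where cy: "y \<in> span E" "z = y + c *s x" using span_insertD[OF z(1)] .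
      have "c = 0"
      proof (rule ccontr)
        assume "c \<noteq> 0"
        then have "inverse c *s z = inverse c *s y + x" using cy(2) by (simp add: scale_right_distrib)
        moreover have "inverse c *s z \<in> S m" using z(2) sub subspace_scale by blast
        ultimately show False using False cy(1) span_scale by metis
      qed
      then show ?thesis using M[of y m] cy z(2) by auto
    qed
    then show ?thesis by blast
  qed
qed

lemma subspace_ker: "subspace {v. pact h v = 0}"
  by (simp add: subspace_def pact_v0 pact_vadd pact_vscale)

lemma ker_power_mono: "m \<le> n \<Longrightarrow> pact (p ^ m) v = 0 \<Longrightarrow> pact (p ^ n) v = 0"
  using pact_dvd_0 le_imp_power_dvd by blast

lemma ker_power_stable:
  assumes "\<And>v. pact (p ^ Suc n) v = 0 \<Longrightarrow> pact (p ^ n) v = 0" and "pact (p ^ m) v = 0"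
  shows "pact (p ^ n) v = 0"
proof (cases "m \<le> n")
  case True then show ?thesis using ker_power_mono assms(2) by blast
next
  case False
  then have "n \<le> m" by simp
  then show ?thesis using assms(2)
  proof (induction rule: dec_induct)
    case (step k)
    have "pact (p ^ Suc n) (pact (p ^ (k - n)) v) = 0"
      using step.prems step.hyps by (simp only: pact_power_add[symmetric]) simp
    then have "pact (p ^ n) (pact (p ^ (k - n)) v) = 0" by (rule assms(1))
    then have "pact (p ^ k) v = 0" using step.hyps by (simp only: pact_power_add[symmetric]) simp
    then show ?case by (rule step.IH)
  qed
qed

text \<open>The functional \<open>r\<close> has to be fixed before the finite set \<open>A\<close>, because \<open>A\<close> will come from applying
  local centrality to \<open>r\<close>.  If the kernels of \<open>p^j\<close> become stationary at \<open>N\<close>, it suffices that \<open>r\<close> is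
  nonzero on one vector \<open>p^(N-1) u\<close>; otherwise \<open>r\<close> is nonzero on every member of the decreasing sequence
  \<open>p^j (ker p^(j+1))\<close>, and \<open>N\<close> may be taken as large as \<open>A\<close> and \<open>n\<close> demand.\<close>

lemma primary_test_functional:
  assumes w: "w \<noteq> 0" "pact p w = 0"
  obtains r where "fnl r" "\<And>A n. finite A \<Longrightarrow> \<exists>N u. N > 0 \<and> (\<forall>v. pact (p ^ n) v = 0 \<longrightarrow> pact (p ^ N) v = 0) \<and>
    pact (p ^ N) u = 0 \<and> r (pact (p ^ (N - 1)) u) \<noteq> 0 \<and>
    (\<forall>y\<in>span A. pact (p ^ N) (pact (p ^ N) y) = 0 \<longrightarrow> pact (p ^ N) y = 0)"
proof (cases "\<exists>j. \<forall>v. pact (p ^ Suc j) v = 0 \<longrightarrow> pact (p ^ j) v = 0")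
  case True
  define N where "N = (LEAST j. \<forall>v. pact (p ^ Suc j) v = 0 \<longrightarrow> pact (p ^ j) v = 0)"
  have N: "\<And>v. pact (p ^ Suc N) v = 0 \<Longrightarrow> pact (p ^ N) v = 0"
    using LeastI_ex[OF True] unfolding N_def by blast
  have "N > 0" using N[of w] w by (intro gr0I) (simp add: pact_1)
  then have "\<not> (\<forall>v. pact (p ^ Suc (N - 1)) v = 0 \<longrightarrow> pact (p ^ (N - 1)) v = 0)"
    unfolding N_def by (intro not_less_Least) simp
  then obtain u where u: "pact (p ^ N) u = 0" "pact (p ^ (N - 1)) u \<noteq> 0" using \<open>N > 0\<close> by auto
  obtain r where r: "fnl r" "r (pact (p ^ (N - 1)) u) = 1"
    using fnl_separates[of "{0}" "pact (p ^ (N - 1)) u"] u(2) subspace_single_0 by auto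
  have st: "pact (p ^ N) v = 0" if "pact (p ^ m) v = 0" for m v
    using ker_power_stable[OF N that] .
  show thesis
  proof (rule that[OF r(1)], intro exI[of _ N] exI[of _ u] conjI allI impI ballI)
    show "r (pact (p ^ (N - 1)) u) \<noteq> 0" using r(2) by simp
    show "pact (p ^ N) v = 0" if "pact (p ^ n) v = 0" for n v using st that .
    show "pact (p ^ N) y = 0" if "pact (p ^ N) (pact (p ^ N) y) = 0" for y
      using st[of "N + N" y] that by (simp add: pact_power_add)
    show "N > 0" by fact
    show "pact (p ^ N) u = 0" by fact
  qed
next
  case False
  define S where "S j = pact (p ^ j) ` {v. pact (p ^ Suc j) v = 0}" for j
  have sub: "subspace (S j)" for j
    unfolding S_def subspace_def
  proof (intro conjI ballI allI)
    show "0 \<in> pact (p ^ j) ` {v. pact (p ^ Suc j) v = 0}" by (intro image_eqI[of _ _ 0]) (simp_all add: pact_v0)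
  next
    fix x y assume "x \<in> pact (p ^ j) ` {v. pact (p ^ Suc j) v = 0}" "y \<in> pact (p ^ j) ` {v. pact (p ^ Suc j) v = 0}"
    then obtain u v where "x = pact (p ^ j) u" "y = pact (p ^ j) v" "pact (p ^ Suc j) u = 0" "pact (p ^ Suc j) v = 0" by blast
    then show "x + y \<in> pact (p ^ j) ` {v. pact (p ^ Suc j) v = 0}"
      by (intro image_eqI[of _ _ "u + v"]) (simp_all add: pact_vadd)
  next
    fix c x assume "x \<in> pact (p ^ j) ` {v. pact (p ^ Suc j) v = 0}"
    then obtain u where "x = pact (p ^ j) u" "pact (p ^ Suc j) u = 0" by blast
    then show "c *s x \<in> pact (p ^ j) ` {v. pact (p ^ Suc j) v = 0}"
      by (intro image_eqI[of _ _ "c *s u"]) (simp_all add: pact_vscale)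
  qed
  have dec: "S n \<subseteq> S m" if "m \<le> n" for m n
  proof
    fix x assume "x \<in> S n"
    then obtain u where u: "x = pact (p ^ n) u" "pact (p ^ Suc n) u = 0" unfolding S_def by blast
    have "x = pact (p ^ m) (pact (p ^ (n - m)) u)" using u(1) that by (simp only: pact_power_add[symmetric]) simp
    moreover have "pact (p ^ Suc m) (pact (p ^ (n - m)) u) = 0"
      using u(2) that by (simp only: pact_power_add[symmetric]) simp
    ultimately show "x \<in> S m" unfolding S_def by blast
  qed
  have nz: "\<exists>u\<in>S j. u \<noteq> 0" for j
  proof -
    obtain v where "pact (p ^ Suc j) v = 0" "pact (p ^ j) v \<noteq> 0" using False by blast
    then show ?thesis unfolding S_def by blast
  qed
  have "\<exists>l. fnl l \<and> (\<forall>n. \<exists>u\<in>S n. l u \<noteq> 0)"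
    by (rule functional_nonzero_on_decreasing[of S], fact sub, fact dec, fact nz)
  then obtain r where r: "fnl r" "\<And>n. \<exists>u\<in>S n. r u \<noteq> 0" by blast
  show thesis
  proof (rule that[OF r(1)])
    fix A n assume "finite (A :: 'v set)"
    have "\<exists>M. \<forall>m. \<forall>y\<in>span A. y \<in> {v. pact (p ^ m) v = 0} \<longrightarrow> y \<in> {v. pact (p ^ M) v = 0}"
    proof (rule increasing_meets_finite_span)
      show "subspace {v. pact (p ^ n) v = 0}" for n by (rule subspace_ker)
      show "{v. pact (p ^ m) v = 0} \<subseteq> {v. pact (p ^ n) v = 0}" if "m \<le> n" for m n
        using ker_power_mono[OF that] by blast
    qed fact
    then obtain M where M: "\<And>m y. y \<in> span A \<Longrightarrow> pact (p ^ m) y = 0 \<Longrightarrow> pact (p ^ M) y = 0" by blast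
    define N where "N = Suc (max M n)"
    obtain u where u: "pact (p ^ Suc (N - 1)) u = 0" "r (pact (p ^ (N - 1)) u) \<noteq> 0"
      using r(2)[of "N - 1"] unfolding S_def by blast
    show "\<exists>N u. N > 0 \<and> (\<forall>v. pact (p ^ n) v = 0 \<longrightarrow> pact (p ^ N) v = 0) \<and>
      pact (p ^ N) u = 0 \<and> r (pact (p ^ (N - 1)) u) \<noteq> 0 \<and>
      (\<forall>y\<in>span A. pact (p ^ N) (pact (p ^ N) y) = 0 \<longrightarrow> pact (p ^ N) y = 0)"
    proof (intro exI[of _ N] exI[of _ u] conjI allI impI ballI)
      show "N > 0" by (simp add: N_def)
      show "pact (p ^ N) u = 0" using u(1) by (simp add: N_def)
      show "r (pact (p ^ (N - 1)) u) \<noteq> 0" by fact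
      show "pact (p ^ N) v = 0" if "pact (p ^ n) v = 0" for v
        using ker_power_mono[OF _ that, of N] by (simp add: N_def)
      show "pact (p ^ N) y = 0" if "y \<in> span A" "pact (p ^ N) (pact (p ^ N) y) = 0" for y
      proof -
        have "pact (p ^ (N + N)) y = 0" using that(2) by (simp add: pact_power_add)
        then have "pact (p ^ M) y = 0" using M that(1) by blast
        then show ?thesis using ker_power_mono[of M N] by (simp add: N_def)
      qed
    qed
  qed
qed

text \<open>If \<open>g(a) u = 0\<close>, the divided difference of \<open>g\<close> on the rank one operator given by \<open>l\<close> and \<open>u\<close>
  commutes with \<open>a\<close> at \<open>y\<close> as soon as \<open>l (g(a) y) = 0\<close>.  The functional can be modified to achieve this
  for all \<open>y\<close> in \<open>A\<close> without changing it on the kernel of \<open>g(a)\<close>.\<close>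

lemma functional_cut_off:
  assumes l: "fnl l" and A: "\<And>y. y \<in> span A \<Longrightarrow> pact g (pact g y) = 0 \<Longrightarrow> pact g y = 0"
  obtains l' where "fnl l'" "\<And>v. pact g v = 0 \<Longrightarrow> l' v = l v" "\<And>y. y \<in> A \<Longrightarrow> l' (pact g y) = 0"
proof -
  define G where "G = {(v + pact g y, l v) | v y. pact g v = 0 \<and> y \<in> span A}"
  have GI: "(v + pact g y, l v) \<in> G" if "pact g v = 0" "y \<in> span A" for v y
    unfolding G_def using that by blast
  have z: "(0, 0) \<in> G" using GI[of 0 0] by (simp add: pact_v0 span_zero fnl_0[OF l])
  have p: "(x + x', y + y') \<in> G" if xy: "(x, y) \<in> G" "(x', y') \<in> G" for x y x' y'
  proof -
    obtain v w v' w' where *: "x = v + pact g w" "y = l v" "x' = v' + pact g w'" "y' = l v'"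
      "pact g v = 0" "pact g v' = 0" "w \<in> span A" "w' \<in> span A" using xy G_def by auto
    have "x + x' = (v + v') + pact g (w + w')" "y + y' = l (v + v')"
      by (simp_all add: * pact_vadd fnl_add[OF l])
    moreover have "pact g (v + v') = 0" "w + w' \<in> span A" using * by (simp_all add: pact_vadd span_add)
    ultimately show ?thesis using GI by metis
  qed
  have m: "(c *s x, c * y) \<in> G" if xy: "(x, y) \<in> G" for c x y
  proof -
    obtain v w where *: "x = v + pact g w" "y = l v" "pact g v = 0" "w \<in> span A" using xy G_def by auto
    have "c *s x = c *s v + pact g (c *s w)" "c * y = l (c *s v)"
      by (simp_all add: * pact_vscale fnl_scale[OF l] scale_right_distrib)
    moreover have "pact g (c *s v) = 0" "c *s w \<in> span A" using * by (simp_all add: pact_vscale span_scale)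
    ultimately show ?thesis using GI by metis
  qed
  have u: "y = 0" if y: "(0, y) \<in> G" for y
  proof -
    obtain v w where *: "0 = v + pact g w" "y = l v" "pact g v = 0" "w \<in> span A" using y G_def by auto
    have "pact g (v + pact g w) = pact g (pact g w)" using *(3) by (simp add: pact_vadd)
    then have "pact g (pact g w) = 0" using *(1) by (simp add: pact_v0)
    then have "pact g w = 0" using A *(4) by blast
    then show ?thesis using * by (simp add: fnl_0[OF l])
  qed
  obtain l' where l': "fnl l'" "\<And>x y. (x, y) \<in> G \<Longrightarrow> l' x = y" using fnl_relation_extend[OF z p m u] by blast
  show thesis
  proof
    show "l' v = l v" if "pact g v = 0" for v
      using l'(2)[OF GI[OF that span_zero]] by (simp add: pact_v0)
    show "l' (pact g y) = 0" if "y \<in> A" for y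
      using l'(2)[OF GI[OF pact_v0 span_base[OF that]]] by (simp add: fnl_0[OF l])
  qed fact
qed

text \<open>For the finite rank operator \<open>T = \<Sum> v \<otimes> l\<close> with all \<open>v\<close> in \<open>K\<close>: if \<open>tr (a^k T) = 0\<close> for all \<open>k\<close>,
  then \<open>tr (c T) = 0\<close>.\<close>

definition trace_determined :: "('v \<Rightarrow> 'v) \<Rightarrow> 'v set \<Rightarrow> bool" where
  "trace_determined c K \<longleftrightarrow> (\<forall>ys. (\<forall>y\<in>set ys. fnl (fst y) \<and> snd y \<in> K) \<longrightarrow>
     (\<forall>k. (\<Sum>y\<leftarrow>ys. fst y ((a ^^ k) (snd y))) = 0) \<longrightarrow> (\<Sum>y\<leftarrow>ys. fst y (c (snd y))) = 0)"

lemma lin_sum_list: "lin x \<Longrightarrow> x (\<Sum>y\<leftarrow>ys. f y) = (\<Sum>y\<leftarrow>ys. x (f y))"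
  by (induction ys) (simp_all add: lin_0 lin_add)

lemma fnl_sum_list: "fnl l \<Longrightarrow> l (\<Sum>y\<leftarrow>ys. f y) = (\<Sum>y\<leftarrow>ys. l (f y))"
  by (induction ys) (simp_all add: fnl_0 fnl_add)

lemma sum_list_cong: "(\<And>y. y \<in> set ys \<Longrightarrow> f y = g y) \<Longrightarrow> (\<Sum>y\<leftarrow>ys. f y) = (\<Sum>y\<leftarrow>ys. g y)"
  by (rule arg_cong[of _ _ sum_list], rule map_cong) auto

lemma trace_determined_zero:
  assumes c: "lin c" and K: "K \<subseteq> {0}"
  shows "trace_determined c K"
  unfolding trace_determined_def
proof (intro allI impI)
  fix ys assume ys: "\<forall>y\<in>set ys. fnl (fst y) \<and> snd y \<in> K"
  have "(\<Sum>y\<leftarrow>ys. fst y (c (snd y))) = (\<Sum>y\<leftarrow>ys. 0)"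
  proof (rule sum_list_cong)
    fix y assume "y \<in> set ys"
    then have "fnl (fst y)" "snd y = 0" using ys K by blast+
    then show "fst y (c (snd y)) = 0" by (simp add: lin_0[OF c] fnl_0)
  qed
  then show "(\<Sum>y\<leftarrow>ys. fst y (c (snd y))) = 0" by simp
qed

text \<open>The polynomials \<open>h\<close> with \<open>r (h(a) q(a) u) = 0\<close> for all \<open>q\<close> form an ideal that contains \<open>p^N\<close> but not
  \<open>p^(N-1)\<close>; so \<open>p^N\<close> divides each of its members, and a member of smaller degree is zero.  The divided difference has
  smaller degree, and its top coefficient is a nonzero multiple of \<open>s 0\<close>.\<close>

lemma divdiff_poly_detects:
  assumes p: "irreducible p" and N: "N > 0" and r: "fnl r"
    and u: "pact (p ^ N) u = 0" "r (pact (p ^ (N - 1)) u) \<noteq> 0"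
    and key: "\<And>q. r (pact (divdiff_poly (p ^ N) s) (pact q u)) = 0"
  shows "s 0 = 0"
proof (rule divdiff_poly_eq_0_D)
  have "p \<noteq> 0" using p by auto
  then show "degree (p ^ N) > 0" using N irreducible_degree_pos[OF p] by (simp add: degree_power_eq)
  show "p ^ N dvd divdiff_poly (p ^ N) s"
  proof (rule ccontr)
    assume nd: "\<not> p ^ N dvd divdiff_poly (p ^ N) s"
    define J where "J = {h. \<forall>q. r (pact h (pact q u)) = 0}"
    have "p ^ (N - 1) \<in> J"
    proof (rule ideal_contains_smaller_power[OF _ _ p])
      show "h + k \<in> J" if "h \<in> J" "k \<in> J" for h k
        using that unfolding J_def by (simp add: pact_add fnl_add[OF r])
      show "q * h \<in> J" if "h \<in> J" for q h
      proof -
        have "pact (q * h) (pact q' u) = pact h (pact (q * q') u)" for q'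
          by (simp add: pact_mult pact_commute[of q h])
        then show ?thesis using that unfolding J_def by simp
      qed
      have "pact (p ^ N) (pact q u) = 0" for q using u(1) pact_commute[of "p ^ N" q u] by (simp add: pact_v0)
      then show "p ^ N \<in> J" unfolding J_def by (simp add: fnl_0[OF r])
      show "divdiff_poly (p ^ N) s \<in> J" unfolding J_def using key by blast
    qed fact
    then have "r (pact (p ^ (N - 1)) (pact 1 u)) = 0" unfolding J_def by blast
    then show False using u(2) by (simp add: pact_1)
  qed
qed

text \<open>Each \<open>l\<close> is turned into the operator \<open>psi\<close>, the divided difference of \<open>g = p^N\<close> on the rank one
  operator with functional \<open>l\<close> and vector \<open>q(a) u\<close>.  It commutes with \<open>a\<close> on the finitely many vectors
  that matter, so \<open>r (psi (c v)) = r (c (psi v))\<close>.  The vanishing moments make the right hand sides add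
  up to \<open>0\<close>, and the left hand sides, for all \<open>q\<close>, detect the sum of the \<open>l (c v)\<close>.\<close>

lemma trace_determined_prime_power:
  assumes p: "irreducible p" and c: "lin c" "\<And>v. c (a v) = a (c v)" "locally_central c"
  shows "trace_determined c {v. pact (p ^ n) v = 0}"
proof (cases "\<exists>w. w \<noteq> 0 \<and> pact p w = 0")
  case False
  then have inj: "\<And>v. pact (p ^ Suc 0) v = 0 \<Longrightarrow> pact (p ^ 0) v = 0" by (auto simp: pact_1)
  have "v = 0" if "pact (p ^ n) v = 0" for v
    using ker_power_stable[OF inj that] by (simp add: pact_1)
  then show ?thesis by (intro trace_determined_zero c) blast
next
  case True
  then obtain w where w: "w \<noteq> 0" "pact p w = 0" by blast
  obtain r where r: "fnl r" "\<And>A n. finite A \<Longrightarrow> \<exists>N u. N > 0 \<and> (\<forall>v. pact (p ^ n) v = 0 \<longrightarrow> pact (p ^ N) v = 0) \<and>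
    pact (p ^ N) u = 0 \<and> r (pact (p ^ (N - 1)) u) \<noteq> 0 \<and>
    (\<forall>y\<in>span A. pact (p ^ N) (pact (p ^ N) y) = 0 \<longrightarrow> pact (p ^ N) y = 0)"
    using primary_test_functional[OF w] by metis
  show ?thesis unfolding trace_determined_def
  proof (intro allI impI)
    fix ys assume ys: "\<forall>y\<in>set ys. fnl (fst y) \<and> snd y \<in> {v. pact (p ^ n) v = 0}"
      and tr: "\<forall>k. (\<Sum>y\<leftarrow>ys. fst y ((a ^^ k) (snd y))) = 0"
    have "\<forall>v. \<exists>A. finite A \<and> (\<forall>x. lin x \<longrightarrow> (\<forall>y\<in>A. x (a y) = a (x y)) \<longrightarrow> r (x (c v)) = r (c (x v)))"
      using locally_centralE[OF c(3) r(1)] by metis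
    then obtain A0 where A0: "\<And>v. finite (A0 v)"
      "\<And>v x. lin x \<Longrightarrow> (\<And>y. y \<in> A0 v \<Longrightarrow> x (a y) = a (x y)) \<Longrightarrow> r (x (c v)) = r (c (x v))"
      by metis
    define A where "A = (\<Union>y\<in>set ys. A0 (snd y))"
    have "finite A" unfolding A_def using A0(1) by blast
    from r(2)[OF this, of n] obtain N u where Nu: "N > 0"
      "\<And>v. pact (p ^ n) v = 0 \<Longrightarrow> pact (p ^ N) v = 0"
      "pact (p ^ N) u = 0" "r (pact (p ^ (N - 1)) u) \<noteq> 0"
      "\<And>y. y \<in> span A \<Longrightarrow> pact (p ^ N) (pact (p ^ N) y) = 0 \<Longrightarrow> pact (p ^ N) y = 0" by blast
    define g where "g = p ^ N"
    have cut: "\<exists>l'. fnl l' \<and> (\<forall>v. pact g v = 0 \<longrightarrow> l' v = l v) \<and> (\<forall>y\<in>A. l' (pact g y) = 0)" if "fnl l" for l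
      using functional_cut_off[OF that, of A g] Nu(5) unfolding g_def by metis
    then obtain cu where cu: "\<And>l. fnl l \<Longrightarrow> fnl (cu l)" "\<And>l v. fnl l \<Longrightarrow> pact g v = 0 \<Longrightarrow> cu l v = l v"
      "\<And>l y. fnl l \<Longrightarrow> y \<in> A \<Longrightarrow> cu l (pact g y) = 0" by metis
    define s where "s k = (\<Sum>y\<leftarrow>ys. fst y ((a ^^ k) (c (snd y))))" for k
    have key: "r (pact (divdiff_poly g s) (pact q u)) = 0" for q
    proof -
      define psi where "psi y = divdiff g (\<lambda>v. cu (fst y) v *s pact q u)" for y :: "('v \<Rightarrow> 'f) \<times> 'v"
      have Y: "fnl (fst y)" "pact g (snd y) = 0" if "y \<in> set ys" for y
        using ys that Nu(2) unfolding g_def by auto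
      have gq: "pact g (pact q u) = 0" using Nu(3) pact_commute[of g q u] by (simp add: g_def pact_v0)
      have psi: "psi y v = pact (divdiff_poly g (\<lambda>k. fst y ((a ^^ k) v))) (pact q u)"
        if "y \<in> set ys" "pact g v = 0" for y v
        unfolding psi_def divdiff_rank_one using cu(2)[OF Y(1)[OF that(1)]] that(2)
        by (simp add: pact_funpow lin_0[OF lin_funpow])
      have eq: "r (psi y (c (snd y))) = r (c (psi y (snd y)))" if y: "y \<in> set ys" for y
      proof (rule A0(2))
        have R: "lin (\<lambda>v. cu (fst y) v *s pact q u)" by (intro lin_rank_one cu(1) Y(1) y)
        then show "lin (psi y)" unfolding psi_def by (rule lin_divdiff)
        fix z assume "z \<in> A0 (snd y)"
        then have "z \<in> A" using y A_def by blast
        then have "a (psi y z) - psi y (a z) = 0"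
          unfolding psi_def divdiff_commutator[OF R]
          by (simp add: pact_vscale gq cu(3)[OF Y(1)[OF y]])
        then show "psi y (a z) = a (psi y z)" by simp
      qed
      have "r (pact (divdiff_poly g s) (pact q u)) = r (\<Sum>y\<leftarrow>ys. psi y (c (snd y)))"
      proof -
        have "(\<Sum>y\<leftarrow>ys. psi y (c (snd y))) =
          (\<Sum>y\<leftarrow>ys. pact (divdiff_poly g (\<lambda>k. fst y ((a ^^ k) (c (snd y))))) (pact q u))"
          by (intro sum_list_cong psi) (simp_all add: commute_pact[OF c(1,2), symmetric] Y(2) lin_0[OF c(1)])
        then show ?thesis by (simp add: divdiff_poly_sum_list s_def[abs_def])
      qed
      also have "\<dots> = (\<Sum>y\<leftarrow>ys. r (c (psi y (snd y))))"
        unfolding fnl_sum_list[OF r(1)] by (intro sum_list_cong eq)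
      also have "\<dots> = r (c (\<Sum>y\<leftarrow>ys. psi y (snd y)))"
        by (simp add: fnl_sum_list[OF r(1)] lin_sum_list[OF c(1)])
      also have "(\<Sum>y\<leftarrow>ys. psi y (snd y)) =
          (\<Sum>y\<leftarrow>ys. pact (divdiff_poly g (\<lambda>k. fst y ((a ^^ k) (snd y)))) (pact q u))"
        by (intro sum_list_cong psi) (simp_all add: Y(2))
      also have "\<dots> = 0" by (simp add: divdiff_poly_sum_list tr) (simp add: divdiff_poly_def pact_0)
      finally show ?thesis by (simp add: lin_0[OF c(1)] fnl_0[OF r(1)])
    qed
    have "s 0 = 0"
      by (rule divdiff_poly_detects[OF p Nu(1) r(1) Nu(3,4)]) (use key in \<open>simp add: g_def\<close>)
    then show "(\<Sum>y\<leftarrow>ys. fst y (c (snd y))) = 0" by (simp add: s_def)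
  qed
qed

lemma trace_zero_pact:
  assumes "\<And>y. y \<in> set ys \<Longrightarrow> fnl (fst y)" "\<And>k. (\<Sum>y\<leftarrow>ys. fst y ((a ^^ k) (snd y))) = 0"
  shows "(\<Sum>y\<leftarrow>ys. fst y ((a ^^ k) (pact h (snd y)))) = 0"
proof (induction h arbitrary: k)
  case 0
  have "(\<Sum>y\<leftarrow>ys. fst y ((a ^^ k) (pact 0 (snd y)))) = (\<Sum>y\<leftarrow>ys. 0)"
    by (intro sum_list_cong) (simp add: pact_0 lin_0[OF lin_funpow] fnl_0 assms(1))
  then show ?case by simp
next
  case (pCons c h)
  have "(\<Sum>y\<leftarrow>ys. fst y ((a ^^ k) (pact (pCons c h) (snd y)))) =
    (\<Sum>y\<leftarrow>ys. c * fst y ((a ^^ k) (snd y)) + fst y ((a ^^ Suc k) (pact h (snd y))))"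
    by (intro sum_list_cong) (simp add: pact_pCons lin_add[OF lin_funpow] lin_scale[OF lin_funpow]
        fnl_add fnl_scale assms(1) funpow_swap1)
  also have "\<dots> = 0" by (simp add: sum_list_addf sum_list_const_mult assms(2) pCons.IH del: funpow.simps)
  finally show ?case .
qed

lemma trace_determined_coprime:
  assumes c: "lin c" and uv: "u * g + v * h = 1"
    and g: "trace_determined c {v. pact g v = 0}" and h: "trace_determined c {v. pact h v = 0}"
  shows "trace_determined c {v. pact (g * h) v = 0}"
  unfolding trace_determined_def
proof (intro allI impI)
  fix ys assume ys: "\<forall>y\<in>set ys. fnl (fst y) \<and> snd y \<in> {v. pact (g * h) v = 0}"
    and tr: "\<forall>k. (\<Sum>y\<leftarrow>ys. fst y ((a ^^ k) (snd y))) = 0"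
  have part: "(\<Sum>y\<leftarrow>ys. fst y (c (pact k (snd y)))) = 0"
    if k: "trace_determined c {v. pact d v = 0}" "\<And>y. y \<in> set ys \<Longrightarrow> pact d (pact k (snd y)) = 0" for d k
  proof -
    let ?zs = "map (\<lambda>y. (fst y, pact k (snd y))) ys"
    have "(\<forall>y\<in>set ?zs. fnl (fst y) \<and> snd y \<in> {v. pact d v = 0})" using ys k(2) by auto
    moreover have "\<forall>j. (\<Sum>y\<leftarrow>?zs. fst y ((a ^^ j) (snd y))) = 0"
      using trace_zero_pact[of ys] ys tr by (simp add: o_def)
    ultimately have "(\<Sum>y\<leftarrow>?zs. fst y (c (snd y))) = 0"
      using k(1) unfolding trace_determined_def by blast
    then show ?thesis by (simp add: o_def)
  qed
  have gh: "pact g (pact h (snd y)) = 0" if "y \<in> set ys" for y using ys that by (simp add: pact_mult)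
  have "pact h (pact (u * g) (snd y)) = 0" if "y \<in> set ys" for y
    using gh[OF that] by (metis pact_commute pact_mult pact_v0)
  moreover have "pact g (pact (v * h) (snd y)) = 0" if "y \<in> set ys" for y
    using gh[OF that] by (metis pact_commute pact_mult pact_v0)
  moreover have "(\<Sum>y\<leftarrow>ys. fst y (c (snd y))) =
    (\<Sum>y\<leftarrow>ys. fst y (c (pact (u * g) (snd y)))) + (\<Sum>y\<leftarrow>ys. fst y (c (pact (v * h) (snd y))))"
    unfolding sum_list_addf[symmetric]
  proof (rule sum_list_cong)
    fix y assume y: "y \<in> set ys"
    have "snd y = pact (u * g) (snd y) + pact (v * h) (snd y)" by (simp add: pact_add[symmetric] uv pact_1)
    then show "fst y (c (snd y)) = fst y (c (pact (u * g) (snd y))) + fst y (c (pact (v * h) (snd y)))"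
      using ys y by (metis fnl_add lin_add[OF c])
  qed
  ultimately show "(\<Sum>y\<leftarrow>ys. fst y (c (snd y))) = 0" using part[OF h, of "u * g"] part[OF g, of "v * h"] by simp
qed

lemma trace_determined_torsion:
  assumes c: "lin c" "\<And>v. c (a v) = a (c v)" "locally_central c"
  shows "trace_determined c {v. \<exists>h. h \<noteq> 0 \<and> pact h v = 0}"
proof -
  have ker: "trace_determined c {v. pact g v = 0}" if "g \<noteq> 0" for g
    using that
  proof (induction "degree g" arbitrary: g rule: less_induct)
    case less
    show ?case
    proof (cases "degree g = 0")
      case True
      then have "g dvd 1" using less.prems by (simp add: is_unit_iff_degree)
      then have "v = 0" if "pact g v = 0" for v using pact_dvd_0[OF _ that, of 1] by (simp add: pact_1)
      then show ?thesis by (intro trace_determined_zero c) blast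
    next
      case False
      then obtain p where p: "irreducible p" "p dvd g" using ex_irreducible_dvd by blast
      obtain n h where nh: "g = p ^ n * h" "\<not> p dvd h" using split_off_power[OF p(1) less.prems] .
      have "n > 0" using p(2) nh by (intro gr0I) simp
      have "p \<noteq> 0" "h \<noteq> 0" using nh(1) less.prems \<open>n > 0\<close> by auto
      then have "degree h < degree g"
        using irreducible_degree_pos[OF p(1)] \<open>n > 0\<close> by (simp add: nh(1) degree_mult_eq degree_power_eq)
      then have "trace_determined c {v. pact h v = 0}" using less.hyps \<open>h \<noteq> 0\<close> by blast
      moreover obtain u v where "u * p ^ n + v * h = 1" using irreducible_power_bezout[OF p(1) nh(2)] .
      ultimately show ?thesis
        unfolding nh(1) using trace_determined_coprime[OF c(1)] trace_determined_prime_power[OF p(1) c] by blast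
    qed
  qed
  show ?thesis unfolding trace_determined_def
  proof (intro allI impI)
    fix ys assume ys: "\<forall>y\<in>set ys. fnl (fst y) \<and> snd y \<in> {v. \<exists>h. h \<noteq> 0 \<and> pact h v = 0}"
      and tr: "\<forall>k. (\<Sum>y\<leftarrow>ys. fst y ((a ^^ k) (snd y))) = 0"
    obtain g where g: "g \<noteq> 0" "\<And>e. e \<in> span (snd ` set ys) \<Longrightarrow> pact g e = 0"
    proof (rule finite_torsion_annihilator)
      show "finite (snd ` set ys)" by simp
      show "\<exists>h. h \<noteq> 0 \<and> pact h e = 0" if "e \<in> snd ` set ys" for e using that ys by blast
    qed blast
    have "\<forall>y\<in>set ys. fnl (fst y) \<and> snd y \<in> {v. pact g v = 0}" using ys g(2) span_base by auto
    then show "(\<Sum>y\<leftarrow>ys. fst y (c (snd y))) = 0" using ker[OF g(1)] tr unfolding trace_determined_def by blast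
  qed
qed


section \<open>Functionals on sequences of moments\<close>

abbreviation seq_scale :: "'f \<Rightarrow> (nat \<Rightarrow> 'f) \<Rightarrow> nat \<Rightarrow> 'f" where "seq_scale \<equiv> (\<lambda>k f n. k * f n)"

lemma vector_space_seq: "vector_space seq_scale"
  by unfold_locales (auto simp: fun_eq_iff algebra_simps)

definition seq_fnl :: "((nat \<Rightarrow> 'f) \<Rightarrow> 'f) \<Rightarrow> bool" where
  "seq_fnl L \<longleftrightarrow> Vector_Spaces.linear seq_scale (*) L"

lemma seq_fnl_add: "seq_fnl L \<Longrightarrow> L (\<lambda>n. f n + g n) = L f + L g"
  unfolding seq_fnl_def Vector_Spaces.linear_iff by (simp add: plus_fun_def)

lemma seq_fnl_scale: "seq_fnl L \<Longrightarrow> L (\<lambda>n. k * f n) = k * L f"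
  unfolding seq_fnl_def Vector_Spaces.linear_iff by simp

lemma seq_fnl_diff: "seq_fnl L \<Longrightarrow> L (\<lambda>n. f n - g n) = L f - L g"
  using seq_fnl_add[of L f "\<lambda>n. - 1 * g n"] seq_fnl_scale[of L "- 1" g] by simp

lemma seq_fnl_sum: "seq_fnl L \<Longrightarrow> L (\<lambda>n. \<Sum>i\<in>I. f i n) = (\<Sum>i\<in>I. L (f i))"
proof (induction I rule: infinite_finite_induct)
  case (insert x F)
  then show ?case using seq_fnl_add[of L "f x" "\<lambda>n. \<Sum>i\<in>F. f i n"] by simp
qed (use seq_fnl_scale[of L 0] in simp_all)

text \<open>The hypothesis that \<open>c\<close> is trace determined on \<open>K\<close> is precisely what makes this prescription for
  \<open>L\<close> consistent.\<close>

lemma moment_functional: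
  assumes "lin c" "trace_determined c K"
  shows "\<exists>L. seq_fnl L \<and> (\<forall>l v. fnl l \<longrightarrow> v \<in> K \<longrightarrow> L (\<lambda>k. l ((a ^^ k) v)) = l (c v))"
proof -
  define ok where "ok ys \<longleftrightarrow> (\<forall>y\<in>set ys. fnl (fst y) \<and> snd y \<in> K)" for ys
  define G where "G = {((\<lambda>k. \<Sum>y\<leftarrow>ys. fst y ((a ^^ k) (snd y))), \<Sum>y\<leftarrow>ys. fst y (c (snd y))) | ys. ok ys}"
  have GI: "(\<lambda>k. \<Sum>y\<leftarrow>ys. fst y ((a ^^ k) (snd y)), \<Sum>y\<leftarrow>ys. fst y (c (snd y))) \<in> G" if "ok ys" for ys
    unfolding G_def using that by blast
  have z: "(0, 0) \<in> G" using GI[of "[]"] by (simp add: ok_def zero_fun_def)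
  have p: "(x + x', y + y') \<in> G" if "(x, y) \<in> G" "(x', y') \<in> G" for x y x' y'
  proof -
    obtain ys zs where *: "ok ys" "ok zs" "x = (\<lambda>k. \<Sum>y\<leftarrow>ys. fst y ((a ^^ k) (snd y)))"
      "y = (\<Sum>y\<leftarrow>ys. fst y (c (snd y)))" "x' = (\<lambda>k. \<Sum>y\<leftarrow>zs. fst y ((a ^^ k) (snd y)))"
      "y' = (\<Sum>y\<leftarrow>zs. fst y (c (snd y)))" using \<open>(x, y) \<in> G\<close> \<open>(x', y') \<in> G\<close> unfolding G_def by blast
    have "ok (ys @ zs)" using *(1,2) by (auto simp: ok_def)
    from GI[OF this] show ?thesis by (simp add: * plus_fun_def)
  qed
  have m: "(seq_scale k x, k * y) \<in> G" if "(x, y) \<in> G" for k x y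
  proof -
    obtain ys where *: "ok ys" "x = (\<lambda>k. \<Sum>y\<leftarrow>ys. fst y ((a ^^ k) (snd y)))"
      "y = (\<Sum>y\<leftarrow>ys. fst y (c (snd y)))" using \<open>(x, y) \<in> G\<close> unfolding G_def by blast
    let ?zs = "map (\<lambda>y. (\<lambda>u. k * fst y u, snd y)) ys"
    have "fnl (\<lambda>u. k * l u)" if "fnl l" for l using that by (simp add: fnl_iff algebra_simps)
    then have "ok ?zs" using *(1) by (auto simp: ok_def)
    from GI[OF this] show ?thesis by (simp add: * o_def sum_list_const_mult)
  qed
  have u: "y = 0" if "(0, y) \<in> G" for y
  proof -
    obtain ys where *: "ok ys" "0 = (\<lambda>k. \<Sum>y\<leftarrow>ys. fst y ((a ^^ k) (snd y)))"
      "y = (\<Sum>y\<leftarrow>ys. fst y (c (snd y)))" using \<open>(0, y) \<in> G\<close> unfolding G_def by blast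
    have "(\<Sum>y\<leftarrow>ys. fst y ((a ^^ k) (snd y))) = 0" for k using fun_cong[OF *(2), of k] by simp
    then show ?thesis using assms(2) *(1,3) unfolding trace_determined_def ok_def by blast
  qed
  obtain L where L: "Vector_Spaces.linear seq_scale (*) L" "\<And>x y. (x, y) \<in> G \<Longrightarrow> L x = y"
    using linear_relation_extend[OF vector_space_seq vector_space_field z p m u] by blast
  show ?thesis
  proof (intro exI[of _ L] conjI allI impI)
    show "seq_fnl L" using L(1) by (simp add: seq_fnl_def)
    show "L (\<lambda>k. l ((a ^^ k) v)) = l (c v)" if "fnl l" "v \<in> K" for l v
      using L(2)[OF GI[of "[(l, v)]"]] that by (simp add: ok_def)
  qed
qed

lemma degree_mod_le:
  fixes g h :: "'f poly"
  assumes "g \<noteq> 0"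
  shows "degree (h mod g) \<le> degree g"
  using degree_mod_less[OF assms, of h] by auto

lemma power_remainder:
  assumes "g \<noteq> 0" "pact g v = 0"
  shows "(a ^^ k) v = (\<Sum>m\<le>degree g. coeff (monom 1 k mod g) m *s (a ^^ m) v)"
proof -
  have "(a ^^ k) v = pact (monom 1 k mod g) v" unfolding pact_mod[OF assms(2)] by (simp add: pact_monom)
  also have "\<dots> = (\<Sum>m\<le>degree g. coeff (monom 1 k mod g) m *s (a ^^ m) v)"
    by (rule pact_bound) (rule degree_mod_le[OF assms(1)])
  finally show ?thesis .
qed

text \<open>On the kernel of \<open>g(a)\<close> the moments of \<open>v\<close> are combinations of the first few, with the coefficients of
  \<open>t^k mod g\<close>; applying \<open>L\<close> to these coefficient sequences gives the coefficients of \<open>f\<close>.\<close>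

lemma polynomial_on_kernel:
  assumes c: "lin c" "trace_determined c {v. pact g v = 0}" and g: "g \<noteq> 0"
  obtains f where "\<And>v. pact g v = 0 \<Longrightarrow> c v = pact f v"
proof -
  obtain L where L: "seq_fnl L" "\<And>l v. fnl l \<Longrightarrow> pact g v = 0 \<Longrightarrow> L (\<lambda>k. l ((a ^^ k) v)) = l (c v)"
    using moment_functional[OF c] by auto
  define e where "e m = (\<lambda>k. coeff (monom 1 k mod g) m)" for m
  define f where "f = (\<Sum>m\<le>degree g. monom (L (e m)) m)"
  have fv: "pact f v = (\<Sum>m\<le>degree g. L (e m) *s (a ^^ m) v)" for v
  proof -
    have "pact (\<Sum>m\<in>I. h m) v = (\<Sum>m\<in>I. pact (h m) v)" for I and h :: "nat \<Rightarrow> 'f poly"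
      by (induction I rule: infinite_finite_induct) (auto simp: pact_0 pact_add)
    then show ?thesis by (simp add: f_def pact_monom)
  qed
  have "c v = pact f v" if v: "pact g v = 0" for v
  proof (rule fnl_eqI)
    fix l assume l: "fnl l"
    have "l (c v) = L (\<lambda>k. l ((a ^^ k) v))" by (simp add: L(2) l v)
    also have "(\<lambda>k. l ((a ^^ k) v)) = (\<lambda>k. \<Sum>m\<le>degree g. l ((a ^^ m) v) * e m k)"
    proof
      fix k
      show "l ((a ^^ k) v) = (\<Sum>m\<le>degree g. l ((a ^^ m) v) * e m k)"
        by (subst power_remainder[OF g v, of k]) (simp add: fnl_sum[OF l] fnl_scale[OF l] e_def mult.commute)
    qed
    also have "L \<dots> = (\<Sum>m\<le>degree g. l ((a ^^ m) v) * L (e m))"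
      by (simp add: seq_fnl_sum[OF L(1)] seq_fnl_scale[OF L(1)])
    also have "\<dots> = l (pact f v)" by (simp add: fv fnl_sum[OF l] fnl_scale[OF l] mult.commute)
    finally show "l (c v) = l (pact f v)" .
  qed
  then show thesis using that by blast
qed

section \<open>Torsion modules\<close>

lemma torsion_orbit_finite:
  assumes "g \<noteq> 0" "pact g v = 0"
  obtains C where "finite C" "\<And>h. pact h v \<in> span C"
proof
  show "finite ((\<lambda>i. (a ^^ i) v) ` {..degree g})" by simp
  fix h
  have "pact h v = pact (h mod g) v" using pact_mod[OF assms(2)] by simp
  also have "\<dots> \<in> span ((\<lambda>i. (a ^^ i) v) ` {..degree g})"
    unfolding pact_bound[OF degree_mod_le[OF assms(1)]]
    by (intro span_sum span_scale span_base) auto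
  finally show "pact h v \<in> span ((\<lambda>i. (a ^^ i) v) ` {..degree g})" .
qed

lemma weak_limit:
  assumes L: "seq_fnl L" and B: "finite B" "\<And>m. d m \<in> span B"
  obtains y where "\<And>l. fnl l \<Longrightarrow> l y = L (\<lambda>m. l (d m))"
proof -
  have "\<forall>m. \<exists>u. d m = (\<Sum>b\<in>B. u b *s b)" using B span_finite[OF B(1)] by auto
  then obtain u where u: "\<And>m. d m = (\<Sum>b\<in>B. u m b *s b)" by metis
  show thesis
  proof (rule that)
    fix l assume l: "fnl l"
    have "L (\<lambda>m. l (d m)) = L (\<lambda>m. \<Sum>b\<in>B. l b * u m b)"
      by (simp add: u fnl_sum[OF l] fnl_scale[OF l] mult.commute)
    also have "\<dots> = l (\<Sum>b\<in>B. L (\<lambda>m. u m b) *s b)"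
      by (simp add: seq_fnl_sum[OF L] seq_fnl_scale[OF L] fnl_sum[OF l] fnl_scale[OF l] mult.commute)
    finally show "l (\<Sum>b\<in>B. L (\<lambda>m. u m b) *s b) = L (\<lambda>m. l (d m))" by simp
  qed
qed

definition range_contained :: "('v \<Rightarrow> 'v) \<Rightarrow> bool" where
  "range_contained c \<longleftrightarrow> (\<forall>x. lin x \<longrightarrow> (\<exists>z. lin z \<and> (\<forall>v. a (z v) - z (a v) = c (x v) - x (c v))))"

text \<open>For \<open>c = f(a)\<close> with \<open>f = \<Sum> f_m t^m\<close> one takes \<open>z = \<Sum> f_m d_m\<close>, where \<open>d_m\<close> is the divided difference of
  \<open>t^m\<close> on \<open>x\<close>.  In general the functional \<open>L\<close> takes the place of the sum over the coefficients of \<open>f\<close>.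
  At each vector \<open>v\<close> the \<open>d_m v\<close> stay in a finite-dimensional space because everything is torsion, so
  the limit that \<open>L\<close> defines is a vector of \<open>V\<close> and not merely one of its bidual.\<close>

lemma range_contained_torsion:
  assumes c: "lin c" "trace_determined c UNIV" and tors: "\<And>v. \<exists>h. h \<noteq> 0 \<and> pact h v = 0"
  shows "range_contained c"
  unfolding range_contained_def
proof (intro allI impI)
  fix x assume x: "lin x"
  obtain L where L: "seq_fnl L" "\<And>l v. fnl l \<Longrightarrow> L (\<lambda>k. l ((a ^^ k) v)) = l (c v)"
    using moment_functional[OF c] by auto
  define d where "d v m = divdiff (monom 1 m) x v" for v m
  have fin: "\<exists>B. finite B \<and> (\<forall>m. d v m \<in> span B)" for v
  proof -
    have orb: "\<exists>C. finite C \<and> (\<forall>h. pact h w \<in> span C)" for w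
      using tors[of w] torsion_orbit_finite by metis
    then obtain C where C: "\<And>w. finite (C w)" "\<And>w h. pact h w \<in> span (C w)" by metis
    define B where "B = (\<Union>w\<in>C v. C (x w))"
    have "subspace {w. \<forall>h. pact h (x w) \<in> span B}"
      by (auto simp: subspace_def lin_0[OF x] lin_add[OF x] lin_scale[OF x] pact_v0 pact_vadd pact_vscale
          intro: span_zero span_add span_scale)
    moreover have "C v \<subseteq> {w. \<forall>h. pact h (x w) \<in> span B}"
    proof
      fix w assume "w \<in> C v"
      then have "span (C (x w)) \<subseteq> span B" unfolding B_def by (intro span_mono) blast
      then show "w \<in> {w. \<forall>h. pact h (x w) \<in> span B}" using C(2) by blast
    qed
    ultimately have sub: "span (C v) \<subseteq> {w. \<forall>h. pact h (x w) \<in> span B}" by (simp add: span_minimal)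
    have "(a ^^ k) v \<in> span (C v)" for k using C(2)[of "monom 1 k" v] by (simp add: pact_monom)
    then have "pact h (x ((a ^^ k) v)) \<in> span B" for h k using sub by blast
    then have "d v m \<in> span B" for m unfolding d_def divdiff_def by (intro span_sum)
    moreover have "finite B" unfolding B_def using C(1) by blast
    ultimately show ?thesis by blast
  qed
  have "\<exists>y. \<forall>l. fnl l \<longrightarrow> l y = L (\<lambda>m. l (d v m))" for v
    using fin[of v] weak_limit[OF L(1)] by metis
  then obtain z where z: "\<And>v l. fnl l \<Longrightarrow> l (z v) = L (\<lambda>m. l (d v m))" by metis
  have lz: "lin z"
  proof (rule linI)
    fix u v
    show "z (u + v) = z u + z v"
      by (rule fnl_eqI) (simp add: z fnl_add d_def lin_add[OF lin_divdiff[OF x]] seq_fnl_add[OF L(1)])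
  next
    fix k v
    show "z (k *s v) = k *s z v"
      by (rule fnl_eqI) (simp add: z fnl_scale d_def lin_scale[OF lin_divdiff[OF x]] seq_fnl_scale[OF L(1)])
  qed
  have "a (z v) - z (a v) = c (x v) - x (c v)" for v
  proof (rule fnl_eqI)
    fix l assume l: "fnl l"
    have "l (a (z v)) = L (\<lambda>m. l (a (d v m)))" using z[OF fnl_comp[OF l lin_a]] .
    then have "l (a (z v) - z (a v)) = L (\<lambda>m. l (a (d v m)) - l (d (a v) m))"
      by (simp add: fnl_diff[OF l] z[OF l] seq_fnl_diff[OF L(1)])
    also have "(\<lambda>m. l (a (d v m)) - l (d (a v) m)) = (\<lambda>m. l ((a ^^ m) (x v)) - l (x ((a ^^ m) v)))"
      unfolding d_def fnl_diff[OF l, symmetric] divdiff_commutator[OF x] by (simp add: pact_monom)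
    also have "L \<dots> = l (c (x v)) - l (x (c v))"
      by (simp add: seq_fnl_diff[OF L(1)] L(2)[OF l] L(2)[OF fnl_comp[OF l x]])
    finally show "l (a (z v) - z (a v)) = l (c (x v) - x (c v))" by (simp add: fnl_diff[OF l])
  qed
  with lz show "\<exists>z. lin z \<and> (\<forall>v. a (z v) - z (a v) = c (x v) - x (c v))" by blast
qed


section \<open>Operators whose derivation has its range in that of the fixed operator\<close>

lemma range_containedD:
  assumes "range_contained c" "lin x"
  obtains z where "lin z" "\<And>v. a (z v) - z (a v) = c (x v) - x (c v)"
  using assms unfolding range_contained_def by blast

lemma range_contained_pact: "range_contained (pact h)"
  unfolding range_contained_def using lin_divdiff divdiff_commutator by blast

lemma range_contained_comp:
  assumes "lin b" "lin c" "range_contained b" "range_contained c"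
  shows "range_contained (\<lambda>v. b (c v))"
  unfolding range_contained_def
proof (intro allI impI)
  fix x assume x: "lin x"
  \<comment> \<open>\<open>[b c, x] = [b, c x] + [c, x b]\<close>\<close>
  obtain z where z: "lin z" "\<And>v. a (z v) - z (a v) = b (c (x v)) - c (x (b v))"
    using range_containedD[OF assms(3) lin_comp[OF assms(2) x]] by metis
  obtain z' where z': "lin z'" "\<And>v. a (z' v) - z' (a v) = c (x (b v)) - x (b (c v))"
    using range_containedD[OF assms(4) lin_comp[OF x assms(1)]] by metis
  have "a (z v + z' v) - (z (a v) + z' (a v)) = b (c (x v)) - x (b (c v))" for v
  proof -
    have "a (z v + z' v) - (z (a v) + z' (a v)) = (a (z v) - z (a v)) + (a (z' v) - z' (a v))"
      by (simp add: a_add)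
    then show ?thesis unfolding z(2) z'(2) by simp
  qed
  then show "\<exists>z. lin z \<and> (\<forall>v. a (z v) - z (a v) = b (c (x v)) - x (b (c v)))"
    using lin_plus[OF z(1) z'(1)] by blast
qed

lemma range_contained_diff:
  assumes "range_contained b" "range_contained c"
  shows "range_contained (\<lambda>v. b v - c v)"
  unfolding range_contained_def
proof (intro allI impI)
  fix x assume x: "lin x"
  obtain z where z: "lin z" "\<And>v. a (z v) - z (a v) = b (x v) - x (b v)"
    using range_containedD[OF assms(1) x] by metis
  obtain z' where z': "lin z'" "\<And>v. a (z' v) - z' (a v) = c (x v) - x (c v)"
    using range_containedD[OF assms(2) x] by metis
  have "a (z v - z' v) - (z (a v) - z' (a v)) = b (x v) - c (x v) - x (b v - c v)" for v
  proof -
    have "a (z v - z' v) - (z (a v) - z' (a v)) = (a (z v) - z (a v)) - (a (z' v) - z' (a v))"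
      by (simp add: a_diff)
    then show ?thesis unfolding z(2) z'(2) by (simp add: lin_diff[OF x])
  qed
  then show "\<exists>z. lin z \<and> (\<forall>v. a (z v) - z (a v) = b (x v) - c (x v) - x (b v - c v))"
    using lin_minus_fun[OF z(1) z'(1)] by blast
qed

lemma range_contained_add:
  assumes "range_contained b" "range_contained c"
  shows "range_contained (\<lambda>v. b v + c v)"
  unfolding range_contained_def
proof (intro allI impI)
  fix x assume x: "lin x"
  obtain z where z: "lin z" "\<And>v. a (z v) - z (a v) = b (x v) - x (b v)"
    using range_containedD[OF assms(1) x] by metis
  obtain z' where z': "lin z'" "\<And>v. a (z' v) - z' (a v) = c (x v) - x (c v)"
    using range_containedD[OF assms(2) x] by metis
  have "a (z v + z' v) - (z (a v) + z' (a v)) = b (x v) + c (x v) - x (b v + c v)" for v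
  proof -
    have "a (z v + z' v) - (z (a v) + z' (a v)) = (a (z v) - z (a v)) + (a (z' v) - z' (a v))"
      by (simp add: a_add)
    then show ?thesis unfolding z(2) z'(2) by (simp add: lin_add[OF x])
  qed
  then show "\<exists>z. lin z \<and> (\<forall>v. a (z v) - z (a v) = b (x v) + c (x v) - x (b v + c v))"
    using lin_plus[OF z(1) z'(1)] by blast
qed

text \<open>The assumptions say that \<open>V\<close> is the direct sum of the kernel and the range of \<open>Q\<close>, and that \<open>Q\<close> is
  bijective on its range; \<open>G\<close> inverts it there and is \<open>0\<close> on the kernel.\<close>

lemma drazin_inverse:
  assumes Q: "lin Q" and asc: "\<And>v. Q (Q v) = 0 \<Longrightarrow> Q v = 0" and desc: "\<And>v. \<exists>w. Q v = Q (Q w)"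
  obtains G where "lin G" "\<And>v. Q (Q (G v)) = Q v" "\<And>v. Q (G (G v)) = G v" "\<And>v. G (Q v) = Q (G v)"
proof -
  have uniq: "y = y'" if y: "y \<in> range Q" "y' \<in> range Q" "Q (Q y) = Q (Q y')" for y y'
  proof -
    obtain w w' where w: "y = Q w" "y' = Q w'" using y(1,2) by blast
    have "Q (Q (Q (w - w'))) = 0" using y(3) by (simp add: w lin_diff[OF Q])
    then have "Q (w - w') = 0" using asc by blast
    then show ?thesis by (simp add: w lin_diff[OF Q])
  qed
  have "\<exists>y. y \<in> range Q \<and> Q (Q y) = Q v" for v
  proof -
    obtain w where w: "Q v = Q (Q w)" using desc by blast
    obtain w' where "Q w = Q (Q w')" using desc by blast
    with w have "Q (Q (Q w')) = Q v" by simp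
    then show ?thesis by blast
  qed
  then obtain G where G: "\<And>v. G v \<in> range Q" "\<And>v. Q (Q (G v)) = Q v" by metis
  have sub: "subspace (range Q)"
    unfolding subspace_def
  proof (intro conjI ballI allI)
    show "0 \<in> range Q" using lin_0[OF Q] by (metis rangeI)
    show "x + y \<in> range Q" if "x \<in> range Q" "y \<in> range Q" for x y
      using that lin_add[OF Q] by (metis (no_types, lifting) image_iff rangeI)
    show "c *s x \<in> range Q" if "x \<in> range Q" for c x
      using that lin_scale[OF Q] by (metis (no_types, lifting) image_iff rangeI)
  qed
  show thesis
  proof
    show "lin G"
    proof (rule linI)
      show "G (u + v) = G u + G v" for u v
        by (rule uniq) (simp_all add: G subspace_add[OF sub] lin_add[OF Q])
      show "G (c *s v) = c *s G v" for c v
        by (rule uniq) (simp_all add: G subspace_scale[OF sub] lin_scale[OF Q])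
    qed
    show "Q (Q (G v)) = Q v" for v by (rule G(2))
    show "Q (G (G v)) = G v" for v by (rule uniq) (simp_all add: G)
    show "G (Q v) = Q (G v)" for v by (rule uniq) (simp_all add: G)
  qed
qed

text \<open>With \<open>E = Q G\<close> the projection onto the range of \<open>Q\<close>, the operator
  \<open>y = G\<^sup>2 x (1 - E) + (1 - E) x G\<^sup>2 - G x G\<close> solves \<open>[Q, y] = [G, x]\<close>.  In the block decomposition given by
  \<open>E\<close> the first two terms deal with the parts of \<open>x\<close> off the diagonal and the last one with the block on
  the range of \<open>Q\<close>.\<close>

lemma range_contained_drazin:
  assumes Q: "lin Q" "range_contained Q"
    and G: "lin G" "\<And>v. Q (Q (G v)) = Q v" "\<And>v. Q (G (G v)) = G v" "\<And>v. G (Q v) = Q (G v)"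
  shows "range_contained G"
  unfolding range_contained_def
proof (intro allI impI)
  fix x assume x: "lin x"
  define R where "R v = v - Q (G v)" for v
  define y where "y v = G (G (x (R v))) + R (x (G (G v))) - G (x (G v))" for v
  have lR: "lin R" unfolding R_def[abs_def] by (intro lin_minus_fun lin_comp[OF Q(1) G(1)] lin_id)
  have ly: "lin y" unfolding y_def[abs_def]
    by (intro lin_minus_fun lin_plus lin_comp[OF G(1)] lin_comp[OF lR] lin_comp[OF x] lR lin_id)
  note QG = lin_add[OF Q(1)] lin_diff[OF Q(1)] lin_add[OF G(1)] lin_diff[OF G(1)] lin_add[OF x] lin_diff[OF x]
    lin_0[OF Q(1)] lin_0[OF G(1)] lin_0[OF x]
  have "Q (y v) - y (Q v) = G (x v) - x (G v)" for v
    by (simp add: y_def R_def QG G(2,3,4) algebra_simps)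
  moreover obtain z where "lin z" "\<And>v. a (z v) - z (a v) = Q (y v) - y (Q v)"
    using range_containedD[OF Q(2) ly] by metis
  ultimately show "\<exists>z. lin z \<and> (\<forall>v. a (z v) - z (a v) = G (x v) - x (G v))" by metis
qed

definition drazin_invertible :: "'f poly \<Rightarrow> bool" where
  "drazin_invertible p \<longleftrightarrow> (\<exists>n>0. (\<forall>v. pact (p ^ Suc n) v = 0 \<longrightarrow> pact (p ^ n) v = 0) \<and>
     (\<forall>v. \<exists>w. pact (p ^ n) v = pact (p ^ Suc n) w))"

lemma drazin_invertible_stable:
  assumes "drazin_invertible p"
  obtains n where "n > 0" "\<And>v. pact (p ^ n) (pact (p ^ n) v) = 0 \<Longrightarrow> pact (p ^ n) v = 0"
    "\<And>v. \<exists>w. pact (p ^ n) v = pact (p ^ n) (pact (p ^ n) w)"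
proof -
  obtain n where n: "n > 0" "\<And>v. pact (p ^ Suc n) v = 0 \<Longrightarrow> pact (p ^ n) v = 0"
     "\<And>v. \<exists>w. pact (p ^ n) v = pact (p ^ Suc n) w" using assms unfolding drazin_invertible_def by blast
  have d: "\<exists>w. pact (p ^ n) v = pact (p ^ (n + k)) w" for k v
  proof (induction k)
    case (Suc k)
    then obtain w where w: "pact (p ^ n) v = pact (p ^ (n + k)) w" by blast
    obtain w' where w': "pact (p ^ n) w = pact (p ^ Suc n) w'" using n(3) by blast
    have "pact (p ^ n) v = pact (p ^ k) (pact (p ^ n) w)" by (simp add: w pact_power_add[symmetric] add.commute)
    also have "\<dots> = pact (p ^ (k + Suc n)) w'" by (simp only: w' pact_power_add)
    finally show ?case by (metis add.commute add_Suc_right)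
  qed auto
  show thesis
  proof (rule that[OF n(1)])
    show "pact (p ^ n) v = 0" if "pact (p ^ n) (pact (p ^ n) v) = 0" for v
      using ker_power_stable[OF n(2), of "n + n" v] that by (simp add: pact_power_add)
    show "\<exists>w. pact (p ^ n) v = pact (p ^ n) (pact (p ^ n) w)" for v
      using d[where k = n] by (simp add: pact_power_add)
  qed
qed

text \<open>On the range of \<open>Q = p(a)^n\<close> one has \<open>b = p(a)^(n-1) (p(a) b) G\<close>, with \<open>G\<close> the Drazin inverse of \<open>Q\<close>,
  and on the kernel \<open>b\<close> is a polynomial in \<open>a\<close>.\<close>

lemma range_contained_divide:
  assumes b: "lin b" "\<And>v. b (a v) = a (b v)"
    and pol: "\<And>n. \<exists>k. \<forall>v. pact (p ^ n) v = 0 \<longrightarrow> b v = pact k v"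
    and dr: "drazin_invertible p" and rc: "range_contained (\<lambda>v. pact p (b v))"
  shows "range_contained b"
proof -
  obtain n where n: "n > 0" "\<And>v. pact (p ^ n) (pact (p ^ n) v) = 0 \<Longrightarrow> pact (p ^ n) v = 0"
    "\<And>v. \<exists>w. pact (p ^ n) v = pact (p ^ n) (pact (p ^ n) w)"
    using drazin_invertible_stable[OF dr] by metis
  let ?Q = "pact (p ^ n)"
  obtain G where G: "lin G" "\<And>v. ?Q (?Q (G v)) = ?Q v" "\<And>v. ?Q (G (G v)) = G v" "\<And>v. G (?Q v) = ?Q (G v)"
    using drazin_inverse[OF lin_pact n(2,3)] by metis
  have rcG: "range_contained G" by (rule range_contained_drazin[OF lin_pact range_contained_pact G])
  obtain k where k: "\<And>v. ?Q v = 0 \<Longrightarrow> b v = pact k v" using pol by metis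
  have eq: "b v = pact (p ^ (n - 1)) (pact p (b (G v))) + pact k (pact 1 v - ?Q (G v))" for v
  proof -
    have "?Q (v - ?Q (G v)) = 0" by (simp add: pact_vdiff G(2))
    then have "b (v - ?Q (G v)) = pact k (pact 1 v - ?Q (G v))" using k by (simp add: pact_1)
    moreover have "b (?Q (G v)) = pact (p ^ (n - 1)) (pact p (b (G v)))"
      using n(1) by (simp add: commute_pact[OF b] pact_mult[symmetric] power_Suc2[symmetric] del: power_Suc)
    moreover have "b v = b (?Q (G v)) + b (v - ?Q (G v))" by (simp add: lin_diff[OF b(1)])
    ultimately show ?thesis by metis
  qed
  have lpb: "lin (\<lambda>v. pact p (b v))" by (rule lin_comp[OF lin_pact b(1)])
  have "range_contained (\<lambda>v. pact (p ^ (n - 1)) (pact p (b (G v))))"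
    using range_contained_comp[OF lin_pact lin_comp[OF lpb G(1)] range_contained_pact
      range_contained_comp[OF lpb G(1) rc rcG]] by simp
  moreover have "range_contained (\<lambda>v. pact k (pact 1 v - ?Q (G v)))"
  proof (rule range_contained_comp[OF lin_pact _ range_contained_pact])
    show "lin (\<lambda>v. pact 1 v - ?Q (G v))" by (intro lin_minus_fun lin_pact lin_comp[OF lin_pact G(1)])
    show "range_contained (\<lambda>v. pact 1 v - ?Q (G v))"
      by (intro range_contained_diff range_contained_pact range_contained_comp[OF lin_pact G(1)] rcG)
  qed
  ultimately have "range_contained (\<lambda>v. pact (p ^ (n - 1)) (pact p (b (G v))) + pact k (pact 1 v - ?Q (G v)))"
    by (rule range_contained_add)
  then show ?thesis unfolding eq[abs_def, symmetric] .
qed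


section \<open>Finite ascent and descent\<close>

text \<open>Finitely many functionals map the decreasing spaces \<open>p^N V\<close> into a finite-dimensional space, where the
  images become stationary.\<close>

lemma functionals_see_powers_stabilise:
  assumes "finite S" "\<And>s. s \<in> S \<Longrightarrow> fnl s"
  shows "\<exists>M. \<forall>N\<ge>M. \<forall>x. \<exists>y. \<forall>s\<in>S. s (pact (p ^ N) x) = s (pact (p ^ Suc N) y)"
  using assms
proof (induction S)
  case (insert s0 S)
  then obtain M where M: "\<And>N x. N \<ge> M \<Longrightarrow> \<exists>y. \<forall>s\<in>S. s (pact (p ^ N) x) = s (pact (p ^ Suc N) y)"
    by blast
  have f: "fnl s" if "s \<in> insert s0 S" for s using insert.prems that by blast
  have f0: "fnl s0" using f by blast
  show ?case
  proof (cases "\<forall>N. \<exists>z. (\<forall>s\<in>S. s (pact (p ^ N) z) = 0) \<and> s0 (pact (p ^ N) z) \<noteq> 0")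
    case True
    have "\<exists>y. \<forall>s\<in>insert s0 S. s (pact (p ^ N) x) = s (pact (p ^ Suc N) y)" if N: "N \<ge> M" for N x
    proof -
      obtain y where y: "\<forall>s\<in>S. s (pact (p ^ N) x) = s (pact (p ^ Suc N) y)" using M[OF N] by blast
      obtain z where z: "\<And>s. s \<in> S \<Longrightarrow> s (pact (p ^ Suc N) z) = 0" "s0 (pact (p ^ Suc N) z) \<noteq> 0"
        using True by blast
      define c where "c = (s0 (pact (p ^ N) x) - s0 (pact (p ^ Suc N) y)) / s0 (pact (p ^ Suc N) z)"
      have ex: "s (pact (p ^ Suc N) (y + c *s z)) = s (pact (p ^ Suc N) y) + c * s (pact (p ^ Suc N) z)"
        if "fnl s" for s using that by (simp only: pact_vadd pact_vscale fnl_add fnl_scale)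
      have "s (pact (p ^ N) x) = s (pact (p ^ Suc N) (y + c *s z))" if s: "s \<in> insert s0 S" for s
      proof (cases "s \<in> S")
        case True
        then show ?thesis unfolding ex[OF f[OF s]] bspec[OF y True] z(1)[OF True] by simp
      next
        case False
        then have "s = s0" using s by simp
        have "c * s0 (pact (p ^ Suc N) z) = s0 (pact (p ^ N) x) - s0 (pact (p ^ Suc N) y)"
          unfolding c_def using z(2) by simp
        then show ?thesis unfolding \<open>s = s0\<close> using ex[OF f0] by simp
      qed
      then show ?thesis by blast
    qed
    then show ?thesis by blast
  next
    case False
    then obtain N0 where N0: "\<And>z. (\<And>s. s \<in> S \<Longrightarrow> s (pact (p ^ N0) z) = 0) \<Longrightarrow> s0 (pact (p ^ N0) z) = 0"
      by blast
    have "\<exists>y. \<forall>s\<in>insert s0 S. s (pact (p ^ N) x) = s (pact (p ^ Suc N) y)" if N: "N \<ge> max M N0" for N x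
    proof -
      obtain y where y: "\<forall>s\<in>S. s (pact (p ^ N) x) = s (pact (p ^ Suc N) y)" using M[of N x] N by auto
      define z where "z = pact (p ^ (N - N0)) (x - pact p y)"
      have "pact (p ^ N0) z = pact (p ^ N) (x - pact p y)"
        unfolding z_def using N by (simp only: pact_power_add[symmetric]) simp
      also have "\<dots> = pact (p ^ N) x - pact (p ^ Suc N) y"
        by (simp add: pact_vdiff pact_mult pact_commute[of p])
      finally have z: "pact (p ^ N0) z = pact (p ^ N) x - pact (p ^ Suc N) y" .
      have "s (pact (p ^ N0) z) = 0" if "s \<in> S" for s
        unfolding z using y that f[of s] by (simp add: fnl_diff)
      then have "s0 (pact (p ^ N0) z) = 0" by (rule N0)
      then have "s0 (pact (p ^ N) x) = s0 (pact (p ^ Suc N) y)" unfolding z by (simp add: fnl_diff[OF f0])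
      then show ?thesis using y by blast
    qed
    then show ?thesis by blast
  qed
qed simp

text \<open>Suppose that the kernels of \<open>p^n\<close> keep growing.  On each of them \<open>e\<close> is a polynomial \<open>f\<close> in \<open>a\<close> with
  \<open>p f = 0\<close> there, and comparing orders shows that \<open>e\<close> vanishes on all vectors killed by a power of \<open>p\<close>.
  Maps into such vectors that commute with \<open>a\<close> locally then have to vanish at \<open>e x0\<close>, while there are
  enough of them to detect \<open>e x0\<close>.\<close>

lemma ker_power_stable_of_ker_prime:
  assumes p: "irreducible p" and e: "lin e" "\<And>v. e (a v) = a (e v)" "locally_central e"
    and pe: "\<And>v. pact p (e v) = 0" and x0: "e x0 \<noteq> 0"
  shows "\<exists>n. \<forall>v. pact (p ^ Suc n) v = 0 \<longrightarrow> pact (p ^ n) v = 0"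
proof (rule ccontr)
  assume neg: "\<not> ?thesis"
  have ker0: "e v = 0" if v: "pact (p ^ n) v = 0" for n v
  proof -
    obtain u where u: "pact (p ^ Suc n) u = 0" "pact (p ^ n) u \<noteq> 0" using neg by blast
    have "p ^ Suc n \<noteq> 0" using p by auto
    then obtain f where f: "\<And>v. pact (p ^ Suc n) v = 0 \<Longrightarrow> e v = pact f v"
      using polynomial_on_kernel[OF e(1) trace_determined_prime_power[OF p e]] by metis
    have "p ^ Suc n dvd p * f"
    proof (rule ccontr)
      assume nd: "\<not> p ^ Suc n dvd p * f"
      have "p ^ (Suc n - 1) \<in> {h. pact h u = 0}"
      proof (rule ideal_contains_smaller_power[OF _ _ p _ _ nd])
        show "p ^ Suc n \<in> {h. pact h u = 0}" using u(1) by simp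
        show "p * f \<in> {h. pact h u = 0}" using pe[of u] f[OF u(1)] by (simp add: pact_mult)
      qed (simp_all add: pact_add pact_mult pact_v0)
      then show False using u(2) by simp
    qed
    moreover have "p \<noteq> 0" using p by auto
    ultimately have "p ^ n dvd f" by simp
    then have "pact f v = 0" using pact_dvd_0 v by blast
    moreover have "pact (p ^ Suc n) v = 0" using ker_power_mono[OF _ v, of "Suc n"] by simp
    ultimately show ?thesis using f by simp
  qed
  define w where "w = e x0"
  have w: "w \<noteq> 0" "pact p w = 0" using x0 pe by (simp_all add: w_def)
  obtain r where r: "fnl r" "\<And>A n. finite A \<Longrightarrow> \<exists>N u. N > 0 \<and> (\<forall>v. pact (p ^ n) v = 0 \<longrightarrow> pact (p ^ N) v = 0) \<and>
    pact (p ^ N) u = 0 \<and> r (pact (p ^ (N - 1)) u) \<noteq> 0 \<and>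
    (\<forall>y\<in>span A. pact (p ^ N) (pact (p ^ N) y) = 0 \<longrightarrow> pact (p ^ N) y = 0)"
    using primary_test_functional[OF w] by metis
  obtain A where A: "finite A" "\<And>x. lin x \<Longrightarrow> (\<And>y. y \<in> A \<Longrightarrow> x (a y) = a (x y)) \<Longrightarrow> r (x (e x0)) = r (e (x x0))"
    using locally_centralE[OF e(3) r(1), of x0] by metis
  from r(2)[OF A(1), of 1] obtain N u where Nu: "N > 0"
      "\<And>v. pact (p ^ 1) v = 0 \<Longrightarrow> pact (p ^ N) v = 0"
      "pact (p ^ N) u = 0" "r (pact (p ^ (N - 1)) u) \<noteq> 0"
      "\<And>y. y \<in> span A \<Longrightarrow> pact (p ^ N) (pact (p ^ N) y) = 0 \<Longrightarrow> pact (p ^ N) y = 0" by blast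
  obtain l where l: "fnl l" "l w = 1" using fnl_separates[of "{0}" w] w(1) subspace_single_0 by auto
  obtain l' where l': "fnl l'" "\<And>v. pact (p ^ N) v = 0 \<Longrightarrow> l' v = l v" "\<And>y. y \<in> A \<Longrightarrow> l' (pact (p ^ N) y) = 0"
    using functional_cut_off[OF l(1), of A "p ^ N"] Nu(5) by metis
  define s where "s k = l' ((a ^^ k) w)" for k
  have "r (pact (divdiff_poly (p ^ N) s) (pact q u)) = 0" for q
  proof -
    let ?x = "\<lambda>v. l' v *s pact q u"
    have gq: "pact (p ^ N) (pact q u) = 0" using Nu(3) pact_commute[of "p ^ N" q u] by (simp add: pact_v0)
    have lx: "lin ?x" by (intro lin_rank_one l'(1))
    have "r (divdiff (p ^ N) ?x (e x0)) = r (e (divdiff (p ^ N) ?x x0))"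
    proof (rule A(2)[OF lin_divdiff[OF lx]])
      fix y assume "y \<in> A"
      then have "a (divdiff (p ^ N) ?x y) - divdiff (p ^ N) ?x (a y) = 0"
        unfolding divdiff_commutator[OF lx] by (simp add: pact_vscale gq l'(3))
      then show "divdiff (p ^ N) ?x (a y) = a (divdiff (p ^ N) ?x y)" by simp
    qed
    moreover have "pact (p ^ N) (divdiff (p ^ N) ?x x0) = 0"
      unfolding divdiff_rank_one using gq by (metis pact_commute pact_v0)
    ultimately show ?thesis
      using ker0 by (simp add: divdiff_rank_one w_def[symmetric] s_def[abs_def] fnl_0[OF r(1)])
  qed
  then have "s 0 = 0" by (rule divdiff_poly_detects[OF p Nu(1) r(1) Nu(3,4)])
  moreover have "l' w = l w" using l'(2) Nu(2) w(2) by simp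
  ultimately show False using l(2) by (simp add: s_def)
qed

text \<open>The hypothesis on \<open>w\<close> says that \<open>w\<close> has order \<open>p^N\<close> modulo \<open>p^N V + K\<close> for every \<open>N\<close>; the
  functional is the last coordinate of the cyclic module that \<open>w\<close> generates there.\<close>

lemma functional_on_quotient:
  assumes p: "irreducible p" and N: "N > 0"
    and K: "subspace K" "\<And>h k. k \<in> K \<Longrightarrow> pact h k \<in> K"
    and w: "\<And>j y. pact (p ^ j) w - pact (p ^ Suc j) y \<notin> K"
  shows "\<exists>l. fnl l \<and> (\<forall>x. l (pact (p ^ N) x) = 0) \<and> (\<forall>k\<in>K. l k = 0) \<and>
    (\<forall>k<degree (p ^ N). l ((a ^^ k) w) = (if k = degree (p ^ N) - 1 then 1 else 0))"
proof -
  define g where "g = p ^ N"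
  define d where "d = degree g"
  have "p \<noteq> 0" using p by auto
  then have d: "d > 0" using N irreducible_degree_pos[OF p] by (simp add: d_def g_def degree_power_eq)
  define G where "G = {(k + pact g x + pact h w, coeff h (d - 1)) | k x h. k \<in> K \<and> degree h < d}"
  have GI: "(k + pact g x + pact h w, coeff h (d - 1)) \<in> G" if "k \<in> K" "degree h < d" for k x h
    unfolding G_def using that by blast
  have z: "(0, 0) \<in> G" using GI[of 0 0 0] d subspace_0[OF K(1)] by (simp add: pact_v0 pact_0)
  have pl: "(x + x', y + y') \<in> G" if xy: "(x, y) \<in> G" "(x', y') \<in> G" for x y x' y'
  proof -
    obtain k v h k' v' h' where *: "x = k + pact g v + pact h w" "y = coeff h (d - 1)"
      "x' = k' + pact g v' + pact h' w" "y' = coeff h' (d - 1)" "degree h < d" "degree h' < d"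
      "k \<in> K" "k' \<in> K" using xy unfolding G_def by auto
    have "x + x' = (k + k') + pact g (v + v') + pact (h + h') w" "y + y' = coeff (h + h') (d - 1)"
      by (simp_all add: * pact_vadd pact_add)
    moreover have "degree (h + h') < d" using *(5,6) by (rule degree_add_less)
    moreover have "k + k' \<in> K" using K(1) *(7,8) by (rule subspace_add)
    ultimately show ?thesis using GI by metis
  qed
  have m: "(c *s x, c * y) \<in> G" if xy: "(x, y) \<in> G" for c x y
  proof -
    obtain k v h where *: "x = k + pact g v + pact h w" "y = coeff h (d - 1)" "degree h < d" "k \<in> K"
      using xy unfolding G_def by auto
    have "c *s x = c *s k + pact g (c *s v) + pact (smult c h) w" "c * y = coeff (smult c h) (d - 1)"
      by (simp_all add: * pact_vscale pact_smult scale_right_distrib)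
    moreover have "degree (smult c h) < d" using *(3) degree_smult_le[of c h] by simp
    moreover have "c *s k \<in> K" using K(1) *(4) by (rule subspace_scale)
    ultimately show ?thesis using GI by metis
  qed
  have u: "y = 0" if y: "(0, y) \<in> G" for y
  proof -
    obtain k v h where *: "0 = k + pact g v + pact h w" "y = coeff h (d - 1)" "degree h < d" "k \<in> K"
      using y unfolding G_def by auto
    have "h = 0"
    proof (rule ccontr)
      assume "h \<noteq> 0"
      obtain i h' where i: "h = p ^ i * h'" "\<not> p dvd h'" using split_off_power[OF p \<open>h \<noteq> 0\<close>] .
      have "i < N"
      proof (rule ccontr)
        assume "\<not> i < N"
        then have "g dvd h" unfolding g_def i(1) by (simp add: le_imp_power_dvd)
        then have "d \<le> degree h" unfolding d_def using \<open>h \<noteq> 0\<close> by (rule dvd_imp_degree_le)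
        then show False using *(3) by simp
      qed
      obtain s t where st: "s * p ^ N + t * h' = 1" using irreducible_power_bezout[OF p i(2)] .
      have hw: "pact h w = - (k + pact g v)" using *(1) by (metis add.commute eq_neg_iff_add_eq_0)
      have "p ^ i = p ^ i * (s * p ^ N + t * h')" by (simp add: st)
      also have "\<dots> = g * (s * p ^ i) + t * h" unfolding g_def i(1) by (simp add: algebra_simps)
      finally have "pact (p ^ i) w = pact g (pact (s * p ^ i) w) + pact t (pact h w)"
        by (metis pact_add pact_mult)
      also have "pact t (pact h w) = - pact t k - pact g (pact t v)"
        unfolding hw lin_minus[OF lin_pact] pact_vadd pact_commute[of t g] by simp
      finally have "pact (p ^ i) w - pact g (pact (s * p ^ i) w - pact t v) = - pact t k"
        by (simp add: pact_vdiff)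
      moreover have "g = p ^ Suc i * p ^ (N - Suc i)"
        using \<open>i < N\<close> by (simp add: g_def power_add[symmetric] del: power_Suc)
      ultimately have "pact (p ^ i) w - pact (p ^ Suc i) (pact (p ^ (N - Suc i)) (pact (s * p ^ i) w - pact t v)) \<in> K"
        using subspace_neg[OF K(1) K(2)[OF *(4)]] by (metis pact_mult)
      then show False using w by blast
    qed
    then show ?thesis using *(2) by simp
  qed
  obtain l where l: "fnl l" "\<And>x y. (x, y) \<in> G \<Longrightarrow> l x = y" using fnl_relation_extend[OF z pl m u] by blast
  show ?thesis
  proof (intro exI[of _ l] conjI allI ballI impI)
    show "fnl l" by fact
    show "l (pact (p ^ N) x) = 0" for x
      using l(2)[OF GI[of 0 0 x]] d subspace_0[OF K(1)] by (simp add: pact_0 g_def)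
    show "l k = 0" if "k \<in> K" for k
      using l(2)[OF GI[of k 0 0]] d that by (simp add: pact_0 pact_v0)
    show "l ((a ^^ k) w) = (if k = degree (p ^ N) - 1 then 1 else 0)" if "k < degree (p ^ N)" for k
      using l(2)[OF GI[of 0 "monom 1 k" 0]] that subspace_0[OF K(1)]
      by (simp add: pact_v0 pact_monom degree_monom_eq d_def g_def)
  qed
qed

text \<open>The ascent of \<open>p(a)\<close> is finite; let \<open>K\<close> be the largest of the kernels.  If the descent is infinite,
  some \<open>v\<close> has unbounded order in the quotients of \<open>V\<close> by \<open>p^N V + K\<close>, and a functional on such a quotient
  gives an operator \<open>psi\<close> with \<open>psi v = u\<close>, up to a scalar, that vanishes on \<open>K\<close>, hence at \<open>e v\<close>.  It need
  not commute with \<open>a\<close>, but the error has its range in the span of \<open>p^N u\<close>.  Only finitely many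
  functionals see this error, and \<open>u\<close> can be chosen in the coset of \<open>x0\<close> modulo \<open>p V\<close>, where \<open>e\<close> is
  constant, such that they all vanish on \<open>p^N u\<close>.  Local centrality then forces \<open>e x0 = 0\<close>.\<close>

lemma drazin_of_ker_prime:
  assumes p: "irreducible p" and e: "lin e" "\<And>v. e (a v) = a (e v)" "locally_central e"
    and pe: "\<And>v. pact p (e v) = 0" and x0: "e x0 \<noteq> 0"
  shows "drazin_invertible p"
proof (rule ccontr)
  assume nd: "\<not> drazin_invertible p"
  obtain n where n: "\<And>v. pact (p ^ Suc n) v = 0 \<Longrightarrow> pact (p ^ n) v = 0"
    using ker_power_stable_of_ker_prime[OF assms] by blast
  have asc: "pact (p ^ Suc n) v = 0" if "pact (p ^ m) v = 0" for m v
    by (rule ker_power_mono[OF _ ker_power_stable[OF n that]]) simp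
  then have "\<exists>v. \<forall>w. pact (p ^ Suc n) v \<noteq> pact (p ^ Suc (Suc n)) w"
    using nd unfolding drazin_invertible_def by blast
  then obtain v where v: "\<And>w. pact (p ^ Suc n) v \<noteq> pact (p ^ Suc (Suc n)) w" by blast
  \<comment> \<open>the exponent is made positive so that \<open>K\<close> contains the kernel of \<open>p\<close>, hence the range of \<open>e\<close>\<close>
  define K where "K = {k. pact (p ^ Suc n) k = 0}"
  have K: "subspace K" unfolding K_def by (rule subspace_ker)
  have Kp: "pact h k \<in> K" if "k \<in> K" for h k
    using that pact_commute[of "p ^ Suc n" h k] unfolding K_def by (simp add: pact_v0)
  have eK: "e x \<in> K" for x
    using pe[of x] pact_dvd_0[of p "p ^ Suc n" "e x"] unfolding K_def by simp
  have vK: "pact (p ^ j) v - pact (p ^ Suc j) y \<notin> K" for j y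
  proof
    assume "pact (p ^ j) v - pact (p ^ Suc j) y \<in> K"
    moreover have "pact (p ^ j) v - pact (p ^ Suc j) y = pact (p ^ j) (v - pact p y)"
      by (simp only: pact_vdiff pact_mult[symmetric] power_Suc2)
    ultimately have "pact (p ^ (Suc n + j)) (v - pact p y) = 0"
      unfolding K_def by (simp only: pact_power_add) simp
    then have "pact (p ^ Suc n) (v - pact p y) = 0" by (rule asc)
    then have "pact (p ^ Suc n) v = pact (p ^ Suc (Suc n)) y"
      by (simp only: pact_vdiff pact_mult[symmetric] power_Suc2[of p "Suc n"]) simp
    then show False using v by blast
  qed
  obtain r where r: "fnl r" "r (e x0) = 1"
    using fnl_separates[of "{0}" "e x0"] x0 subspace_single_0 by auto
  obtain ys where ys: "\<forall>y\<in>set ys. fnl (fst y)" "\<forall>x. lin x \<longrightarrow> r (x (e v)) - r (e (x v)) =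
       (\<Sum>y\<leftarrow>ys. fst y (x (a (snd y)) - a (x (snd y))))"
    using e(3) r(1) unfolding locally_central_def by blast
  have "\<exists>M. \<forall>N\<ge>M. \<forall>x. \<exists>y. \<forall>s\<in>fst ` set ys. s (pact (p ^ N) x) = s (pact (p ^ Suc N) y)"
    by (rule functionals_see_powers_stabilise) (use ys(1) in auto)
  then obtain M where M: "\<And>N x. N \<ge> M \<Longrightarrow> \<exists>y. \<forall>s\<in>fst ` set ys. s (pact (p ^ N) x) = s (pact (p ^ Suc N) y)"
    by blast
  \<comment> \<open>\<open>N\<close> has to be positive for \<open>p^N\<close> to have a last coordinate\<close>
  define N where "N = Suc M"
  obtain y where y: "\<And>s. s \<in> fst ` set ys \<Longrightarrow> s (pact (p ^ N) x0) = s (pact (p ^ Suc N) y)"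
    using M[of N x0] unfolding N_def by auto
  define u where "u = x0 - pact p y"
  have su: "fst z (pact (p ^ N) u) = 0" if "z \<in> set ys" for z
  proof -
    have "pact (p ^ N) u = pact (p ^ N) x0 - pact (p ^ Suc N) y"
      unfolding u_def by (simp only: pact_vdiff pact_mult[symmetric] power_Suc2)
    then show ?thesis using y[of "fst z"] that ys(1) by (simp add: fnl_diff)
  qed
  have eu: "e u = e x0"
    unfolding u_def lin_diff[OF e(1)] using commute_pact[OF e(1,2), of p y] pe by simp
  have "N > 0" by (simp add: N_def)
  from functional_on_quotient[OF p this K Kp vK]
  obtain l where l: "fnl l" "\<And>x. l (pact (p ^ N) x) = 0" "\<And>k. k \<in> K \<Longrightarrow> l k = 0"
    "\<And>k. k < degree (p ^ N) \<Longrightarrow> l ((a ^^ k) v) = (if k = degree (p ^ N) - 1 then 1 else 0)"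
    by blast
  define g where "g = p ^ N"
  define d where "d = degree g"
  have "p \<noteq> 0" using p by auto
  then have d: "d > 0" "g \<noteq> 0"
    using \<open>N > 0\<close> irreducible_degree_pos[OF p] by (simp_all add: d_def g_def degree_power_eq)
  define psi where "psi = divdiff g (\<lambda>v. l v *s u)"
  have lx: "lin (\<lambda>v. l v *s u)" by (rule lin_rank_one[OF l(1)])
  have com: "fst z (psi (a (snd z)) - a (psi (snd z))) = 0" if z: "z \<in> set ys" for z
  proof -
    have fz: "fnl (fst z)" using ys(1) z by blast
    have "psi (a (snd z)) - a (psi (snd z)) = - (l (snd z) *s pact g u)"
      using divdiff_commutator[OF lx, of g "snd z"] l(2) unfolding psi_def g_def
      by (simp add: pact_vscale) (metis minus_diff_eq)
    then show ?thesis using su[OF z] by (simp add: fnl_minus[OF fz] fnl_scale[OF fz] g_def)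
  qed
  have "r (psi (e v)) - r (e (psi v)) = (\<Sum>y\<leftarrow>ys. fst y (psi (a (snd y)) - a (psi (snd y))))"
    using ys(2) lin_divdiff[OF lx] unfolding psi_def by blast
  also have "\<dots> = (\<Sum>y\<leftarrow>ys. 0)" by (rule sum_list_cong) (rule com)
  finally have eq: "r (psi (e v)) = r (e (psi v))" by simp
  have "l ((a ^^ k) (e v)) = 0" for k
    using l(3)[OF Kp[OF eK, of "monom 1 k"]] by (simp add: pact_monom)
  then have "psi (e v) = 0" unfolding psi_def divdiff_def by (simp add: pact_v0)
  moreover have "psi v = lead_coeff g *s u"
  proof -
    have "psi v = (\<Sum>k<d. l ((a ^^ k) v) *s pact (poly_shift (Suc k) g) u)"
      by (simp add: psi_def divdiff_def d_def pact_vscale)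
    also have "\<dots> = (\<Sum>k<d. if k = d - 1 then pact (poly_shift d g) u else 0)"
      using d(1) l(4) by (intro sum.cong) (auto simp: d_def g_def)
    also have "\<dots> = pact (poly_shift d g) u" using d(1) by simp
    also have "poly_shift d g = [:lead_coeff g:]"
      by (auto simp: poly_eq_iff coeff_poly_shift d_def coeff_pCons coeff_eq_0 split: nat.splits)
    finally show ?thesis by (simp add: pact_pCons pact_0 a_0)
  qed
  ultimately have "lead_coeff g * r (e x0) = 0"
    using eq by (simp add: lin_scale[OF e(1)] fnl_scale[OF r(1)] eu fnl_0[OF r(1)])
  then show False using r(2) d(2) by simp
qed


section \<open>Modules with a nontorsion vector\<close>

definition invariant :: "'v set \<Rightarrow> bool" where
  "invariant N \<longleftrightarrow> subspace N \<and> (\<forall>h. \<forall>v\<in>N. pact h v \<in> N)"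

lemma invariantD:
  assumes "invariant N"
  shows "0 \<in> N" "\<And>u v. u \<in> N \<Longrightarrow> v \<in> N \<Longrightarrow> u + v \<in> N" "\<And>u v. u \<in> N \<Longrightarrow> v \<in> N \<Longrightarrow> u - v \<in> N"
    "\<And>h v. v \<in> N \<Longrightarrow> pact h v \<in> N"
  using assms unfolding invariant_def by (auto intro: subspace_0 subspace_add subspace_diff)

lemma invariant_plus_cyclic:
  assumes N: "invariant N"
  shows "invariant {n + pact q y | n q. n \<in> N}"
  unfolding invariant_def subspace_def
proof (intro conjI ballI allI)
  have "0 + pact 0 y \<in> {n + pact q y | n q. n \<in> N}" using invariantD(1)[OF N] by blast
  then show "0 \<in> {n + pact q y | n q. n \<in> N}" by (simp add: pact_0)
next
  fix u v assume "u \<in> {n + pact q y | n q. n \<in> N}" "v \<in> {n + pact q y | n q. n \<in> N}"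
  then obtain n q n' q' where "u = n + pact q y" "v = n' + pact q' y" "n \<in> N" "n' \<in> N" by blast
  moreover from this have "u + v = (n + n') + pact (q + q') y" by (simp add: pact_add)
  ultimately show "u + v \<in> {n + pact q y | n q. n \<in> N}" using invariantD(2)[OF N] by blast
next
  fix c u assume "u \<in> {n + pact q y | n q. n \<in> N}"
  then obtain n q where "u = n + pact q y" "n \<in> N" by blast
  then have "c *s u = pact [:c:] n + pact (smult c q) y"
    by (simp add: pact_pCons pact_0 a_0 pact_smult scale_right_distrib)
  then show "c *s u \<in> {n + pact q y | n q. n \<in> N}" using invariantD(4)[OF N \<open>n \<in> N\<close>] by blast
next
  fix h u assume "u \<in> {n + pact q y | n q. n \<in> N}"
  then obtain n q where "u = n + pact q y" "n \<in> N" by blast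
  then have "pact h u = pact h n + pact (h * q) y" by (simp add: pact_vadd pact_mult)
  then show "pact h u \<in> {n + pact q y | n q. n \<in> N}" using invariantD(4)[OF N \<open>n \<in> N\<close>] by blast
qed

text \<open>Up to multiplication by a nonzero polynomial, the finitely many vectors of \<open>A\<close> lie in a direct sum of
  an invariant subspace \<open>N\<close> and the cyclic module of \<open>v0\<close>: a vector with no multiple in this sum can be
  thrown into \<open>N\<close>.\<close>

lemma cyclic_complement:
  assumes N0: "invariant N0" "\<forall>k. pact k v0 \<in> N0 \<longrightarrow> k = 0" and "finite A"
  shows "\<exists>N h. invariant N \<and> N0 \<subseteq> N \<and> (\<forall>k. pact k v0 \<in> N \<longrightarrow> k = 0) \<and> h \<noteq> 0 \<and>
    (\<forall>y\<in>A. \<exists>k. pact h y - pact k v0 \<in> N)"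
  using \<open>finite A\<close>
proof (induction A)
  case empty
  show ?case using N0 by (intro exI[of _ N0] exI[of _ 1]) auto
next
  case (insert y A)
  then obtain N h where N: "invariant N" "N0 \<subseteq> N" "\<And>k. pact k v0 \<in> N \<Longrightarrow> k = 0" "h \<noteq> 0"
    "\<And>y. y \<in> A \<Longrightarrow> \<exists>k. pact h y - pact k v0 \<in> N" by blast
  show ?case
  proof (cases "\<exists>h' k. h' \<noteq> 0 \<and> pact h' y - pact k v0 \<in> N")
    case True
    then obtain h' k where h': "h' \<noteq> 0" "pact h' y - pact k v0 \<in> N" by blast
    have "\<exists>k. pact (h' * h) z - pact k v0 \<in> N" if z: "z \<in> insert y A" for z
    proof (cases "z = y")
      case True
      have "pact (h' * h) y - pact (h * k) v0 = pact h (pact h' y - pact k v0)"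
        by (simp add: pact_mult pact_vdiff pact_commute[of h' h])
      then show ?thesis using invariantD(4)[OF N(1) h'(2)] True by metis
    next
      case False
      then obtain j where j: "pact h z - pact j v0 \<in> N" using N(5) z by blast
      have "pact (h' * h) z - pact (h' * j) v0 = pact h' (pact h z - pact j v0)"
        by (simp add: pact_mult pact_vdiff)
      then show ?thesis using invariantD(4)[OF N(1) j] by metis
    qed
    then show ?thesis using N h'(1) by (intro exI[of _ N] exI[of _ "h' * h"]) auto
  next
    case False
    define N' where "N' = {n + pact q y | n q. n \<in> N}"
    have N'I: "n + pact q y \<in> N'" if "n \<in> N" for n q unfolding N'_def using that by blast
    have sub: "N \<subseteq> N'" using N'I[where q = 0] by (auto simp: pact_0)
    have "k = 0" if k: "pact k v0 \<in> N'" for k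
    proof -
      obtain n q where n: "pact k v0 = n + pact q y" "n \<in> N" using k unfolding N'_def by blast
      then have "pact q y - pact k v0 = 0 - n" by simp
      also have "\<dots> \<in> N" using invariantD(1,3)[OF N(1)] n(2) by blast
      finally have "q = 0" using False by blast
      then have "pact k v0 \<in> N" using n by (simp add: pact_0)
      then show ?thesis by (rule N(3))
    qed
    moreover have "\<exists>k. pact h z - pact k v0 \<in> N'" if z: "z \<in> insert y A" for z
    proof (cases "z = y")
      case True
      have "pact h y - pact 0 v0 \<in> N'" using N'I[of 0 h] invariantD(1)[OF N(1)] by (simp add: pact_0)
      then show ?thesis using True by blast
    next
      case False
      then show ?thesis using N(5) z sub by blast
    qed
    moreover have "invariant N'" unfolding N'_def by (rule invariant_plus_cyclic[OF N(1)])
    ultimately show ?thesis using N(2,4) sub by (intro exI[of _ N'] exI[of _ h]) auto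
  qed
qed

text \<open>The map kills \<open>N\<close> and divides by \<open>h\<close>: it sends \<open>v0\<close> to \<open>h(a) w\<close>, and a vector \<open>y\<close> whose multiple
  \<open>h(a) y\<close> has the coordinate \<open>k\<close> along \<open>v0\<close> to \<open>k(a) w\<close>.\<close>

lemma map_along_cyclic:
  assumes N: "invariant N" "\<forall>k. pact k v0 \<in> N \<longrightarrow> k = 0"
  shows "\<exists>psi. lin psi \<and> (\<forall>y k. pact h y - pact k v0 \<in> N \<longrightarrow> psi y = pact k w)"
proof -
  define G where "G = {(y, pact k w) | y k. pact h y - pact k v0 \<in> N}"
  have GI: "(y, pact k w) \<in> G" if "pact h y - pact k v0 \<in> N" for y k unfolding G_def using that by blast
  have z: "(0, 0) \<in> G" using GI[of 0 0] invariantD(1)[OF N(1)] by (simp add: pact_0 pact_v0)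
  have p: "(x + x', y + y') \<in> G" if xy: "(x, y) \<in> G" "(x', y') \<in> G" for x y x' y'
  proof -
    obtain k k' where *: "y = pact k w" "pact h x - pact k v0 \<in> N" "y' = pact k' w" "pact h x' - pact k' v0 \<in> N"
      using xy unfolding G_def by blast
    have "pact h (x + x') - pact (k + k') v0 = (pact h x - pact k v0) + (pact h x' - pact k' v0)"
      by (simp add: pact_vadd pact_add)
    then have "pact h (x + x') - pact (k + k') v0 \<in> N" using invariantD(2)[OF N(1) *(2,4)] by simp
    from GI[OF this] show ?thesis by (simp add: * pact_add)
  qed
  have m: "(c *s x, c *s y) \<in> G" if xy: "(x, y) \<in> G" for c x y
  proof -
    obtain k where *: "y = pact k w" "pact h x - pact k v0 \<in> N" using xy unfolding G_def by blast
    have "pact h (c *s x) - pact (smult c k) v0 = pact [:c:] (pact h x - pact k v0)"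
      by (simp add: pact_vscale pact_smult pact_pCons pact_0 a_0 scale_right_diff_distrib)
    then have "pact h (c *s x) - pact (smult c k) v0 \<in> N" using invariantD(4)[OF N(1) *(2)] by simp
    from GI[OF this] show ?thesis by (simp add: * pact_smult)
  qed
  have u: "y = 0" if y: "(0, y) \<in> G" for y
  proof -
    obtain k where *: "y = pact k w" "pact h 0 - pact k v0 \<in> N" using y unfolding G_def by blast
    have "pact k v0 = 0 - (pact h 0 - pact k v0)" by (simp add: pact_v0)
    also have "\<dots> \<in> N" using invariantD(1,3)[OF N(1)] *(2) by blast
    finally have "k = 0" using N(2) by blast
    then show ?thesis using * by (simp add: pact_0)
  qed
  obtain psi where psi: "lin psi" "\<And>x y. (x, y) \<in> G \<Longrightarrow> psi x = y" using lin_relation_extend[OF z p m u] by blast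
  show ?thesis
  proof (intro exI[of _ psi] conjI allI impI)
    show "lin psi" by fact
    show "psi y = pact k w" if "pact h y - pact k v0 \<in> N" for y k by (rule psi(2)[OF GI[OF that]])
  qed
qed

text \<open>Local centrality at \<open>v0\<close> and \<open>r\<close>, tested on a map that kills \<open>c v0\<close> and sends \<open>v0\<close> to \<open>h(a) w\<close> for an
  arbitrary \<open>w\<close>, gives \<open>r (h(a) c w) = 0\<close>.  Here \<open>h\<close> depends on \<open>r\<close>; a common annihilator exists because a
  space whose dual is torsion is bounded.\<close>

lemma bounded_if_vanishes_beside_nontorsion:
  assumes c: "lin c" "\<And>v. c (a v) = a (c v)" "locally_central c"
    and N0: "invariant N0" "\<forall>k. pact k v0 \<in> N0 \<longrightarrow> k = 0" and v0: "c v0 \<in> N0"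
  obtains k where "k \<noteq> 0" "\<And>w. pact k (c w) = 0"
proof -
  have sub: "subspace (range c)"
    unfolding subspace_def
  proof (intro conjI ballI allI)
    show "0 \<in> range c" using lin_0[OF c(1)] by (metis rangeI)
    show "x + y \<in> range c" if "x \<in> range c" "y \<in> range c" for x y
      using that lin_add[OF c(1)] by (metis (no_types, lifting) image_iff rangeI)
    show "t *s x \<in> range c" if "x \<in> range c" for t x
      using that lin_scale[OF c(1)] by (metis (no_types, lifting) image_iff rangeI)
  qed
  have inv: "a w \<in> range c" if "w \<in> range c" for w using that c(2) by (metis image_iff rangeI)
  have dual: "\<exists>h. h \<noteq> 0 \<and> (\<forall>w\<in>range c. r (pact h w) = 0)" if r: "fnl r" for r
  proof -
    obtain A where A: "finite A" "\<And>x. lin x \<Longrightarrow> (\<And>y. y \<in> A \<Longrightarrow> x (a y) = a (x y)) \<Longrightarrow> r (x (c v0)) = r (c (x v0))"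
      using locally_centralE[OF c(3) r, of v0] by metis
    obtain N h where N: "invariant N" "N0 \<subseteq> N" "\<forall>k. pact k v0 \<in> N \<longrightarrow> k = 0" "h \<noteq> 0"
      "\<forall>y\<in>A. \<exists>k. pact h y - pact k v0 \<in> N"
      using cyclic_complement[OF N0 A(1)] by blast
    have "r (pact h (c w)) = 0" for w
    proof -
      obtain psi where psi: "lin psi" "\<And>y k. pact h y - pact k v0 \<in> N \<Longrightarrow> psi y = pact k w"
        using map_along_cyclic[OF N(1,3)] by blast
      have "r (psi (c v0)) = r (c (psi v0))"
      proof (rule A(2)[OF psi(1)])
        fix y assume "y \<in> A"
        then obtain k where k: "pact h y - pact k v0 \<in> N" using N(5) by blast
        have "pact h (a y) - pact (pCons 0 k) v0 = pact (pCons 0 1) (pact h y - pact k v0)"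
          by (simp add: pact_pCons pact_a pact_1 a_diff)
        then have "pact h (a y) - pact (pCons 0 k) v0 \<in> N" using invariantD(4)[OF N(1) k] by simp
        then have "psi (a y) = pact (pCons 0 k) w" by (rule psi(2))
        then show "psi (a y) = a (psi y)" using psi(2)[OF k] by (simp add: pact_pCons)
      qed
      moreover have "psi (c v0) = 0"
        using psi(2)[of "c v0" 0] invariantD(4)[OF N(1), of "c v0" h] v0 N(2) by (auto simp: pact_0)
      moreover have "psi v0 = pact h w" using psi(2)[of v0 h] invariantD(1)[OF N(1)] by simp
      ultimately show ?thesis using commute_pact[OF c(1,2), of h w] by (simp add: fnl_0[OF r])
    qed
    then show ?thesis using N(4) by blast
  qed
  obtain k where "k \<noteq> 0" "\<And>w. w \<in> range c \<Longrightarrow> pact k w = 0"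
  proof (rule dual_torsion_bounded[OF sub])
    show "a w \<in> range c" if "w \<in> range c" for w using inv that .
    show "\<exists>h. h \<noteq> 0 \<and> (\<forall>w\<in>range c. l (pact h w) = 0)" if "fnl l" for l using dual that .
  qed blast
  then show thesis using that by blast
qed

lemma bicomm_pact_comp: "bicomm c \<Longrightarrow> bicomm (\<lambda>v. pact f (c v))"
  unfolding bicomm_def using lin_comp[OF lin_pact] commute_pact by metis

lemma bicomm_diff_pact: "bicomm c \<Longrightarrow> bicomm (\<lambda>v. c v - pact h v)"
  unfolding bicomm_def
proof (intro conjI allI impI)
  fix x v assume c: "lin c \<and> (\<forall>x. lin x \<longrightarrow> (\<forall>v. x (a v) = a (x v)) \<longrightarrow> (\<forall>v. c (x v) = x (c v)))"
    and x: "lin x" "\<forall>v. x (a v) = a (x v)"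
  then show "c (x v) - pact h (x v) = x (c v - pact h v)"
    using commute_pact[of x h v] by (simp add: lin_diff)
qed (simp add: lin_minus_fun lin_pact)

text \<open>If \<open>v0\<close> and \<open>b v0\<close> are dependent over the polynomials, \<open>f b v0 = h v0\<close>, then \<open>f b - h\<close> kills the nontorsion
  vector \<open>v0\<close> and is therefore annihilated by a polynomial.  If not, \<open>b v0\<close> spans a cyclic module
  independent of \<open>v0\<close>, and \<open>b\<close> itself is annihilated.\<close>

lemma bicomm_is_fraction:
  assumes central: "\<And>c. bicomm c \<Longrightarrow> locally_central c"
    and b: "bicomm b" and v0: "\<And>h. h \<noteq> 0 \<Longrightarrow> pact h v0 \<noteq> 0"
  shows "\<exists>f h. f \<noteq> 0 \<and> (\<forall>v. pact f (b v) = pact h v)"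
proof (cases "\<exists>f h. f \<noteq> 0 \<and> pact f (b v0) = pact h v0")
  case True
  then obtain f h where f: "f \<noteq> 0" "pact f (b v0) = pact h v0" by blast
  define c where "c v = pact f (b v) - pact h v" for v
  have bc: "bicomm c" unfolding c_def[abs_def] by (intro bicomm_diff_pact bicomm_pact_comp b)
  have i: "invariant {0}" by (simp add: invariant_def subspace_single_0 pact_v0)
  have nt: "\<forall>k. pact k v0 \<in> {0} \<longrightarrow> k = 0" using v0 by blast
  have "c v0 \<in> {0}" using f(2) by (simp add: c_def)
  from bounded_if_vanishes_beside_nontorsion[OF bicomm_lin[OF bc] bicomm_commute[OF bc] central[OF bc] i nt this]
  obtain k where k: "k \<noteq> 0" "\<And>w. pact k (c w) = 0" by metis
  have "pact (k * f) (b v) = pact (k * h) v" for v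
    using k(2)[of v] by (simp add: c_def pact_vdiff pact_mult)
  moreover have "k * f \<noteq> 0" using k(1) f(1) by simp
  ultimately show ?thesis by blast
next
  case False
  define N0 where "N0 = {n + pact q (b v0) | n q. n \<in> {0}}"
  have "invariant {0}" by (simp add: invariant_def subspace_single_0 pact_v0)
  then have i: "invariant N0" unfolding N0_def by (rule invariant_plus_cyclic)
  have nt: "\<forall>k. pact k v0 \<in> N0 \<longrightarrow> k = 0"
  proof (intro allI impI)
    fix k assume k: "pact k v0 \<in> N0"
    obtain q where q: "pact k v0 = pact q (b v0)" using k unfolding N0_def by auto
    then have "q = 0" using False by metis
    then show "k = 0" using q v0[of k] by (auto simp: pact_0)
  qed
  have "0 + pact 1 (b v0) \<in> N0" unfolding N0_def by blast
  then have "b v0 \<in> N0" by (simp add: pact_1)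
  from bounded_if_vanishes_beside_nontorsion[OF bicomm_lin[OF b] bicomm_commute[OF b] central[OF b] i nt this]
  obtain k where k: "k \<noteq> 0" "\<And>w. pact k (b w) = 0" by metis
  then have "\<forall>v. pact k (b v) = pact 0 v" by (simp add: pact_0)
  then show ?thesis using k(1) by blast
qed

text \<open>Remove an irreducible factor \<open>p\<close> of \<open>f = p f1\<close>.  If \<open>p(a)\<close> is Drazin invertible, pass to \<open>p(a) b\<close>.  If not,
  then \<open>p\<close> divides \<open>h = p h1\<close>, and \<open>e = f1 b - h1\<close>, which \<open>p\<close> annihilates, has to vanish, so that \<open>p\<close>
  cancels.\<close>

lemma range_contained_fraction:
  assumes central: "\<And>c. bicomm c \<Longrightarrow> locally_central c"
    and "bicomm b" "f \<noteq> 0" "\<And>v. pact f (b v) = pact h v"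
  shows "range_contained b"
  using assms(2-)
proof (induction "degree f" arbitrary: f b h rule: less_induct)
  case less
  note b = bicomm_lin[OF less.prems(1)] bicomm_commute[OF less.prems(1)] central[OF less.prems(1)]
  show ?case
  proof (cases "degree f = 0")
    case True
    then obtain c where f: "f = [:c:]" using degree_eq_zeroE by blast
    then have "c \<noteq> 0" using less.prems(2) by auto
    have cb: "c *s b v = pact h v" for v using less.prems(3)[of v] f by (simp add: pact_pCons pact_0 a_0)
    have "b v = pact (smult (inverse c) h) v" for v
      unfolding pact_smult cb[symmetric] using \<open>c \<noteq> 0\<close> by simp
    then have "b = pact (smult (inverse c) h)" by blast
    then show ?thesis by (simp add: range_contained_pact)
  next
    case False
    then obtain p where p: "irreducible p" "p dvd f" using ex_irreducible_dvd by blast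
    then obtain f1 where f1: "f = p * f1" by auto
    then have nz: "p \<noteq> 0" "f1 \<noteq> 0" using less.prems(2) by auto
    then have deg: "degree f1 < degree f" using irreducible_degree_pos[OF p(1)] by (simp add: f1 degree_mult_eq)
    have pf: "pact p (pact f1 (b v)) = pact h v" for v using less.prems(3)[of v] by (simp add: f1 pact_mult)
    show ?thesis
    proof (cases "drazin_invertible p")
      case True
      show ?thesis
      proof (rule range_contained_divide[OF b(1,2) _ True])
        show "\<exists>k. \<forall>v. pact (p ^ n) v = 0 \<longrightarrow> b v = pact k v" for n
        proof -
          have "p ^ n \<noteq> 0" using nz(1) by simp
          from polynomial_on_kernel[OF b(1) trace_determined_prime_power[OF p(1) b] this]
          show ?thesis by metis
        qed
        show "range_contained (\<lambda>v. pact p (b v))"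
        proof (rule less.hyps[OF deg bicomm_pact_comp[OF less.prems(1)] nz(2)])
          show "pact f1 (pact p (b v)) = pact h v" for v using pf[of v] by (simp add: pact_commute[of f1 p])
        qed
      qed
    next
      case False
      have "p dvd h"
      proof (rule ccontr)
        assume "\<not> p dvd h"
        then obtain u v where uv: "u * p + v * h = 1" using irreducible_coprime_bezout[OF p(1)] by metis
        \<comment> \<open>if \<open>p\<close> does not divide \<open>h\<close>, it acts bijectively, by the Bezout identity and \<open>h = p f1 b\<close>\<close>
        have inv: "x = pact p (pact u x + pact v (pact f1 (b x)))" for x
        proof -
          have "x = pact (u * p + v * h) x" by (simp add: uv pact_1)
          also have "\<dots> = pact p (pact u x) + pact v (pact p (pact f1 (b x)))"
            by (simp add: pact_add pact_mult pf pact_commute[of u p])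
          finally show ?thesis by (simp add: pact_vadd pact_commute[of v p])
        qed
        have inj: "x = 0" if "pact p x = 0" for x
        proof -
          have "pact f1 (b (pact p x)) = pact p (pact f1 (b x))"
            by (simp add: commute_pact[OF b(1,2)] pact_commute[of p f1])
          then have "pact p (pact f1 (b x)) = 0" using that by (simp add: lin_0[OF b(1)] pact_v0)
          then show ?thesis using inv[of x] that
            by (simp add: pact_vadd pact_commute[of p u] pact_commute[of p v] pact_v0)
        qed
        have "drazin_invertible p" unfolding drazin_invertible_def
        proof (intro exI[of _ 1] conjI allI impI)
          show "pact (p ^ 1) x = 0" if "pact (p ^ Suc 1) x = 0" for x using inj that by (simp add: pact_mult)
          show "\<exists>w. pact (p ^ 1) x = pact (p ^ Suc 1) w" for x
            using inv[of x] by (simp add: pact_mult) metis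
        qed simp
        with False show "False" by blast
      qed
      then obtain h1 where h1: "h = p * h1" by auto
      define e where "e v = pact f1 (b v) - pact h1 v" for v
      have be: "bicomm e" unfolding e_def[abs_def] by (intro bicomm_diff_pact bicomm_pact_comp less.prems(1))
      have pe: "pact p (e v) = 0" for v using pf[of v] by (simp add: e_def pact_vdiff h1 pact_mult)
      have "e v = 0" for v
        using drazin_of_ker_prime[OF p(1) bicomm_lin[OF be] bicomm_commute[OF be] central[OF be] pe] False
        by blast
      then have "pact f1 (b v) = pact h1 v" for v by (simp add: e_def)
      then show ?thesis by (rule less.hyps[OF deg less.prems(1) nz(2)])
    qed
  qed
qed

lemma range_contained_bicomm:
  assumes central: "\<And>c. bicomm c \<Longrightarrow> locally_central c" and b: "bicomm b"
  shows "range_contained b"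
proof (cases "\<forall>v. \<exists>h. h \<noteq> 0 \<and> pact h v = 0")
  case True
  then have "{v. \<exists>h. h \<noteq> 0 \<and> pact h v = 0} = UNIV" by blast
  then have "trace_determined b UNIV"
    using trace_determined_torsion[OF bicomm_lin[OF b] bicomm_commute[OF b] central[OF b]] by simp
  then show ?thesis using range_contained_torsion[OF bicomm_lin[OF b]] True by blast
next
  case False
  then obtain v0 where "\<And>h. h \<noteq> 0 \<Longrightarrow> pact h v0 \<noteq> 0" by blast
  from bicomm_is_fraction[OF central b this] obtain f h where "f \<noteq> 0" "\<And>v. pact f (b v) = pact h v"
    by blast
  from range_contained_fraction[OF central b this] show ?thesis .
qed

end

theorem theorem4p3:
  fixes scale :: "'f::field \<Rightarrow> 'v::ab_group_add \<Rightarrow> 'v"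
    and a b :: "'v \<Rightarrow> 'v"
  assumes "vector_space scale"
    and "a \<in> linops scale"
    and "b \<in> linops scale"
    and "bicommutant (dual scale) (dual_linops scale) (adjoint scale a)
           = {adjoint scale c | c. c \<in> bicommutant UNIV (linops scale) a}"
    and "b \<in> bicommutant UNIV (linops scale) a"
  shows "derivation b ` linops scale \<subseteq> derivation a ` linops scale"
proof -
  interpret endo scale a
    using assms(1,2) by (simp add: endo_def endo_axioms_def linops_def)
  have central: "locally_central c" if c: "bicomm c" for c
  proof (rule locally_central_of_adjoint[OF bicomm_lin[OF c]])
    show "adjoint scale c \<in> bicommutant (dual scale) (dual_linops scale) (adjoint scale a)"
      unfolding assms(4) using c by (auto simp: bicommutant_eq)
  qed
  have "bicomm b" using assms(5) by (simp add: bicommutant_eq)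
  with central have rc: "range_contained b" by (rule range_contained_bicomm)
  show ?thesis
  proof
    fix y assume "y \<in> derivation b ` linops scale"
    then obtain x where x: "lin x" "y = derivation b x" by (auto simp: linops_def)
    obtain z where z: "lin z" "\<And>v. a (z v) - z (a v) = b (x v) - x (b v)"
      using range_containedD[OF rc x(1)] by metis
    then have "y = derivation a z" by (simp add: x(2) derivation_def fun_eq_iff)
    with z(1) show "y \<in> derivation a ` linops scale" by (auto simp: linops_def)
  qed
qed


end
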